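(* (Cauchy identities.) Let $x=(x_1,x_2,\ldots)$ and $y=(y_1,y_2,\ldots)$ be two infinite sequences of independent commuting variables. Then, as formal power series, $$\sum_\lambda s_\lambda(x)s_\lambda(y)=\sum_\lambda m_\lambda(x)h_\lambda(y)=\prod_{i,j}\frac{1}{1-x_iy_j}$$ and $$\sum_\lambda s_\lambda(x)s_{\lambda'}(y)=\sum_\lambda m_\lambda(x)e_\lambda(y)=\prod_{i,j}(1+x_iy_j),$$ where the sums are taken over all partitions $\lambda$, and $\lambda'$ denotes the conjugate partition of $\lambda$.
   Context: $h_r(x)$ and $e_r(x)$ are the complete and elementary symmetric functions: $\sum_{r\ge 0}h_r(x)t^r=\prod_i(1-x_it)^{-1}$ and $\sum_{r\ge 0}e_r(x)t^r=\prod_i(1+x_it)$, with $h_r=e_r=0$ for $r<0$. For an integer sequence $\alpha$ with finitely many nonzero terms, $h_\alpha=\prod_i h_{\alpha_i}$ and $e_\alpha=\prod_i e_{\alpha_i}$. The monomial symmetric function is $m_\lambda(x)=\sum_\alpha x^\alpha$, summed over all distinct permutations $\alpha$ of $\lambda=(\lambda_1,\lambda_2,\ldots)$. For $i<j$ let $R_{ij}(\alpha)=(\alpha_1,\ldots,\alpha_i+1,\ldots,\alpha_j-1,\ldots)$, and for a monomial $R$ in the $R_{ij}$ let $R\,h_\alpha:=h_{R\alpha}$ (the operator acts on the index). The Schur function is defined by $s_\alpha:=\prod_{i<j}(1-R_{ij})\,h_\alpha=\det(h_{\alpha_i+j-i})_{1\le i,j\le\ell}$, where $\ell$ is the largest index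 with $\alpha_\ell\ne 0$. The conjugate partition is given by $\lambda'_i=\#\{j\mid\lambda_j\ge i\}$. *)

theory Defs
  imports "HOL-Analysis.Analysis" "HOL-Library.Poly_Mapping"
begin

section \<open>Formal power series in an arbitrary set of commuting variables\<close>

text \<open>
  A power series over the integers with variables in \<^typ>\<open>'v\<close> is an arbitrary integer-valued
  function on the monomials, a monomial being a finitely supported exponent vector of
  type \<^typ>\<open>'v \<Rightarrow>\<^sub>0 nat\<close>.
\<close>

typedef 'v mps = "UNIV :: (('v \<Rightarrow>\<^sub>0 nat) \<Rightarrow> int) set"
  morphisms mps_coeff Abs_mps by simp

setup_lifting type_definition_mps

lemma mps_eqI: "(\<And>m. mps_coeff f m = mps_coeff g m) \<Longrightarrow> f = g"
  by transfer auto

lemma finite_splittings: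
  fixes m :: "'v \<Rightarrow>\<^sub>0 nat"
  shows "finite {(a, b). a + b = m}"
proof -
  let ?r = "\<lambda>a :: 'v \<Rightarrow>\<^sub>0 nat. restrict (Poly_Mapping.lookup a) (Poly_Mapping.keys m)"
  let ?A = "{a. \<exists>b. a + b = m}"
  have le: "Poly_Mapping.lookup a k \<le> Poly_Mapping.lookup m k" if "a \<in> ?A" for a k
    using that by (auto simp: lookup_add)
  have "?r ` ?A \<subseteq> PiE (Poly_Mapping.keys m) (\<lambda>k. {..Poly_Mapping.lookup m k})"
    using le by (auto simp: lookup_add)
  moreover have "finite (PiE (Poly_Mapping.keys m) (\<lambda>k. {..Poly_Mapping.lookup m k}))"
    by (intro finite_PiE) auto
  ultimately have fin: "finite (?r ` ?A)"
    by (rule finite_subset)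
  have "inj_on ?r ?A"
  proof (rule inj_onI)
    fix a a' assume A: "a \<in> ?A" "a' \<in> ?A" and eq: "?r a = ?r a'"
    show "a = a'"
    proof (rule poly_mapping_eqI)
      fix k
      show "Poly_Mapping.lookup a k = Poly_Mapping.lookup a' k"
      proof (cases "k \<in> Poly_Mapping.keys m")
        case True
        then show ?thesis using fun_cong[OF eq, of k] by simp
      next
        case False
        then show ?thesis using le[OF A(1), of k] le[OF A(2), of k] by (simp add: in_keys_iff)
      qed
    qed
  qed
  with fin have "finite ?A"
    by (rule finite_imageD)
  moreover have "{(a, b). a + b = m} \<subseteq> (\<lambda>a. (a, m - a)) ` ?A"
    by (auto simp: image_iff)
  ultimately show ?thesis
    by (meson finite_imageI finite_subset)
qed

instantiation mps :: (type) comm_ring_1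
begin

lift_definition zero_mps :: "'a mps" is "\<lambda>_. 0" .
lift_definition one_mps :: "'a mps" is "\<lambda>m. if m = 0 then 1 else 0" .
lift_definition plus_mps :: "'a mps \<Rightarrow> 'a mps \<Rightarrow> 'a mps" is "\<lambda>f g m. f m + g m" .
lift_definition minus_mps :: "'a mps \<Rightarrow> 'a mps \<Rightarrow> 'a mps" is "\<lambda>f g m. f m - g m" .
lift_definition uminus_mps :: "'a mps \<Rightarrow> 'a mps" is "\<lambda>f m. - f m" .
lift_definition times_mps :: "'a mps \<Rightarrow> 'a mps \<Rightarrow> 'a mps"
  is "\<lambda>f g m. \<Sum>(a, b) | a + b = m. f a * g b" .

instance
proof
  fix f g h :: "'a mps"
  show "f * g * h = f * (g * h)"
  proof (transfer, rule ext)
    fix f g h :: "('a \<Rightarrow>\<^sub>0 nat) \<Rightarrow> int" and m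
    have "(\<Sum>(p, c) | p + c = m. (\<Sum>(a, b) | a + b = p. f a * g b) * h c)
        = (\<Sum>((p, c), (a, b)) \<in> Sigma {(p, c). p + c = m} (\<lambda>(p, c). {(a, b). a + b = p}).
             f a * g b * h c)"
      by (subst sum.Sigma[symmetric])
         (auto simp: finite_splittings finite_splittings[unfolded case_prod_unfold] sum_distrib_right case_prod_unfold intro!: sum.cong)
    also have "\<dots> = (\<Sum>((a, q), (b, c)) \<in> Sigma {(a, q). a + q = m} (\<lambda>(a, q). {(b, c). b + c = q}).
             f a * (g b * h c))"
      by (rule sum.reindex_bij_witness[where
            i = "\<lambda>((a, q), (b, c)). ((a + b, c), (a, b))" and
            j = "\<lambda>((p, c), (a, b)). ((a, b + c), (b, c))"]) (auto simp: ac_simps)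
    also have "\<dots> = (\<Sum>(a, q) | a + q = m. f a * (\<Sum>(b, c) | b + c = q. g b * h c))"
      by (subst sum.Sigma[symmetric])
         (auto simp: finite_splittings finite_splittings[unfolded case_prod_unfold] sum_distrib_left case_prod_unfold intro!: sum.cong)
    finally show "(\<Sum>(p, c) | p + c = m. (\<Sum>(a, b) | a + b = p. f a * g b) * h c)
        = (\<Sum>(a, q) | a + q = m. f a * (\<Sum>(b, c) | b + c = q. g b * h c))" .
  qed
  show "f * g = g * f"
  proof (transfer, rule ext)
    fix f g :: "('a \<Rightarrow>\<^sub>0 nat) \<Rightarrow> int" and m
    show "(\<Sum>(a, b) | a + b = m. f a * g b) = (\<Sum>(a, b) | a + b = m. g a * f b)"
      by (rule sum.reindex_bij_witness[where i = prod.swap and j = prod.swap])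
         (auto simp: ac_simps)
  qed
  show "1 * f = f"
  proof (transfer, rule ext)
    fix f :: "('a \<Rightarrow>\<^sub>0 nat) \<Rightarrow> int" and m
    have "(\<Sum>(a, b) | a + b = m. (if a = 0 then 1 else 0) * f b)
        = (\<Sum>(a, b) \<in> {(0 :: 'a \<Rightarrow>\<^sub>0 nat, m)}. (if a = 0 then 1 else 0) * f b)"
      by (rule sum.mono_neutral_right) (auto simp: finite_splittings split: if_splits)
    then show "(\<Sum>(a, b) | a + b = m. (if a = 0 then 1 else 0) * f b) = f m"
      by simp
  qed
  show "(f + g) * h = f * h + g * h"
    by transfer (auto simp: fun_eq_iff distrib_right case_prod_unfold sum.distrib)
  show "(0 :: 'a mps) \<noteq> 1"
    by transfer (auto simp: fun_eq_iff)
qed (transfer; simp add: fun_eq_iff)+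

end

text \<open>As elsewhere in the library, the inverse of a non-unit is zero by convention.\<close>

instantiation mps :: (type) inverse
begin

definition inverse_mps :: "'a mps \<Rightarrow> 'a mps" where
  "inverse_mps f = (if f dvd 1 then THE g. f * g = 1 else 0)"

definition divide_mps :: "'a mps \<Rightarrow> 'a mps \<Rightarrow> 'a mps" where
  "divide_mps f g = f * inverse g"

instance ..

end

text \<open>
  The topology of coefficientwise convergence (product topology of discrete coefficients):
  a net converges iff each single coefficient is eventually constant.
\<close>

instantiation mps :: (type) t2_space
begin

definition open_mps :: "'a mps set \<Rightarrow> bool" where
  "open U \<longleftrightarrow> (\<forall>f\<in>U. \<exists>M. finite M \<and> {g. \<forall>m\<in>M. mps_coeff g m = mps_coeff f m} \<subseteq> U)"

instance
proof
  show "open (UNIV :: 'a mps set)"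
    by (auto simp: open_mps_def)
next
  fix S T :: "'a mps set" assume ST: "open S" "open T"
  show "open (S \<inter> T)"
    unfolding open_mps_def
  proof
    fix f assume "f \<in> S \<inter> T"
    then have "f \<in> S" "f \<in> T" by auto
    obtain M where M: "finite M" "{g. \<forall>m\<in>M. mps_coeff g m = mps_coeff f m} \<subseteq> S"
      using ST(1) \<open>f \<in> S\<close> unfolding open_mps_def by blast
    obtain N where N: "finite N" "{g. \<forall>m\<in>N. mps_coeff g m = mps_coeff f m} \<subseteq> T"
      using ST(2) \<open>f \<in> T\<close> unfolding open_mps_def by blast
    from M N show "\<exists>M. finite M \<and> {g. \<forall>m\<in>M. mps_coeff g m = mps_coeff f m} \<subseteq> S \<inter> T"
      by (intro exI[of _ "M \<union> N"]) auto
  qed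
next
  fix K :: "'a mps set set" assume "\<forall>S\<in>K. open S"
  then show "open (\<Union>K)"
    unfolding open_mps_def by (meson Union_iff Union_upper subset_trans)
next
  fix f g :: "'a mps" assume "f \<noteq> g"
  then obtain m where m: "mps_coeff f m \<noteq> mps_coeff g m"
    using mps_eqI by blast
  have op: "open {h. mps_coeff h m = c}" for c
    unfolding open_mps_def by (auto intro!: exI[of _ "{m}"])
  show "\<exists>U V. open U \<and> open V \<and> f \<in> U \<and> g \<in> V \<and> U \<inter> V = {}"
    using m op[of "mps_coeff f m"] op[of "mps_coeff g m"]
    by (intro exI[of _ "{h. mps_coeff h m = mps_coeff f m}"]
              exI[of _ "{h. mps_coeff h m = mps_coeff g m}"]) auto
qed

end

lift_definition mps_var :: "'v \<Rightarrow> 'v mps"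
  is "\<lambda>v m. if m = Poly_Mapping.single v 1 then 1 else 0" .

text \<open>Unordered infinite products, in analogy to \<^const>\<open>summable_on\<close> and \<^const>\<open>infsum\<close>.\<close>

definition multipliable_on :: "('i \<Rightarrow> 'a::{comm_monoid_mult, t2_space}) \<Rightarrow> 'i set \<Rightarrow> bool"
    (infixr \<open>multipliable'_on\<close> 46) where
  "f multipliable_on A \<longleftrightarrow> (\<exists>p. (prod f \<longlongrightarrow> p) (finite_subsets_at_top A))"

definition infprod :: "('i \<Rightarrow> 'a::{comm_monoid_mult, t2_space}) \<Rightarrow> 'i set \<Rightarrow> 'a" where
  "infprod f A = Lim (finite_subsets_at_top A) (prod f)"


section \<open>Symmetric functions\<close>

text \<open>
  Everything below is parameterised by the sequence \<open>x\<close> of variables; sequences of variables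
  and integer sequences are indexed from 0.

  Infinite products of power series in an additional variable \<open>t\<close> are formed coefficientwise
  in \<open>t\<close>, for the above topology on the coefficients. (The topology that the library
  provides on \<^typ>\<open>'a fps\<close> treats the coefficients as discrete; the products defining
  \<open>h\<close> and \<open>e\<close> do not converge in it.)
\<close>

definition fps_infprod :: "('i \<Rightarrow> 'v mps fps) \<Rightarrow> 'i set \<Rightarrow> 'v mps fps" where
  "fps_infprod f A = Abs_fps (\<lambda>r. Lim (finite_subsets_at_top A) (\<lambda>I. fps_nth (\<Prod>i\<in>I. f i) r))"

definition complete_sym :: "(nat \<Rightarrow> 'v mps) \<Rightarrow> int \<Rightarrow> 'v mps" where
  "complete_sym x r =
     (if r < 0 then 0
      else fps_nth (fps_infprod (\<lambda>i. inverse (1 - fps_const (x i) * fps_X)) UNIV) (nat r))"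

definition elementary_sym :: "(nat \<Rightarrow> 'v mps) \<Rightarrow> int \<Rightarrow> 'v mps" where
  "elementary_sym x r =
     (if r < 0 then 0
      else fps_nth (fps_infprod (\<lambda>i. 1 + fps_const (x i) * fps_X) UNIV) (nat r))"

text \<open>
  The products \<open>h\<^sub>\<alpha>\<close> and \<open>e\<^sub>\<alpha>\<close> for integer sequences with finitely many nonzero terms;
  the omitted factors are \<open>h\<^sub>0 = e\<^sub>0 = 1\<close>.
\<close>

definition complete_seq :: "(nat \<Rightarrow> 'v mps) \<Rightarrow> (nat \<Rightarrow> int) \<Rightarrow> 'v mps" where
  "complete_seq x \<alpha> = (\<Prod>i | \<alpha> i \<noteq> 0. complete_sym x (\<alpha> i))"

definition elementary_seq :: "(nat \<Rightarrow> 'v mps) \<Rightarrow> (nat \<Rightarrow> int) \<Rightarrow> 'v mps" where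
  "elementary_seq x \<alpha> = (\<Prod>i | \<alpha> i \<noteq> 0. elementary_sym x (\<alpha> i))"

definition partitions :: "(nat \<Rightarrow> int) set" where
  "partitions = {\<mu>. antimono \<mu> \<and> (\<forall>i. 0 \<le> \<mu> i) \<and> finite {i. \<mu> i \<noteq> 0}}"

text \<open>Part number \<open>i\<close> counted from 0 is part number \<open>i + 1\<close> counted from 1.\<close>

definition conjugate :: "(nat \<Rightarrow> int) \<Rightarrow> (nat \<Rightarrow> int)" where
  "conjugate \<mu> = (\<lambda>i. int (card {j. \<mu> j \<ge> int (i + 1)}))"

definition monomial_sym :: "(nat \<Rightarrow> 'v mps) \<Rightarrow> (nat \<Rightarrow> int) \<Rightarrow> 'v mps" where
  "monomial_sym x \<mu> =
     (\<Sum>\<^sub>\<infinity>\<alpha> \<in> {\<mu> \<circ> \<sigma> | \<sigma>. bij \<sigma>}. \<Prod>i | \<alpha> i \<noteq> 0. x i ^ nat (\<alpha> i))"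

text \<open>
  Raising operators: integer polynomials in commuting indeterminates \<open>R\<^sub>i\<^sub>j\<close>. A monomial in
  them acts on integer sequences (\<open>R\<^sub>i\<^sub>j\<close> adds 1 to entry \<open>i\<close> and subtracts 1 from entry \<open>j\<close>), and a
  polynomial acts on the index of \<open>h\<^sub>\<alpha>\<close> by linearity.
\<close>

type_synonym raising_monomial = "(nat \<times> nat) \<Rightarrow>\<^sub>0 nat"
type_synonym raising_poly = "raising_monomial \<Rightarrow>\<^sub>0 int"

definition raising_var :: "nat \<times> nat \<Rightarrow> raising_poly" where
  "raising_var ij = Poly_Mapping.single (Poly_Mapping.single ij 1) 1"

definition raise_seq :: "raising_monomial \<Rightarrow> (nat \<Rightarrow> int) \<Rightarrow> (nat \<Rightarrow> int)" where
  "raise_seq M \<alpha> =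
     (\<lambda>k. \<alpha> k + (\<Sum>(i, j) \<in> Poly_Mapping.keys M.
                   int (Poly_Mapping.lookup M (i, j)) * (of_bool (k = i) - of_bool (k = j))))"

definition raise_complete :: "raising_poly \<Rightarrow> (nat \<Rightarrow> 'v mps) \<Rightarrow> (nat \<Rightarrow> int) \<Rightarrow> 'v mps" where
  "raise_complete p x \<alpha> =
     (\<Sum>M \<in> Poly_Mapping.keys p. of_int (Poly_Mapping.lookup p M) * complete_seq x (raise_seq M \<alpha>))"

text \<open>
  The action of the infinite product \<open>\<Prod>\<^sub>i\<^sub><\<^sub>j (1 - R\<^sub>i\<^sub>j)\<close> is the limit of the actions of its finite
  subproducts. It is eventually constant: if \<open>\<alpha>\<^sub>k = 0\<close> for all \<open>k \<ge> l\<close>, every monomial that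
  involves some \<open>R\<^sub>i\<^sub>j\<close> with \<open>j \<ge> l\<close> creates a negative entry and hence contributes 0.
\<close>

definition schur :: "(nat \<Rightarrow> 'v mps) \<Rightarrow> (nat \<Rightarrow> int) \<Rightarrow> 'v mps" where
  "schur x \<alpha> = Lim (finite_subsets_at_top {(i, j). i < j})
                 (\<lambda>P. raise_complete (\<Prod>ij\<in>P. 1 - raising_var ij) x \<alpha>)"


text \<open>Two disjoint infinite sequences of independent variables.\<close>

definition xvar :: "nat \<Rightarrow> (nat + nat) mps" where
  "xvar i = mps_var (Inl i)"

definition yvar :: "nat \<Rightarrow> (nat + nat) mps" where
  "yvar j = mps_var (Inr j)"

end

theory Submission
  imports "Jordan_Normal_Form.Determinant" Defs
begin

text \<open>
  Fix one monomial of the power series. Its coefficient on either side only involves finitely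
  many variables and finitely many partitions, so each identity reduces to one between power
  series in finitely many variables, valid up to a given degree. Reductions of this kind are
  expressed by the relation \<open>agree\<close>, equality of coefficients on a set of monomials
  closed under divisors, which is a congruence of rings.

  For the Schur expansions, \<open>schur_eq_jacobi_trudi\<close> identifies the raising operator expression
  with a determinant: on exponents \<open>R\<^sub>i\<^sub>j\<close> acts like \<open>z\<^sub>i / z\<^sub>j\<close>, and the product of all
  \<open>1 - z\<^sub>i / z\<^sub>j\<close> is a Vandermonde determinant divided by a monomial.
  With \<open>n\<close> variables \<open>y\<^sub>j\<close> and a power series \<open>F(t)\<close> with coefficients \<open>f\<^sub>r\<close>, the product of the
  \<open>F(y\<^sub>j)\<close> times the Vandermonde determinant is the determinant of the matrix with entries
  \<open>y\<^sub>j\<^sup>i F(y\<^sub>j) = \<Sum>\<^sub>b f\<^bsub>b-i\<^esub> y\<^sub>j\<^sup>b\<close>. The Cauchy-Binet formula writes it as a sum over strictly decreasing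
  sequences \<open>b\<close>, that is, over partitions, of \<open>det(f\<^bsub>b\<^sub>k-i\<^esub>) det(y\<^sub>j\<^bsup>b\<^sub>k\<^esup>)\<close>. By the bialternant
  formula the second factor is a Schur polynomial times the Vandermonde determinant, which
  cancels. This is \<open>finite_cauchy\<close>. For \<open>F(t) = \<Prod>\<^sub>i (1 - x\<^sub>i t)\<^sup>-\<^sup>1\<close> it is the first
  Cauchy identity; for \<open>F(t) = \<Prod>\<^sub>i (1 + x\<^sub>i t)\<close> it gives the dual one, because
  determinants in the \<open>e\<^sub>r\<close> are Schur functions of the conjugate partition
  (\<open>jacobi_trudi_conjugate\<close>, an instance of Jacobi's theorem on complementary minors).

  For the monomial expansions, the product over \<open>i\<close> of \<open>F(x\<^sub>i)\<close>, with \<open>F\<close> now a series in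
  the \<open>y\<^sub>j\<close>, is multiplied out into terms \<open>f\<^sub>\<alpha> x\<^sup>\<alpha>\<close>; as \<open>f\<^sub>\<alpha>\<close> depends only on the sorted sequence,
  the terms are collected by partitions (\<open>monomial_has_sum\<close>).
\<close>

section \<open>Determinants of indexed families\<close>

text \<open>
  The size of the matrices is tied to the length of a partition and to the number of variables
  kept, so it has to be a term and not a type.
\<close>

definition det_fun :: "nat \<Rightarrow> (nat \<Rightarrow> nat \<Rightarrow> 'a::comm_ring_1) \<Rightarrow> 'a" where
  "det_fun n f = Determinant.det (Matrix.mat n n (\<lambda>(i, j). f i j))"

lemma det_fun_expand: "det_fun n f = (\<Sum>p | p permutes {0..<n}. signof p * (\<Prod>i=0..<n. f i (p i)))"
  unfolding det_fun_def Determinant.det_def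
  by (auto intro!: sum.cong prod.cong arg_cong2[where f="(*)"] simp: permutes_in_image)

lemma det_fun_cong: "(\<And>i j. i < n \<Longrightarrow> j < n \<Longrightarrow> f i j = g i j) \<Longrightarrow> det_fun n f = det_fun n g"
  unfolding det_fun_expand by (auto intro!: sum.cong prod.cong arg_cong2[where f="(*)"] simp: permutes_in_image)

lemma det_fun_transpose: "det_fun n (\<lambda>i j. f j i) = det_fun n f"
proof -
  have "Determinant.det (transpose_mat (Matrix.mat n n (\<lambda>(i, j). f i j))) = det_fun n f"
    unfolding det_fun_def by (rule Determinant.det_transpose) auto
  moreover have "transpose_mat (Matrix.mat n n (\<lambda>(i, j). f i j)) = Matrix.mat n n (\<lambda>(i, j). f j i)"
    by (auto intro!: eq_matI)
  ultimately show ?thesis by (simp add: det_fun_def)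
qed

lemma det_fun_mult: "det_fun n (\<lambda>i j. \<Sum>k<n. f i k * g k j) = det_fun n f * det_fun n g"
proof -
  have "Matrix.mat n n (\<lambda>(i, j). \<Sum>k<n. f i k * g k j) = Matrix.mat n n (\<lambda>(i, j). f i j) * Matrix.mat n n (\<lambda>(i, j). g i j)"
    by (auto intro!: eq_matI simp: scalar_prod_def lessThan_atLeast0)
  then show ?thesis unfolding det_fun_def by (simp add: Determinant.det_mult[of _ n])
qed

lemma det_fun_permute_rows:
  assumes "p permutes {0..<n}"
  shows "det_fun n (\<lambda>i j. f (p i) j) = signof p * det_fun n f"
proof -
  have "Matrix.mat n n (\<lambda>(i, j). f (p i) j) = Matrix.mat n n (\<lambda>(i, j). Matrix.mat n n (\<lambda>(i, j). f i j) $$ (p i, j))"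
    using assms by (auto intro!: eq_matI)
  then show ?thesis unfolding det_fun_def
    by (simp add: Determinant.det_permute_rows[OF _ assms])
qed

lemma det_fun_identical_rows:
  assumes "i \<noteq> i'" "i < n" "i' < n" "\<And>j. j < n \<Longrightarrow> f i j = f i' j"
  shows "det_fun n f = 0"
  unfolding det_fun_def
  by (rule Determinant.det_identical_rows[of _ n i i']) (use assms in \<open>auto intro!: eq_vecI\<close>)

lemma det_fun_triangular:
  assumes "\<And>i j. i < j \<Longrightarrow> j < n \<Longrightarrow> f i j = 0"
  shows "det_fun n f = (\<Prod>i<n. f i i)"
proof -
  have "det_fun n f = prod_list (diag_mat (Matrix.mat n n (\<lambda>(i, j). f i j)))"
    unfolding det_fun_def by (rule Determinant.det_lower_triangular[of n]) (use assms in auto)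
  also have "\<dots> = prod_list (map (\<lambda>i. f i i) [0..<n])"
    by (auto simp: diag_mat_def intro!: arg_cong[where f=prod_list])
  also have "\<dots> = (\<Prod>i<n. f i i)"
    by (simp add: prod.distinct_set_conv_list[symmetric] lessThan_atLeast0)
  finally show ?thesis .
qed

lemma det_fun_scale_rows: "det_fun n (\<lambda>i j. c i * f i j) = (\<Prod>i<n. c i) * det_fun n f"
  unfolding det_fun_expand sum_distrib_left
  by (auto intro!: sum.cong simp: prod.distrib lessThan_atLeast0 mult_ac)

lemma det_fun_scale_cols: "det_fun n (\<lambda>i j. c j * f i j) = (\<Prod>i<n. c i) * det_fun n f"
  using det_fun_scale_rows[of n c "\<lambda>i j. f j i"] det_fun_transpose[of n f]
    det_fun_transpose[of n "\<lambda>i j. c j * f i j"] by simp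

lemma det_fun_Suc_last_row:
  assumes "\<And>j. j < n \<Longrightarrow> f n j = 0"
  shows "det_fun (Suc n) f = f n n * det_fun n f"
proof -
  let ?P = "{p. p permutes {0..<Suc n}}" and ?Q = "{p. p permutes {0..<n}}"
  have "det_fun (Suc n) f = (\<Sum>p\<in>?P. signof p * (\<Prod>i=0..<Suc n. f i (p i)))"
    by (simp add: det_fun_expand)
  also have "\<dots> = (\<Sum>p\<in>?Q. signof p * (\<Prod>i=0..<Suc n. f i (p i)))"
  proof (rule sum.mono_neutral_right)
    show "finite ?P" by (simp add: finite_permutations)
    show "?Q \<subseteq> ?P"
      by (intro Collect_mono impI, erule permutes_subset) simp
    show "\<forall>p\<in>?P - ?Q. signof p * (\<Prod>i=0..<Suc n. f i (p i)) = 0"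
    proof
      fix p assume p: "p \<in> ?P - ?Q"
      have "p n \<noteq> n"
      proof
        assume "p n = n"
        have "p permutes {0..<n}"
        proof (rule permutes_superset)
          show "p permutes {0..<Suc n}" using p by blast
          show "p x = x" if "x \<in> {0..<Suc n} - {0..<n}" for x
            using that \<open>p n = n\<close> by (cases "x = n") auto
        qed
        then show False using p by auto
      qed
      moreover have "p n < Suc n" using p permutes_in_image[of p "{0..<Suc n}" n] by auto
      ultimately have "f n (p n) = 0" using assms by simp
      then have "(\<Prod>i=0..<Suc n. f i (p i)) = 0" by simp
      then show "signof p * (\<Prod>i=0..<Suc n. f i (p i)) = 0" by (simp only: mult_zero_right)
    qed
  qed
  also have "\<dots> = (\<Sum>p\<in>?Q. f n n * (signof p * (\<Prod>i=0..<n. f i (p i))))"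
  proof (rule sum.cong[OF refl])
    fix p assume "p \<in> ?Q"
    then have "p n = n" by (intro permutes_not_in[of p "{0..<n}"]) auto
    then show "signof p * (\<Prod>i=0..<Suc n. f i (p i)) = f n n * (signof p * (\<Prod>i=0..<n. f i (p i)))"
      by (simp add: mult_ac)
  qed
  also have "\<dots> = f n n * det_fun n f"
    by (simp add: det_fun_expand sum_distrib_left)
  finally show ?thesis .
qed

lemma det_fun_Suc_last_col:
  assumes "\<And>i. i < n \<Longrightarrow> f i n = 0"
  shows "det_fun (Suc n) f = f n n * det_fun n f"
  using det_fun_Suc_last_row[of n "\<lambda>i j. f j i"] assms det_fun_transpose[of n f] det_fun_transpose[of "Suc n" f]
  by simp

lemma det_fun_block_left:
  assumes "\<And>i j. i < n + m \<Longrightarrow> n \<le> j \<Longrightarrow> j < n + m \<Longrightarrow> f i j = of_bool (i = j)"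
  shows "det_fun (n + m) f = det_fun n f"
  using assms
proof (induction m)
  case 0
  show ?case by (simp only: add_0_right)
next
  case (Suc m)
  have "f i (n + m) = 0" if "i < n + m" for i
    using Suc.prems[of i "n + m"] that by simp
  then have "det_fun (n + Suc m) f = f (n + m) (n + m) * det_fun (n + m) f"
    unfolding add_Suc_right by (rule det_fun_Suc_last_col)
  moreover have "f (n + m) (n + m) = 1" using Suc.prems[of "n + m" "n + m"] by simp
  moreover have "det_fun (n + m) f = det_fun n f"
  proof (rule Suc.IH)
    fix i j assume "i < n + m" "n \<le> j" "j < n + m"
    then show "f i j = of_bool (i = j)" by (intro Suc.prems) simp_all
  qed
  ultimately show ?case by simp
qed

lemma signof_mult_self: "signof p * signof p = (1 :: 'a::comm_ring_1)"
  by (auto simp: sign_def)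

lemma det_fun_reverse: "det_fun n (\<lambda>i j. f (n - 1 - i) (n - 1 - j)) = det_fun n f"
proof -
  define p where "p = (\<lambda>i. if i < n then n - 1 - i else i)"
  have p: "p permutes {0..<n}"
  proof (rule bij_imp_permutes)
    show "bij_betw p {0..<n} {0..<n}"
      by (rule bij_betw_byWitness[where f' = p]) (auto simp: p_def)
    show "p x = x" if "x \<notin> {0..<n}" for x using that by (simp add: p_def)
  qed
  have "det_fun n (\<lambda>i j. f (n - 1 - i) (n - 1 - j)) = det_fun n (\<lambda>i j. f (p i) (p j))"
    by (rule det_fun_cong) (simp add: p_def)
  also have "\<dots> = signof p * det_fun n (\<lambda>j i. f i (p j))"
    using det_fun_permute_rows[OF p, of "\<lambda>i j. f i (p j)"] det_fun_transpose[of n "\<lambda>i j. f i (p j)"] by simp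
  also have "\<dots> = signof p * (signof p * det_fun n (\<lambda>j i. f i j))"
    using det_fun_permute_rows[OF p, of "\<lambda>j i. f i j"] by simp
  also have "\<dots> = det_fun n f"
    by (simp only: mult.assoc[symmetric] signof_mult_self det_fun_transpose[of n f] mult_1)
  finally show ?thesis .
qed

lemma det_fun_block_right:
  assumes "\<And>i j. i < n + m \<Longrightarrow> j < n \<Longrightarrow> f i j = of_bool (i = j)"
  shows "det_fun (n + m) f = det_fun m (\<lambda>i j. f (n + i) (n + j))"
proof -
  have "det_fun (n + m) f = det_fun (m + n) (\<lambda>i j. f (n + m - 1 - i) (n + m - 1 - j))"
    using det_fun_reverse[of "n + m" f] by (simp add: add.commute)
  also have "\<dots> = det_fun m (\<lambda>i j. f (n + m - 1 - i) (n + m - 1 - j))"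
    by (rule det_fun_block_left) (use assms in auto)
  also have "\<dots> = det_fun m (\<lambda>i j. f (n + (m - 1 - i)) (n + (m - 1 - j)))"
    by (rule det_fun_cong) (auto intro!: arg_cong2[where f=f])
  also have "\<dots> = det_fun m (\<lambda>i j. f (n + i) (n + j))"
    using det_fun_reverse[of m "\<lambda>i j. f (n + i) (n + j)"] by simp
  finally show ?thesis .
qed

text \<open>
  The products of the \<open>t - x\<^sub>k\<close> with \<open>k < j\<close> are monic of degree \<open>j\<close>; passing to them from the
  powers of \<open>t\<close> is therefore a unitriangular change of basis.
\<close>

lemma newton_basis:
  fixes x :: "nat \<Rightarrow> 'a::comm_ring_1"
  shows "\<exists>c. c j = 1 \<and> (\<forall>t. (\<Prod>k<j. t - x k) = (\<Sum>k\<le>j. t ^ k * c k))"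
proof (induction j)
  case 0
  show ?case by (auto intro!: exI[of _ "\<lambda>_. 1"])
next
  case (Suc j)
  then obtain c where c: "c j = 1" "\<And>t. (\<Prod>k<j. t - x k) = (\<Sum>k\<le>j. t ^ k * c k)" by blast
  define d where "d = (\<lambda>k. (if k = 0 then 0 else c (k - 1)) - (if k \<le> j then x j * c k else 0))"
  have "(\<Prod>k<Suc j. t - x k) = (\<Sum>k\<le>Suc j. t ^ k * d k)" for t
  proof -
    have "(\<Sum>k\<le>Suc j. t ^ k * d k) = (\<Sum>k\<le>Suc j. t ^ k * (if k = 0 then 0 else c (k - 1)))
        - (\<Sum>k\<le>Suc j. t ^ k * (if k \<le> j then x j * c k else 0))"
      by (simp add: d_def right_diff_distrib sum_subtractf del: sum.atMost_Suc)
    also have "(\<Sum>k\<le>Suc j. t ^ k * (if k = 0 then 0 else c (k - 1))) = t * (\<Sum>k\<le>j. t ^ k * c k)"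
      by (subst sum.atMost_Suc_shift) (simp add: sum_distrib_left mult_ac)
    also have "(\<Sum>k\<le>Suc j. t ^ k * (if k \<le> j then x j * c k else 0)) = x j * (\<Sum>k\<le>j. t ^ k * c k)"
      by (simp add: sum_distrib_left mult_ac)
    finally show ?thesis by (simp add: c(2) algebra_simps)
  qed
  moreover have "d (Suc j) = 1" using c by (simp add: d_def)
  ultimately show ?case by blast
qed

text \<open>
  In the Newton basis at the nodes \<open>x\<^sub>k\<close> the Vandermonde matrix is triangular: the \<open>j\<close>-th basis
  polynomial vanishes at \<open>x\<^sub>i\<close> for \<open>i < j\<close>.
\<close>

lemma det_fun_vandermonde: "det_fun n (\<lambda>i j. x i ^ j) = (\<Prod>(i, j) \<in> {(i, j). i < j \<and> j < n}. x j - x i)"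
proof -
  obtain c where c: "\<And>j. c j j = 1" "\<And>j t. (\<Prod>k<j. t - x k) = (\<Sum>k\<le>j. t ^ k * c j k)"
    using newton_basis[of _ x] by metis
  define U where "U = (\<lambda>k j. if k \<le> j then c j k else 0)"
  have "det_fun n U = det_fun n (\<lambda>i j. U j i)" by (rule det_fun_transpose[symmetric])
  also have "\<dots> = 1" by (subst det_fun_triangular) (auto simp: U_def c(1))
  finally have "det_fun n (\<lambda>i j. x i ^ j) = det_fun n (\<lambda>i j. x i ^ j) * det_fun n U" by simp
  also have "\<dots> = det_fun n (\<lambda>i j. \<Sum>k<n. x i ^ k * U k j)" by (rule det_fun_mult[symmetric])
  also have "\<dots> = det_fun n (\<lambda>i j. \<Prod>k<j. x i - x k)"
  proof (rule det_fun_cong)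
    fix i j assume "i < n" "j < n"
    have "(\<Sum>k<n. x i ^ k * U k j) = (\<Sum>k\<le>j. x i ^ k * U k j)"
      by (rule sum.mono_neutral_right) (use \<open>j < n\<close> in \<open>auto simp: U_def\<close>)
    then show "(\<Sum>k<n. x i ^ k * U k j) = (\<Prod>k<j. x i - x k)"
      by (simp add: c(2) U_def)
  qed
  also have "\<dots> = (\<Prod>j<n. \<Prod>k<j. x j - x k)"
    by (rule det_fun_triangular) (auto intro!: prod_zero)
  also have "\<dots> = (\<Prod>(j, i) \<in> Sigma {..<n} (\<lambda>j. {..<j}). x j - x i)"
    by (rule prod.Sigma) auto
  also have "\<dots> = (\<Prod>(i, j) \<in> {(i, j). i < j \<and> j < n}. x j - x i)"
    by (rule prod.reindex_bij_witness[where i = prod.swap and j = prod.swap]) auto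
  finally show ?thesis .
qed

text \<open>
  Multilinearity in the rows, the first half of the Cauchy-Binet formula.
\<close>

lemma det_fun_sum_rows:
  "det_fun n (\<lambda>i j. \<Sum>b\<in>A. Y b i * H b j)
     = (\<Sum>f\<in>PiE {0..<n} (\<lambda>_. A). (\<Prod>i=0..<n. Y (f i) i) * det_fun n (\<lambda>i. H (f i)))"
  if "finite A"
proof -
  have "det_fun n (\<lambda>i j. \<Sum>b\<in>A. Y b i * H b j) =
      (\<Sum>p | p permutes {0..<n}. \<Sum>f\<in>PiE {0..<n} (\<lambda>_. A).
          signof p * (\<Prod>i=0..<n. Y (f i) i * H (f i) (p i)))"
    unfolding det_fun_expand using that by (simp add: prod_sum_PiE sum_distrib_left)
  also have "\<dots> = (\<Sum>f\<in>PiE {0..<n} (\<lambda>_. A). (\<Prod>i=0..<n. Y (f i) i) * det_fun n (\<lambda>i. H (f i)))"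
    unfolding det_fun_expand by (subst sum.swap) (simp add: prod.distrib sum_distrib_left mult_ac)
  finally show ?thesis .
qed

section \<open>Power series on a set of monomials\<close>

lemma coeff_zero [simp]: "mps_coeff 0 m = 0" by transfer simp
lemma coeff_plus [simp]: "mps_coeff (f + g) m = mps_coeff f m + mps_coeff g m" by transfer simp
lemma coeff_minus [simp]: "mps_coeff (f - g) m = mps_coeff f m - mps_coeff g m" by transfer simp
lemma coeff_times: "mps_coeff (f * g) m = (\<Sum>(a, b) | a + b = m. mps_coeff f a * mps_coeff g b)"
  by (rule times_mps.rep_eq[THEN fun_cong])
lemma coeff_sum: "mps_coeff (\<Sum>i\<in>A. f i) m = (\<Sum>i\<in>A. mps_coeff (f i) m)"
  by (induction A rule: infinite_finite_induct) auto

text \<open>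
  Series that agree on \<open>M\<close> are congruent modulo the series without monomials in \<open>M\<close>. If every
  divisor of a monomial in \<open>M\<close> is in \<open>M\<close>, these series form an ideal, so that one may calculate with
  \<open>agree M\<close> as with equality. Bounding the degree or restricting the variables gives such an \<open>M\<close>.
\<close>

definition agree :: "('v \<Rightarrow>\<^sub>0 nat) set \<Rightarrow> 'v mps \<Rightarrow> 'v mps \<Rightarrow> bool" where
  "agree M f g \<longleftrightarrow> (\<forall>m\<in>M. mps_coeff f m = mps_coeff g m)"

definition divisor_closed :: "('v \<Rightarrow>\<^sub>0 nat) set \<Rightarrow> bool" where
  "divisor_closed M \<longleftrightarrow> (\<forall>a b. a + b \<in> M \<longrightarrow> a \<in> M)"

lemma agreeD: "agree M f g \<Longrightarrow> m \<in> M \<Longrightarrow> mps_coeff f m = mps_coeff g m"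
  by (simp add: agree_def)

lemma agree_refl [simp, intro]: "agree M f f" by (simp add: agree_def)
lemma agree_sym: "agree M f g \<Longrightarrow> agree M g f" by (simp add: agree_def)
lemma agree_trans [trans]: "agree M f g \<Longrightarrow> agree M g h \<Longrightarrow> agree M f h" by (simp add: agree_def)
lemma agree_mono: "agree M f g \<Longrightarrow> N \<subseteq> M \<Longrightarrow> agree N f g" by (auto simp: agree_def)
lemma agree_add: "agree M f f' \<Longrightarrow> agree M g g' \<Longrightarrow> agree M (f + g) (f' + g')"
  by (simp add: agree_def)
lemma agree_diff: "agree M f f' \<Longrightarrow> agree M g g' \<Longrightarrow> agree M (f - g) (f' - g')"
  by (simp add: agree_def)
lemma agree_sum: "(\<And>i. i \<in> A \<Longrightarrow> agree M (f i) (g i)) \<Longrightarrow> agree M (\<Sum>i\<in>A. f i) (\<Sum>i\<in>A. g i)"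
  by (simp add: agree_def coeff_sum)

lemma agree_mult:
  assumes M: "divisor_closed M" and f: "agree M f f'" and g: "agree M g g'"
  shows "agree M (f * g) (f' * g')"
  unfolding agree_def coeff_times
proof (intro ballI sum.cong refl, clarsimp)
  fix a b assume ab: "a + b \<in> M"
  then have "a \<in> M" "b \<in> M"
    using M unfolding divisor_closed_def by (blast, metis add.commute)
  then show "mps_coeff f a * mps_coeff g b = mps_coeff f' a * mps_coeff g' b"
    using f g by (simp add: agree_def)
qed

lemma agree_prod:
  "divisor_closed M \<Longrightarrow> (\<And>i. i \<in> A \<Longrightarrow> agree M (f i) (g i)) \<Longrightarrow> agree M (\<Prod>i\<in>A. f i) (\<Prod>i\<in>A. g i)"
  by (induction A rule: infinite_finite_induct) (auto intro!: agree_mult)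

lemma agree_power: "divisor_closed M \<Longrightarrow> agree M f g \<Longrightarrow> agree M (f ^ k) (g ^ k)"
  by (induction k) (auto intro!: agree_mult)

section \<open>Bounding the degree\<close>

definition mdeg :: "('v \<Rightarrow>\<^sub>0 nat) \<Rightarrow> nat" where
  "mdeg m = (\<Sum>k\<in>Poly_Mapping.keys m. Poly_Mapping.lookup m k)"

lemma mdeg_superset:
  "finite A \<Longrightarrow> Poly_Mapping.keys m \<subseteq> A \<Longrightarrow> mdeg m = (\<Sum>k\<in>A. Poly_Mapping.lookup m k)"
  unfolding mdeg_def by (rule sum.mono_neutral_left) (auto simp: in_keys_iff)

lemma mdeg_add: "mdeg (a + b) = mdeg a + mdeg b"
proof -
  let ?A = "Poly_Mapping.keys a \<union> Poly_Mapping.keys b"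
  have "mdeg (a + b) = (\<Sum>k\<in>?A. Poly_Mapping.lookup (a + b) k)"
    by (rule mdeg_superset) (auto dest: subsetD[OF Poly_Mapping.keys_add])
  also have "\<dots> = mdeg a + mdeg b"
    by (simp add: lookup_add sum.distrib mdeg_superset[of ?A a] mdeg_superset[of ?A b])
  finally show ?thesis .
qed

lemma mdeg_single [simp]: "mdeg (Poly_Mapping.single v k) = k"
  by (cases "k = 0") (auto simp: mdeg_def)

definition degree_below :: "nat \<Rightarrow> ('v \<Rightarrow>\<^sub>0 nat) set" where "degree_below d = {m. mdeg m < d}"

lemma agree_degree_below_0 [simp]: "agree (degree_below 0) f g" by (simp add: agree_def degree_below_def)

lemma divisor_closed_degree_below: "divisor_closed (degree_below d)"
  by (auto simp: divisor_closed_def degree_below_def mdeg_add)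

lemma degree_below_mono: "d \<le> e \<Longrightarrow> degree_below d \<subseteq> degree_below e" by (auto simp: degree_below_def)

lemma agree_degree_below_mono: "agree (degree_below e) f g \<Longrightarrow> d \<le> e \<Longrightarrow> agree (degree_below d) f g"
  by (meson agree_mono degree_below_mono)

lemma agree_degree_below_all:
  fixes f g :: "'v mps"
  assumes "\<And>d. agree (degree_below d) f g"
  shows "f = g"
proof (rule mps_eqI)
  fix m :: "'v \<Rightarrow>\<^sub>0 nat"
  have "agree (degree_below (Suc (mdeg m))) f g" by (rule assms)
  moreover have "m \<in> degree_below (Suc (mdeg m))" by (simp add: degree_below_def)
  ultimately show "mps_coeff f m = mps_coeff g m"
    unfolding agree_def by blast
qed

lemma agree_degree_below_mult_zero:
  assumes f: "agree (degree_below a) f 0" and g: "agree (degree_below b) g 0"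
  shows "agree (degree_below (a + b)) (f * g) 0"
  unfolding agree_def coeff_times coeff_zero
proof (intro ballI sum.neutral, clarsimp)
  fix p q assume "p + q \<in> degree_below (a + b)" "mps_coeff g q \<noteq> 0"
  then have "\<not> mdeg q < b" "mdeg p + mdeg q < a + b"
    using g by (auto simp: agree_def degree_below_def mdeg_add)
  then show "mps_coeff f p = 0" using f by (simp add: agree_def degree_below_def)
qed

lemma agree_degree_below_prod_zero:
  assumes "\<And>i. i \<in> A \<Longrightarrow> agree (degree_below (d i)) (f i) 0"
  shows "agree (degree_below (\<Sum>i\<in>A. d i)) (\<Prod>i\<in>A. f i) 0"
  using assms
proof (induction A rule: infinite_finite_induct)
  case (insert x A)
  have "agree (degree_below (d x + sum d A)) (f x * prod f A) 0"
    by (rule agree_degree_below_mult_zero) (use insert in auto)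
  then show ?case using insert.hyps by simp
qed simp_all

lemma agree_degree_below_power_zero: "agree (degree_below a) f 0 \<Longrightarrow> agree (degree_below (a * k)) (f ^ k) 0"
  using agree_degree_below_prod_zero[of "{..<k}" "\<lambda>_. a" "\<lambda>_. f"] by (simp add: mult.commute)

lemma agree_mult_zero: "divisor_closed M \<Longrightarrow> agree M f 0 \<Longrightarrow> agree M (f * g) 0"
  using agree_mult[of M f 0 g g] by simp

lemma agree_zero_sum: "(\<And>i. i \<in> A \<Longrightarrow> agree M (f i) 0) \<Longrightarrow> agree M (\<Sum>i\<in>A. f i) 0"
  using agree_sum[of A M f "\<lambda>_. 0"] by simp

lemma agree_degree_below_var: "agree (degree_below 1) (mps_var v) 0"
  by (auto simp: agree_def degree_below_def mps_var.rep_eq)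

section \<open>Restricting the variables\<close>

definition monomials_in :: "'v set \<Rightarrow> ('v \<Rightarrow>\<^sub>0 nat) set" where "monomials_in V = {m. Poly_Mapping.keys m \<subseteq> V}"

lemma divisor_closed_monomials_in: "divisor_closed (monomials_in V)"
  by (auto simp: divisor_closed_def monomials_in_def in_keys_iff lookup_add subset_iff)

lemma agree_monomials_in_var: "v \<notin> V \<Longrightarrow> agree (monomials_in V) (mps_var v) 0"
  by (auto simp: agree_def monomials_in_def mps_var.rep_eq)

section \<open>Geometric series\<close>

text \<open>
  The partial sums of the geometric series of \<open>c\<close> stabilise in each degree when \<open>c\<close> has no constant
  term. Their coefficientwise limit inverts \<open>1 - c\<close>, since it does so modulo each degree.
\<close>

lemma geometric_exists:
  assumes c: "agree (degree_below 1) c (0 :: 'v mps)"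
  shows "\<exists>g. (1 - c) * g = 1"
proof -
  define g where "g = Abs_mps (\<lambda>m. mps_coeff (\<Sum>k<Suc (mdeg m). c ^ k) m)"
  have pow: "agree (degree_below k) (c ^ k) 0" for k
    using agree_degree_below_power_zero[OF c, of k] by simp
  have g: "agree (degree_below d) g (\<Sum>k<d. c ^ k)" for d
    unfolding agree_def
  proof
    fix m :: "'v \<Rightarrow>\<^sub>0 nat" assume "m \<in> degree_below d"
    then have d: "Suc (mdeg m) \<le> d" by (simp add: degree_below_def)
    have "(\<Sum>k<d. mps_coeff (c ^ k) m) = (\<Sum>k<Suc (mdeg m). mps_coeff (c ^ k) m)"
    proof (rule sum.mono_neutral_right)
      show "\<forall>i\<in>{..<d} - {..<Suc (mdeg m)}. mps_coeff (c ^ i) m = 0"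
        using pow by (auto simp: agree_def degree_below_def)
    qed (use d in auto)
    then show "mps_coeff g m = mps_coeff (\<Sum>k<d. c ^ k) m"
      by (simp only: g_def Abs_mps_inverse[OF UNIV_I] coeff_sum)
  qed
  have "(1 - c) * g = 1"
  proof (rule agree_degree_below_all)
    fix d
    have "agree (degree_below d) ((1 - c) * g) ((1 - c) * (\<Sum>k<d. c ^ k))"
      by (intro agree_mult divisor_closed_degree_below g agree_refl)
    also have "(1 - c) * (\<Sum>k<d. c ^ k) = 1 - c ^ d"
      by (simp add: one_diff_power_eq)
    also have "agree (degree_below d) (1 - c ^ d) (1 - 0)"
      by (intro agree_diff agree_refl pow)
    finally show "agree (degree_below d) ((1 - c) * g) 1" by simp
  qed
  then show ?thesis ..
qed

lemma inverse_mps_eqI: "f * g = 1 \<Longrightarrow> inverse f = (g :: 'v mps)"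
proof -
  assume fg: "f * g = 1"
  then have "f dvd 1" by (metis dvd_triv_left)
  moreover have "(THE g. f * g = 1) = g"
  proof (rule the_equality)
    show "f * g = 1" by (rule fg)
  next
    fix g' assume "f * g' = 1"
    then have "g' = g' * (f * g)" by (simp add: fg)
    also have "\<dots> = (f * g') * g" by (simp only: ac_simps)
    finally show "g' = g" by (simp add: \<open>f * g' = 1\<close>)
  qed
  ultimately show "inverse f = g" by (simp add: inverse_mps_def)
qed

lemma geometric:
  assumes "agree (degree_below 1) c 0"
  shows "(1 - c) * (1 / (1 - c)) = 1"
proof -
  obtain g where g: "(1 - c) * g = 1" using geometric_exists[OF assms] by blast
  then show ?thesis using inverse_mps_eqI[OF g] by (simp add: divide_mps_def)
qed

lemma geometric_unfold:
  assumes "agree (degree_below 1) c 0"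
  shows "1 / (1 - c) = 1 + c * (1 / (1 - c))"
proof (rule diff_eq_eq[THEN iffD1])
  show "1 / (1 - c) - c * (1 / (1 - c)) = 1"
    using geometric[OF assms] by (simp only: left_diff_distrib mult_1)
qed

lemma geometric_agree_one:
  assumes "agree (degree_below 1) c 0" "divisor_closed M" "agree M c 0"
  shows "agree M (1 / (1 - c)) 1"
proof -
  have "agree M (1 + c * (1 / (1 - c))) (1 + 0)"
    by (intro agree_add agree_refl agree_mult_zero assms)
  then show ?thesis using geometric_unfold[OF assms(1)] by simp
qed

lemma geometric_truncate:
  assumes c: "agree (degree_below 1) c 0"
  shows "agree (degree_below d) (1 / (1 - c)) (\<Sum>k<d. c ^ k)"
proof -
  let ?g = "1 / (1 - c)"
  have "agree (degree_below d) (?g * (1 - 0)) (?g * (1 - c ^ d))"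
    using agree_degree_below_power_zero[OF c, of d]
    by (intro agree_mult divisor_closed_degree_below agree_diff agree_refl) (auto intro: agree_sym)
  also have "?g * (1 - c ^ d) = ((1 - c) * ?g) * (\<Sum>k<d. c ^ k)"
    by (simp only: one_diff_power_eq ac_simps)
  finally show ?thesis by (simp only: geometric[OF c] mult_1 mult_1_right diff_zero)
qed

section \<open>Coefficientwise convergence\<close>

lemma open_coeff: "open {h. mps_coeff h m = c}"
  unfolding open_mps_def by (auto intro!: exI[of _ "{m}"])

lemma tendsto_mps_iff:
  "(g \<longlongrightarrow> L) F \<longleftrightarrow> (\<forall>m. eventually (\<lambda>x. mps_coeff (g x) m = mps_coeff L m) F)"
proof
  assume "(g \<longlongrightarrow> L) F"
  then show "\<forall>m. eventually (\<lambda>x. mps_coeff (g x) m = mps_coeff L m) F"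
    using topological_tendstoD[of g L F "{h. mps_coeff h m = mps_coeff L m}" for m] open_coeff by auto
next
  assume *: "\<forall>m. eventually (\<lambda>x. mps_coeff (g x) m = mps_coeff L m) F"
  show "(g \<longlongrightarrow> L) F"
  proof (rule topological_tendstoI)
    fix U :: "'b mps set" assume "open U" "L \<in> U"
    then obtain M where M: "finite M" "{h. \<forall>m\<in>M. mps_coeff h m = mps_coeff L m} \<subseteq> U"
      unfolding open_mps_def by blast
    have "eventually (\<lambda>x. \<forall>m\<in>M. mps_coeff (g x) m = mps_coeff L m) F"
      using * M(1) by (simp add: eventually_ball_finite)
    then show "eventually (\<lambda>x. g x \<in> U) F"
      by (rule eventually_mono) (use M(2) in auto)
  qed
qed

lemma tendsto_mps_exists:
  assumes "\<And>m. \<exists>c. eventually (\<lambda>x. mps_coeff (g x) m = c) F"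
  shows "\<exists>L. (g \<longlongrightarrow> L) F"
proof -
  obtain c where c: "\<And>m. eventually (\<lambda>x. mps_coeff (g x) m = c m) F" using assms by metis
  have "(g \<longlongrightarrow> Abs_mps c) F"
    unfolding tendsto_mps_iff Abs_mps_inverse[OF UNIV_I] using c by blast
  then show ?thesis ..
qed

lemma has_sum_mpsI:
  assumes "\<And>m. \<exists>B. finite B \<and> B \<subseteq> A \<and> (\<forall>a\<in>A - B. mps_coeff (f a) m = 0)
              \<and> (\<Sum>a\<in>B. mps_coeff (f a) m) = mps_coeff S m"
  shows "(f has_sum S) A"
  unfolding has_sum_def tendsto_mps_iff
proof
  fix m
  obtain B where B: "finite B" "B \<subseteq> A" "\<forall>a\<in>A - B. mps_coeff (f a) m = 0"
     "(\<Sum>a\<in>B. mps_coeff (f a) m) = mps_coeff S m" using assms by blast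
  show "\<forall>\<^sub>F X in finite_subsets_at_top A. mps_coeff (sum f X) m = mps_coeff S m"
    unfolding eventually_finite_subsets_at_top
  proof (intro exI[of _ B] conjI allI impI B(1,2))
    fix Y assume Y: "finite Y \<and> B \<subseteq> Y \<and> Y \<subseteq> A"
    have "(\<Sum>a\<in>Y. mps_coeff (f a) m) = (\<Sum>a\<in>B. mps_coeff (f a) m)"
      by (rule sum.mono_neutral_right) (use Y B in auto)
    then show "mps_coeff (sum f Y) m = mps_coeff S m" using B(4) by (simp add: coeff_sum)
  qed
qed

lemma coeff_infsum:
  assumes fin: "\<And>m. finite {a\<in>A. mps_coeff (f a) m \<noteq> 0}"
    and B: "finite B" "B \<subseteq> A" "\<And>a. a \<in> A - B \<Longrightarrow> mps_coeff (f a) m = 0"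
  shows "mps_coeff (infsum f A) m = (\<Sum>a\<in>B. mps_coeff (f a) m)"
proof -
  define S where "S = Abs_mps (\<lambda>m. \<Sum>a | a \<in> A \<and> mps_coeff (f a) m \<noteq> 0. mps_coeff (f a) m)"
  have S: "mps_coeff S m = (\<Sum>a | a \<in> A \<and> mps_coeff (f a) m \<noteq> 0. mps_coeff (f a) m)" for m
    by (simp add: S_def Abs_mps_inverse)
  have "(f has_sum S) A"
  proof (rule has_sum_mpsI)
    fix m show "\<exists>B. finite B \<and> B \<subseteq> A \<and> (\<forall>a\<in>A - B. mps_coeff (f a) m = 0)
              \<and> (\<Sum>a\<in>B. mps_coeff (f a) m) = mps_coeff S m"
      by (intro exI[of _ "{a \<in> A. mps_coeff (f a) m \<noteq> 0}"]) (use fin in \<open>auto simp: S\<close>)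
  qed
  then have "infsum f A = S" by (rule infsumI)
  moreover have "(\<Sum>a\<in>B. mps_coeff (f a) m) = mps_coeff S m"
    unfolding S by (rule sum.mono_neutral_right) (use B in auto)
  ultimately show ?thesis by simp
qed

lemma eventually_agree_tendsto:
  assumes "(g \<longlongrightarrow> L) F" "F \<noteq> bot" "eventually (\<lambda>x. agree M (g x) h) F"
  shows "agree M L h"
  unfolding agree_def
proof
  fix m assume "m \<in> M"
  have "eventually (\<lambda>x. mps_coeff (g x) m = mps_coeff L m) F"
    using assms(1) by (simp add: tendsto_mps_iff)
  moreover have "eventually (\<lambda>x. mps_coeff (g x) m = mps_coeff h m) F"
    using assms(3) by (rule eventually_mono) (use \<open>m \<in> M\<close> in \<open>auto simp: agree_def\<close>)
  ultimately have "eventually (\<lambda>x. mps_coeff L m = mps_coeff h m) F"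
    by eventually_elim simp
  then show "mps_coeff L m = mps_coeff h m" using assms(2) by (simp add: eventually_const)
qed

section \<open>Raising operators and the Jacobi-Trudi determinant\<close>

definition pairs :: "nat \<Rightarrow> (nat \<times> nat) set" where "pairs l = {(i, j). i < j \<and> j < l}"

lemma finite_pairs [simp]: "finite (pairs l)"
  by (rule finite_subset[of _ "{..<l} \<times> {..<l}"]) (auto simp: pairs_def)

text \<open>
  A function on monomials extends linearly to integer polynomials. This describes the action of
  raising operators, and it transports the Vandermonde identity to arbitrary values \<open>\<phi>\<close>.
\<close>

definition linear_extension :: "('k \<Rightarrow> 'a::comm_ring_1) \<Rightarrow> ('k \<Rightarrow>\<^sub>0 int) \<Rightarrow> 'a" where
  "linear_extension \<phi> p = (\<Sum>k\<in>Poly_Mapping.keys p. of_int (Poly_Mapping.lookup p k) * \<phi> k)"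

lemma linear_extension_superset:
  "finite A \<Longrightarrow> Poly_Mapping.keys p \<subseteq> A \<Longrightarrow> linear_extension \<phi> p = (\<Sum>k\<in>A. of_int (Poly_Mapping.lookup p k) * \<phi> k)"
  unfolding linear_extension_def by (rule sum.mono_neutral_left) (auto simp: in_keys_iff)

lemma linear_extension_add: "linear_extension \<phi> (p + q) = linear_extension \<phi> p + linear_extension \<phi> q"
proof -
  let ?A = "Poly_Mapping.keys p \<union> Poly_Mapping.keys q"
  have "linear_extension \<phi> (p + q) = (\<Sum>k\<in>?A. of_int (Poly_Mapping.lookup (p + q) k) * \<phi> k)"
    by (rule linear_extension_superset) (auto dest: subsetD[OF Poly_Mapping.keys_add])
  also have "\<dots> = linear_extension \<phi> p + linear_extension \<phi> q"
    by (simp add: lookup_add sum.distrib distrib_right linear_extension_superset[of ?A p] linear_extension_superset[of ?A q])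
  finally show ?thesis .
qed

lemma linear_extension_zero [simp]: "linear_extension \<phi> 0 = 0" by (simp add: linear_extension_def)

lemma linear_extension_sum: "linear_extension \<phi> (\<Sum>i\<in>A. f i) = (\<Sum>i\<in>A. linear_extension \<phi> (f i))"
  by (induction A rule: infinite_finite_induct) (simp_all add: linear_extension_add)

lemma linear_extension_single: "linear_extension \<phi> (Poly_Mapping.single k c) = of_int c * \<phi> k"
  by (cases "c = 0") (simp_all add: linear_extension_def)

lemma prod_single_one:
  "(\<Prod>i\<in>S. Poly_Mapping.single (k i) (1 :: int)) = Poly_Mapping.single (\<Sum>i\<in>S. k i) 1"
  by (induction S rule: infinite_finite_induct) (simp_all add: mult_single)

lemma power_single_one:
  "Poly_Mapping.single k (1 :: int) ^ n = Poly_Mapping.single (\<Sum>i<n. k) 1"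
  using prod_single_one[of "\<lambda>_. k" "{..<n}"] by simp

lemma of_int_poly_mapping: "(of_int c :: ('k::comm_monoid_add) \<Rightarrow>\<^sub>0 int) = Poly_Mapping.single 0 c"
  by (metis of_int_eq_id id_apply single_of_int)

lemma linear_extension_of_int_mult_single:
  "linear_extension \<phi> (of_int c * Poly_Mapping.single (k :: 'k::comm_monoid_add) 1) = of_int c * \<phi> k"
  by (simp add: of_int_poly_mapping mult_single linear_extension_single)

lemma linear_extension_sign_mult_single:
  "linear_extension \<phi> ((-1) ^ n * Poly_Mapping.single (k :: 'k::comm_monoid_add) 1) = (-1) ^ n * \<phi> k"
  using linear_extension_of_int_mult_single[of \<phi> "(-1) ^ n" k] by simp

text \<open>
  Both sides expand the Vandermonde determinant in indeterminates \<open>Z\<^sub>i\<close>, on the left by the Leibniz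
  formula, on the right by choosing one term from each factor \<open>Z\<^sub>j - Z\<^sub>i\<close>; then each monomial
  is replaced by its value under \<open>\<phi>\<close>.
\<close>

lemma vandermonde_functional:
  fixes \<phi> :: "(nat \<Rightarrow>\<^sub>0 nat) \<Rightarrow> 'a::comm_ring_1"
  shows "(\<Sum>p | p permutes {0..<l}. signof p * \<phi> (\<Sum>i=0..<l. Poly_Mapping.single i (p i)))
    = (\<Sum>S\<in>Pow (pairs l). (-1) ^ card S *
         \<phi> ((\<Sum>(i, j)\<in>S. Poly_Mapping.single i 1) + (\<Sum>(i, j)\<in>pairs l - S. Poly_Mapping.single j 1)))"
proof -
  define Z where "Z = (\<lambda>i :: nat. Poly_Mapping.single (Poly_Mapping.single i (1 :: nat)) (1 :: int))"
  have Zp: "Z i ^ k = Poly_Mapping.single (Poly_Mapping.single i k) 1" for i k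
  proof -
    have "(\<Sum>ia<k. Poly_Mapping.single i (1 :: nat)) = Poly_Mapping.single i k"
      by (induction k) (simp_all add: single_add[symmetric] del: sum_constant)
    then show ?thesis unfolding Z_def power_single_one by simp
  qed
  have "det_fun l (\<lambda>i j. Z i ^ j) = (\<Sum>p | p permutes {0..<l}. of_int (sign p) *
      Poly_Mapping.single (\<Sum>i=0..<l. Poly_Mapping.single i (p i)) 1)"
    unfolding det_fun_expand Zp prod_single_one ..
  then have 1: "linear_extension \<phi> (det_fun l (\<lambda>i j. Z i ^ j)) =
      (\<Sum>p | p permutes {0..<l}. signof p * \<phi> (\<Sum>i=0..<l. Poly_Mapping.single i (p i)))"
    by (simp only: linear_extension_sum linear_extension_of_int_mult_single)
  have "det_fun l (\<lambda>i j. Z i ^ j) = (\<Prod>ij\<in>pairs l. Z (snd ij) - Z (fst ij))"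
    unfolding det_fun_vandermonde by (simp add: pairs_def case_prod_unfold)
  also have "\<dots> = (\<Sum>S\<in>Pow (pairs l). (-1) ^ card S * (\<Prod>x\<in>S. Z (fst x)) * (\<Prod>x\<in>pairs l - S. Z (snd x)))"
    by (rule prod_diff_conv_sum) simp
  also have "\<dots> = (\<Sum>S\<in>Pow (pairs l). (-1) ^ card S * Poly_Mapping.single
     ((\<Sum>(i, j)\<in>S. Poly_Mapping.single i 1) + (\<Sum>(i, j)\<in>pairs l - S. Poly_Mapping.single j 1)) 1)"
    by (simp add: Z_def prod_single_one mult.assoc mult_single case_prod_unfold)
  finally have "linear_extension \<phi> (det_fun l (\<lambda>i j. Z i ^ j)) = (\<Sum>S\<in>Pow (pairs l). (-1) ^ card S *
         \<phi> ((\<Sum>(i, j)\<in>S. Poly_Mapping.single i 1) + (\<Sum>(i, j)\<in>pairs l - S. Poly_Mapping.single j 1)))"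
    by (simp only: linear_extension_sum linear_extension_sign_mult_single)
  with 1 show ?thesis by simp
qed

text \<open>
  The inverse of a power series is constructed recursively from the inverse of its constant
  coefficient. It is a true inverse here because that coefficient is 1.
\<close>

lemma fps_geometric_inverse:
  "inverse (1 - fps_const c * fps_X) = Abs_fps (\<lambda>n. (c :: 'v mps) ^ n)"
proof -
  let ?f = "1 - fps_const c * fps_X" and ?g = "Abs_fps (\<lambda>n. c ^ n)"
  have fg: "?f * ?g = 1"
  proof (rule fps_ext)
    fix n show "fps_nth (?f * ?g) n = fps_nth 1 n"
      by (cases n) (simp_all add: left_diff_distrib mult.assoc)
  qed
  have inv1: "inverse (fps_nth ?f 0) = 1"
    by (rule inverse_mps_eqI) simp
  have fh: "?f * inverse ?f = 1"
    unfolding fps_inverse_def inv1 by (rule fps_right_inverse) simp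
  have "inverse ?f = (?f * ?g) * inverse ?f" by (simp only: fg mult_1)
  also have "\<dots> = (?f * inverse ?f) * ?g" by (simp only: ac_simps)
  finally show ?thesis by (simp only: fh mult_1)
qed

lemma fps_nth_prod_0: "fps_nth (\<Prod>i\<in>A. f i) 0 = (\<Prod>i\<in>A. fps_nth (f i) 0)"
  for f :: "'i \<Rightarrow> 'a::comm_ring_1 fps"
  by (induction A rule: infinite_finite_induct) simp_all

lemma complete_sym_0: "complete_sym x 0 = 1"
proof -
  have "Lim (finite_subsets_at_top UNIV)
     (\<lambda>I :: nat set. fps_nth (\<Prod>i\<in>I. inverse (1 - fps_const (x i) * fps_X)) 0) = 1"
    by (simp add: fps_geometric_inverse fps_nth_prod_0 tendsto_Lim)
  then show ?thesis by (simp add: complete_sym_def fps_infprod_def)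
qed

lemma complete_sym_neg: "r < 0 \<Longrightarrow> complete_sym x r = 0"
  by (simp add: complete_sym_def)

lemma complete_seq_eq_prod:
  assumes "\<And>k. k \<ge> l \<Longrightarrow> \<beta> k = 0"
  shows "complete_seq x \<beta> = (\<Prod>k=0..<l. complete_sym x (\<beta> k))"
proof -
  have "{k. \<beta> k \<noteq> 0} \<subseteq> {0..<l}" by (auto, meson assms not_le_imp_less)
  then show ?thesis unfolding complete_seq_def
    by (intro prod.mono_neutral_left) (auto simp: complete_sym_0)
qed

definition index_shift :: "(nat \<times> nat) set \<Rightarrow> nat \<Rightarrow> int" where
  "index_shift S k = (\<Sum>(i, j)\<in>S. of_bool (k = i) - of_bool (k = j))"

lemma raise_complete_linear_extension:
  "raise_complete p x \<alpha> = linear_extension (\<lambda>M. complete_seq x (raise_seq M \<alpha>)) p"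
  by (simp add: raise_complete_def linear_extension_def)

lemma raise_complete_expand:
  assumes "finite P"
  shows "raise_complete (\<Prod>ij\<in>P. 1 - raising_var ij) x \<alpha>
    = (\<Sum>S\<in>Pow P. (-1) ^ card S * complete_seq x (\<lambda>k. \<alpha> k + index_shift S k))"
proof -
  have lk: "Poly_Mapping.lookup (\<Sum>ij\<in>S. Poly_Mapping.single ij (1::nat)) ij = of_bool (ij \<in> S)"
    if "finite S" for S :: "(nat \<times> nat) set" and ij
    using that by (simp add: lookup_sum lookup_single when_def of_bool_def)
  have rs: "raise_seq (\<Sum>ij\<in>S. Poly_Mapping.single ij 1) \<alpha> = (\<lambda>k. \<alpha> k + index_shift S k)"
    if "finite S" for S
  proof -
    have "Poly_Mapping.keys (\<Sum>ij\<in>S. Poly_Mapping.single ij (1::nat)) = S"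
      by (rule Set.set_eqI) (simp only: in_keys_iff lk[OF that] of_bool_eq_0_iff not_not)
    then show ?thesis
      unfolding raise_seq_def index_shift_def
      by (auto simp: fun_eq_iff lk[OF that, unfolded One_nat_def] intro!: sum.cong)
  qed
  have "(\<Prod>ij\<in>P. 1 - raising_var ij) = (\<Sum>S\<in>Pow P. (-1) ^ card S * (\<Prod>ij\<in>S. raising_var ij))"
    using prod_diff_conv_sum[OF assms, of "\<lambda>_. 1" raising_var] by simp
  also have "\<dots> = (\<Sum>S\<in>Pow P. (-1) ^ card S *
      Poly_Mapping.single (\<Sum>ij\<in>S. Poly_Mapping.single ij 1) 1)"
    by (simp add: raising_var_def prod_single_one)
  finally have "raise_complete (\<Prod>ij\<in>P. 1 - raising_var ij) x \<alpha> =
     (\<Sum>S\<in>Pow P. (-1) ^ card S * complete_seq x (raise_seq (\<Sum>ij\<in>S. Poly_Mapping.single ij 1) \<alpha>))"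
    unfolding raise_complete_linear_extension
    by (simp only: linear_extension_sum linear_extension_sign_mult_single)
  also have "\<dots> = (\<Sum>S\<in>Pow P. (-1) ^ card S * complete_seq x (\<lambda>k. \<alpha> k + index_shift S k))"
  proof (rule sum.cong[OF refl])
    fix S assume "S \<in> Pow P"
    then have "finite S" using assms finite_subset by blast
    then show "(-1) ^ card S * complete_seq x (raise_seq (\<Sum>ij\<in>S. Poly_Mapping.single ij 1) \<alpha>)
      = (-1) ^ card S * complete_seq x (\<lambda>k. \<alpha> k + index_shift S k)"
      by (simp only: rs)
  qed
  finally show ?thesis .
qed

text \<open>
  Let \<open>J \<ge> l\<close> be the largest second index of a pair in \<open>S\<close>. No pair of \<open>S\<close> has first index \<open>J\<close>, so
  entry \<open>J\<close>, which was 0, only gets lowered; and complete functions of negative degree vanish.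
\<close>

lemma complete_seq_shift_eq_0:
  assumes \<alpha>: "\<And>k. k \<ge> l \<Longrightarrow> \<alpha> k = 0"
    and S: "finite S" "S \<subseteq> {(i, j). i < j}" "\<not> S \<subseteq> pairs l"
  shows "complete_seq x (\<lambda>k. \<alpha> k + index_shift S k) = 0"
proof -
  \<comment> \<open>the entry that is lowered but never raised\<close>
  define J where "J = Max (snd ` S)"
  from S obtain i j where ij: "(i, j) \<in> S" "j \<ge> l" by (auto simp: pairs_def) (metis not_less)
  have le: "j \<le> J" if "(i, j) \<in> S" for i j
    unfolding J_def using S(1) that by (intro Max_ge) force+
  have "J \<in> snd ` S" unfolding J_def using S(1) ij by (intro Max_in) auto
  then obtain i' where i': "(i', J) \<in> S" by auto
  have J: "J \<ge> l" using le[OF ij(1)] ij(2) by simp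
  have "index_shift S J = (\<Sum>ij\<in>S. - of_bool (J = snd ij))"
    unfolding index_shift_def
  proof (rule sum.cong[OF refl])
    fix ij assume "ij \<in> S"
    then have "fst ij < snd ij" "snd ij \<le> J" using le[of "fst ij" "snd ij"] S(2) by auto
    then show "(case ij of (i, j) \<Rightarrow> of_bool (J = i) - of_bool (J = j)) = (- of_bool (J = snd ij) :: int)"
      by (cases ij) auto
  qed
  also have "\<dots> = - int (card {ij\<in>S. J = snd ij})"
    using S(1) by (simp add: sum_negf of_bool_def sum.If_cases Int_def)
  also have "\<dots> < 0"
    using i' S(1) by (auto simp: card_gt_0_iff)
  finally have neg: "\<alpha> J + index_shift S J < 0" using \<alpha>[OF J] by simp
  define L where "L = Suc (max l J)"
  have "\<alpha> k + index_shift S k = 0" if "k \<ge> L" for k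
  proof -
    have "index_shift S k = 0" unfolding index_shift_def
    proof (rule sum.neutral, rule ballI)
      fix ij assume "ij \<in> S"
      then have "fst ij < snd ij" "snd ij \<le> J" using le[of "fst ij" "snd ij"] S(2) by auto
      then show "(case ij of (i, j) \<Rightarrow> of_bool (k = i) - of_bool (k = j)) = (0 :: int)"
        using that by (cases ij) (auto simp: L_def)
    qed
    then show ?thesis using \<alpha>[of k] that by (simp add: L_def)
  qed
  then have "complete_seq x (\<lambda>k. \<alpha> k + index_shift S k) = (\<Prod>k=0..<L. complete_sym x (\<alpha> k + index_shift S k))"
    by (rule complete_seq_eq_prod)
  also have "\<dots> = 0"
    by (rule prod_zero) (auto simp: L_def intro!: bexI[of _ J] complete_sym_neg neg)
  finally show ?thesis .
qed

text \<open>
  Once a finite subproduct contains all pairs below \<open>l\<close>, further factors only contribute terms that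
  vanish by the preceding lemma.
\<close>

lemma schur_eq_sum:
  assumes \<alpha>: "\<And>k. k \<ge> l \<Longrightarrow> \<alpha> k = 0"
  shows "schur x \<alpha> = (\<Sum>S\<in>Pow (pairs l). (-1) ^ card S * complete_seq x (\<lambda>k. \<alpha> k + index_shift S k))"
  unfolding schur_def
proof (rule tendsto_Lim)
  show "((\<lambda>P. raise_complete (\<Prod>ij\<in>P. 1 - raising_var ij) x \<alpha>) \<longlongrightarrow>
     (\<Sum>S\<in>Pow (pairs l). (-1) ^ card S * complete_seq x (\<lambda>k. \<alpha> k + index_shift S k)))
     (finite_subsets_at_top {(i, j). i < j})"
  proof (rule tendsto_eventually, unfold eventually_finite_subsets_at_top,
      intro exI[of _ "pairs l"] conjI allI impI)
    fix P assume P: "finite P \<and> pairs l \<subseteq> P \<and> P \<subseteq> {(i, j). i < j}"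
    have "raise_complete (\<Prod>ij\<in>P. 1 - raising_var ij) x \<alpha> =
        (\<Sum>S\<in>Pow P. (-1) ^ card S * complete_seq x (\<lambda>k. \<alpha> k + index_shift S k))"
      using P by (intro raise_complete_expand) simp
    also have "\<dots> = (\<Sum>S\<in>Pow (pairs l). (-1) ^ card S * complete_seq x (\<lambda>k. \<alpha> k + index_shift S k))"
    proof (rule sum.mono_neutral_right)
      show "\<forall>S\<in>Pow P - Pow (pairs l). (-1) ^ card S * complete_seq x (\<lambda>k. \<alpha> k + index_shift S k) = 0"
      proof
        fix S assume "S \<in> Pow P - Pow (pairs l)"
        then have "complete_seq x (\<lambda>k. \<alpha> k + index_shift S k) = 0"
          using P by (intro complete_seq_shift_eq_0[OF \<alpha>]) (auto dest: finite_subset)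
        then show "(-1) ^ card S * complete_seq x (\<lambda>k. \<alpha> k + index_shift S k) = 0" by simp
      qed
    qed (use P in auto)
    finally show "raise_complete (\<Prod>ij\<in>P. 1 - raising_var ij) x \<alpha> =
       (\<Sum>S\<in>Pow (pairs l). (-1) ^ card S * complete_seq x (\<lambda>k. \<alpha> k + index_shift S k))" .
  next
    show "finite (pairs l)" by simp
    show "pairs l \<subseteq> {(i, j). i < j}" by (auto simp: pairs_def)
  qed
qed simp

definition jacobi_trudi :: "(int \<Rightarrow> 'a::comm_ring_1) \<Rightarrow> nat \<Rightarrow> (nat \<Rightarrow> int) \<Rightarrow> 'a" where
  "jacobi_trudi h n \<mu> = det_fun n (\<lambda>i j. h (\<mu> i + int j - int i))"

text \<open>
  Multiplying \<open>\<Prod>\<^sub>i\<^sub><\<^sub>j (1 - z\<^sub>i / z\<^sub>j)\<close> by \<open>\<Prod>\<^sub>k z\<^sub>k\<^sup>k\<close> turns it into \<open>\<Prod>\<^sub>i\<^sub><\<^sub>j (z\<^sub>j - z\<^sub>i)\<close>. For the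
  term that takes \<open>z\<^sub>i\<close> from the factors in \<open>S\<close>, this compares the two exponents of \<open>z\<^sub>k\<close>.
\<close>

lemma index_shift_complement:
  assumes "S \<subseteq> pairs l" "k < l"
  shows "int (Poly_Mapping.lookup ((\<Sum>(i, j)\<in>S. Poly_Mapping.single i 1) + (\<Sum>(i, j)\<in>pairs l - S. Poly_Mapping.single j 1)) k)
     = int k + index_shift S k"
proof -
  have fin: "finite S" using assms(1) by (rule finite_subset) simp
  have c: "(\<Sum>x\<in>A. int (Poly_Mapping.lookup (Poly_Mapping.single (f x) (1::nat)) k)) = (\<Sum>x\<in>A. of_bool (k = f x))"
    for A :: "(nat \<times> nat) set" and f
    by (intro sum.cong refl) (auto simp: lookup_single when_def)
  have "(\<Sum>ij\<in>pairs l. of_bool (k = snd ij)) = int (card {ij \<in> pairs l. k = snd ij})"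
    by (simp add: of_bool_def sum.If_cases Int_def)
  also have "{ij \<in> pairs l. k = snd ij} = (\<lambda>i. (i, k)) ` {..<k}"
    using assms(2) by (auto simp: pairs_def)
  also have "int (card \<dots>) = int k" by (simp add: card_image inj_on_def)
  finally have tot: "(\<Sum>ij\<in>pairs l. of_bool (k = snd ij)) = int k" .
  have "int (Poly_Mapping.lookup ((\<Sum>(i, j)\<in>S. Poly_Mapping.single i 1) + (\<Sum>(i, j)\<in>pairs l - S. Poly_Mapping.single j 1)) k)
    = (\<Sum>ij\<in>S. of_bool (k = fst ij)) + (\<Sum>ij\<in>pairs l - S. of_bool (k = snd ij))"
    unfolding case_prod_unfold lookup_add lookup_sum of_nat_add of_nat_sum c ..
  also have "(\<Sum>ij\<in>pairs l - S. of_bool (k = snd ij)) = int k - (\<Sum>ij\<in>S. of_bool (k = snd ij))"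
    using tot by (simp add: sum_diff[OF finite_pairs assms(1)])
  finally show ?thesis by (simp add: index_shift_def case_prod_unfold sum_subtractf)
qed

text \<open>
  The size \<open>l\<close> may be any bound on the length of \<open>\<alpha>\<close>, which allows one size for all partitions that
  contribute to a given coefficient.
\<close>

lemma schur_eq_jacobi_trudi:
  assumes \<alpha>: "\<And>k. k \<ge> l \<Longrightarrow> \<alpha> k = 0"
  shows "schur x \<alpha> = jacobi_trudi (complete_sym x) l \<alpha>"
proof -
  define \<phi> where "\<phi> = (\<lambda>m :: nat \<Rightarrow>\<^sub>0 nat.
      complete_seq x (\<lambda>k. \<alpha> k + (if k < l then int (Poly_Mapping.lookup m k) - int k else 0)))"
  have "schur x \<alpha> = (\<Sum>S\<in>Pow (pairs l). (-1) ^ card S *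
     \<phi> ((\<Sum>(i, j)\<in>S. Poly_Mapping.single i 1) + (\<Sum>(i, j)\<in>pairs l - S. Poly_Mapping.single j 1)))"
  proof (rule trans[OF schur_eq_sum[of l \<alpha> x]], rule \<alpha>, assumption,
      intro sum.cong refl arg_cong2[where f = "(*)"])
    fix S assume S: "S \<in> Pow (pairs l)"
    have "index_shift S k = (if k < l then int (Poly_Mapping.lookup ((\<Sum>(i, j)\<in>S. Poly_Mapping.single i 1)
        + (\<Sum>(i, j)\<in>pairs l - S. Poly_Mapping.single j 1)) k) - int k else 0)" for k
    proof (cases "k < l")
      case True
      then show ?thesis using index_shift_complement[of S l k] S by simp
    next
      case False
      have "index_shift S k = 0"
        unfolding index_shift_def
      proof (rule sum.neutral, rule ballI)
        fix ij assume "ij \<in> S"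
        then have "fst ij < snd ij" "snd ij < l" using S by (auto simp: pairs_def)
        then show "(case ij of (i, j) \<Rightarrow> of_bool (k = i) - of_bool (k = j)) = (0 :: int)"
          using False by (cases ij) auto
      qed
      then show ?thesis using False by simp
    qed
    then show "complete_seq x (\<lambda>k. \<alpha> k + index_shift S k) = \<phi> ((\<Sum>(i, j)\<in>S. Poly_Mapping.single i 1)
        + (\<Sum>(i, j)\<in>pairs l - S. Poly_Mapping.single j 1))"
      by (simp only: \<phi>_def)
  qed
  also have "\<dots> = (\<Sum>p | p permutes {0..<l}. signof p * \<phi> (\<Sum>i=0..<l. Poly_Mapping.single i (p i)))"
    by (rule vandermonde_functional[symmetric])
  also have "\<dots> = jacobi_trudi (complete_sym x) l \<alpha>"
    unfolding jacobi_trudi_def det_fun_expand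
  proof (intro sum.cong refl arg_cong2[where f = "(*)"])
    fix p :: "nat \<Rightarrow> nat"
    have lk: "Poly_Mapping.lookup (\<Sum>i=0..<l. Poly_Mapping.single i (p i)) k = p k" if "k < l" for k
      using that by (simp add: lookup_sum lookup_single when_def)
    have "\<phi> (\<Sum>i=0..<l. Poly_Mapping.single i (p i)) =
       (\<Prod>k=0..<l. complete_sym x (\<alpha> k + (if k < l then int (Poly_Mapping.lookup (\<Sum>i=0..<l. Poly_Mapping.single i (p i)) k) - int k else 0)))"
      unfolding \<phi>_def by (rule complete_seq_eq_prod) (simp add: \<alpha>)
    also have "\<dots> = (\<Prod>k=0..<l. complete_sym x (\<alpha> k + int (p k) - int k))"
      by (intro prod.cong refl) (simp add: lk add_diff_eq)
    finally show "\<phi> (\<Sum>i=0..<l. Poly_Mapping.single i (p i)) =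
       (\<Prod>k=0..<l. complete_sym x (\<alpha> k + int (p k) - int k))" .
  qed
  finally show ?thesis .
qed

section \<open>Alternants\<close>

text \<open>
  Coefficients at negative indices occur in the determinants and are 0.
\<close>

definition int_coeff :: "'a::comm_ring_1 fps \<Rightarrow> int \<Rightarrow> 'a" where
  "int_coeff F r = (if r < 0 then 0 else fps_nth F (nat r))"

definition complete_gen :: "(nat \<Rightarrow> 'a::comm_ring_1) \<Rightarrow> nat \<Rightarrow> 'a fps" where
  "complete_gen x n = (\<Prod>i<n. Abs_fps (\<lambda>r. x i ^ r))"

definition elementary_gen :: "(nat \<Rightarrow> 'a::comm_ring_1) \<Rightarrow> nat \<Rightarrow> 'a fps" where
  "elementary_gen x n = (\<Prod>i<n. 1 + fps_const (x i) * fps_X)"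

lemma geometric_fps: "Abs_fps (\<lambda>n. c ^ n) * (1 - fps_const c * fps_X) = (1 :: 'a::comm_ring_1 fps)"
proof (rule fps_ext)
  fix n show "fps_nth (Abs_fps (\<lambda>n. c ^ n) * (1 - fps_const c * fps_X)) n = fps_nth 1 n"
    by (subst mult.commute, cases n) (simp_all add: left_diff_distrib mult.assoc)
qed

lemma linear_prod_degree:
  "finite A \<Longrightarrow> card A < k \<Longrightarrow> fps_nth (\<Prod>i\<in>A. 1 - fps_const (y i) * fps_X) k = (0 :: 'a::comm_ring_1)"
proof (induction A arbitrary: k rule: finite_induct)
  case (insert a A)
  then obtain k' where k: "k = Suc k'" "card A < k'" by (cases k) auto
  then show ?case using insert by (simp add: left_diff_distrib mult.assoc)
qed simp

text \<open>
  Multiplying the generating function of the complete functions by all \<open>1 - y\<^sub>i t\<close> with \<open>i \<noteq> j\<close>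
  leaves the geometric series of \<open>y\<^sub>j t\<close>. The multiplier has degree below \<open>n\<close>, so \<open>n\<close> terms suffice
  for every exponent \<open>b\<close>.
\<close>

lemma power_eq_complete_combination:
  fixes y :: "nat \<Rightarrow> 'a::comm_ring_1"
  assumes j: "j < n"
  shows "y j ^ b = (\<Sum>k<n. int_coeff (complete_gen y n) (int b - int k) *
            fps_nth (\<Prod>i\<in>{..<n} - {j}. 1 - fps_const (y i) * fps_X) k)"
proof -
  let ?C = "\<Prod>i\<in>{..<n} - {j}. 1 - fps_const (y i) * fps_X"
  have "complete_gen y n = Abs_fps (\<lambda>r. y j ^ r) * (\<Prod>i\<in>{..<n} - {j}. Abs_fps (\<lambda>r. y i ^ r))"
    unfolding complete_gen_def using j by (intro prod.remove) auto
  then have "?C * complete_gen y n = Abs_fps (\<lambda>r. y j ^ r) *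
      (\<Prod>i\<in>{..<n} - {j}. Abs_fps (\<lambda>r. y i ^ r) * (1 - fps_const (y i) * fps_X))"
    by (simp only: prod.distrib ac_simps)
  then have eq: "?C * complete_gen y n = Abs_fps (\<lambda>r. y j ^ r)"
    by (simp only: geometric_fps prod.neutral_const mult_1_right)
  have "y j ^ b = fps_nth (?C * complete_gen y n) b" by (simp add: eq)
  also have "\<dots> = (\<Sum>k=0..b. int_coeff (complete_gen y n) (int b - int k) * fps_nth ?C k)"
    unfolding fps_mult_nth by (intro sum.cong refl) (simp add: int_coeff_def nat_diff_distrib mult.commute flip: of_nat_diff)
  also have "\<dots> = (\<Sum>k\<in>{0..b} \<union> {..<n}. int_coeff (complete_gen y n) (int b - int k) * fps_nth ?C k)"
    by (rule sum.mono_neutral_left) (auto simp: int_coeff_def)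
  also have "\<dots> = (\<Sum>k<n. int_coeff (complete_gen y n) (int b - int k) * fps_nth ?C k)"
  proof (rule sum.mono_neutral_right)
    show "\<forall>k\<in>{0..b} \<union> {..<n} - {..<n}. int_coeff (complete_gen y n) (int b - int k) * fps_nth ?C k = 0"
    proof
      fix k assume "k \<in> {0..b} \<union> {..<n} - {..<n}"
      then have "fps_nth ?C k = 0" using j by (intro linear_prod_degree) auto
      then show "int_coeff (complete_gen y n) (int b - int k) * fps_nth ?C k = 0" by simp
    qed
  qed auto
  finally show ?thesis .
qed

lemma int_coeff_complete_gen_0: "int_coeff (complete_gen y n) 0 = 1"
  by (simp add: int_coeff_def complete_gen_def fps_nth_prod_0)

text \<open>
  The matrix of powers is the product of a matrix of complete functions and a matrix \<open>C\<close> that does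
  not depend on the exponents. For the exponents \<open>0, \<dots>, n - 1\<close> the first factor is unitriangular,
  which identifies \<open>det C\<close> as the Vandermonde determinant.
\<close>

lemma bialternant:
  fixes y :: "nat \<Rightarrow> 'a::comm_ring_1"
  shows "det_fun n (\<lambda>i j. y j ^ \<beta> i) =
     det_fun n (\<lambda>i k. int_coeff (complete_gen y n) (int (\<beta> i) - int k)) * det_fun n (\<lambda>i j. y j ^ i)"
proof -
  define C where "C = (\<lambda>k j. fps_nth (\<Prod>i\<in>{..<n} - {j}. 1 - fps_const (y i) * fps_X) k)"
  have fac: "det_fun n (\<lambda>i j. y j ^ \<beta> i) = det_fun n (\<lambda>i k. int_coeff (complete_gen y n) (int (\<beta> i) - int k)) * det_fun n C" for \<beta>
  proof -
    have "det_fun n (\<lambda>i j. y j ^ \<beta> i) = det_fun n (\<lambda>i j. \<Sum>k<n. int_coeff (complete_gen y n) (int (\<beta> i) - int k) * C k j)"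
      unfolding C_def by (rule det_fun_cong) (rule power_eq_complete_combination)
    then show ?thesis by (simp only: det_fun_mult)
  qed
  have "det_fun n (\<lambda>i k. int_coeff (complete_gen y n) (int i - int k)) = (\<Prod>i<n. int_coeff (complete_gen y n) (int i - int i))"
    by (rule det_fun_triangular) (simp add: int_coeff_def)
  then have "det_fun n C = det_fun n (\<lambda>i j. y j ^ i)"
    using fac[of "\<lambda>i. i"] by (simp add: int_coeff_complete_gen_0)
  then show ?thesis using fac by simp
qed

section \<open>Partitions and strictly decreasing sequences\<close>

lemma sorting_permutation:
  fixes f :: "nat \<Rightarrow> 'a::linorder"
  shows "\<exists>p. p permutes {0..<n} \<and> (\<forall>i j. i \<le> j \<longrightarrow> j < n \<longrightarrow> f (p j) \<le> f (p i))"
proof -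
  let ?xs = "map f [0..<n]" let ?ys = "rev (sort ?xs)"
  have "mset ?ys = mset ?xs" by simp
  then obtain p where p: "p permutes {..<length ?xs}" "permute_list p ?xs = ?ys"
    by (rule mset_eq_permutation)
  have nth: "?ys ! i = f (p i)" if "i < n" for i
  proof -
    have "p i < n" using p(1) that permutes_in_image[of p "{..<n}" i] by simp
    then show ?thesis
      using that permute_list_nth[OF p(1), of i] by (simp add: p(2)[symmetric])
  qed
  have "f (p j) \<le> f (p i)" if "i \<le> j" "j < n" for i j
  proof -
    have "?ys ! j \<le> ?ys ! i"
      using that by (intro sorted_rev_nth_mono) (auto)
    then show ?thesis using nth that by simp
  qed
  with p(1) show ?thesis by (auto simp: lessThan_atLeast0)
qed

lemma finite_initial_segment:
  assumes "finite D" "\<And>i j. j \<in> D \<Longrightarrow> i \<le> j \<Longrightarrow> i \<in> D"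
  shows "D = {..<card (D :: nat set)}"
proof (cases "D = {}")
  case False
  have "D = {..Max D}"
  proof
    show "D \<subseteq> {..Max D}" using Max_ge[OF assms(1)] by blast
    show "{..Max D} \<subseteq> D" using assms(2)[OF Max_in[OF assms(1) False]] by blast
  qed
  then have "D = {..<Suc (Max D)}" by (simp only: lessThan_Suc_atMost)
  moreover from this have "card D = Suc (Max D)" by (metis card_lessThan)
  ultimately show ?thesis by simp
qed simp

text \<open>
  For a decreasing function the set of arguments with value at least \<open>c\<close> is an initial segment, hence
  determined by its cardinality, and the cardinality is invariant under permutations.
\<close>

lemma sorted_unique:
  fixes g g' :: "nat \<Rightarrow> 'a::linorder"
  assumes p: "p permutes {0..<n}" and g': "\<And>i. i < n \<Longrightarrow> g' i = g (p i)"
    and mono: "\<And>i j. i \<le> j \<Longrightarrow> j < n \<Longrightarrow> g j \<le> g i" "\<And>i j. i \<le> j \<Longrightarrow> j < n \<Longrightarrow> g' j \<le> g' i"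
    and i: "i < n"
  shows "g' i = g i"
proof -
  have *: "{i. i < n \<and> c \<le> g' i} = {i. i < n \<and> c \<le> g i}" for c
  proof -
    let ?D' = "{i. i < n \<and> c \<le> g' i}" and ?D = "{i. i < n \<and> c \<le> g i}"
    have "bij_betw p ?D' ?D"
    proof (rule bij_betw_imageI)
      show "inj_on p ?D'" using permutes_inj[OF p] by (rule inj_on_subset) simp
      show "p ` ?D' = ?D"
      proof safe
        fix i assume "i < n" "c \<le> g' i"
        then show "p i < n" "c \<le> g (p i)" using g' p permutes_in_image[OF p, of i] by auto
      next
        fix j assume j: "j < n" "c \<le> g j"
        then obtain i where "i < n" "j = p i"
          using permutes_image[OF p] by (metis atLeastLessThan_iff imageE zero_le)
        then show "j \<in> p ` ?D'" using j g' by auto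
      qed
    qed
    then have "card ?D' = card ?D" by (rule bij_betw_same_card)
    moreover have "?D = {..<card ?D}"
      by (rule finite_initial_segment) (auto dest: mono(1) order.trans)
    moreover have "?D' = {..<card ?D'}"
      by (rule finite_initial_segment) (auto dest: mono(2) order.trans)
    ultimately show ?thesis by metis
  qed
  show ?thesis
  proof (rule antisym)
    show "g' i \<le> g i" using *[of "g' i"] i by blast
    show "g i \<le> g' i" using *[of "g i"] i by blast
  qed
qed

definition boxed_partitions :: "nat \<Rightarrow> nat \<Rightarrow> (nat \<Rightarrow> int) set" where
  "boxed_partitions n K = {\<mu> \<in> partitions. (\<forall>k\<ge>n. \<mu> k = 0) \<and> (\<forall>k. \<mu> k \<le> int K)}"

lemma partitionsD:
  assumes "\<mu> \<in> partitions"
  shows "i \<le> j \<Longrightarrow> \<mu> j \<le> \<mu> i" "0 \<le> \<mu> i" "finite {i. \<mu> i \<noteq> 0}"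
  using assms by (auto simp: partitions_def antimono_def)

lemma boxed_partitions_subset: "boxed_partitions n K \<subseteq> partitions" by (auto simp: boxed_partitions_def)

lemma finite_boxed_partitions [simp]: "finite (boxed_partitions n K)"
proof (rule finite_imageD)
  show "finite ((\<lambda>\<mu>. restrict \<mu> {0..<n}) ` boxed_partitions n K)"
  proof (rule finite_subset)
    show "(\<lambda>\<mu>. restrict \<mu> {0..<n}) ` boxed_partitions n K \<subseteq> PiE {0..<n} (\<lambda>_. {0..int K})"
      by (auto simp: boxed_partitions_def partitions_def)
    show "finite (PiE {0..<n} (\<lambda>_. {0..int K}))" by (intro finite_PiE) auto
  qed
  show "inj_on (\<lambda>\<mu>. restrict \<mu> {0..<n}) (boxed_partitions n K)"
  proof (rule inj_onI, rule ext)
    fix \<mu> \<nu> k assume b: "\<mu> \<in> boxed_partitions n K" "\<nu> \<in> boxed_partitions n K" and eq: "restrict \<mu> {0..<n} = restrict \<nu> {0..<n}"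
    show "\<mu> k = \<nu> k"
      using b fun_cong[OF eq, of k] by (cases "k < n") (auto simp: boxed_partitions_def)
  qed
qed

text \<open>
  Adding the staircase makes a partition strictly decreasing, which lets it index the minors in the
  Cauchy-Binet formula.
\<close>

definition beta_number :: "nat \<Rightarrow> (nat \<Rightarrow> int) \<Rightarrow> nat \<Rightarrow> nat" where
  "beta_number n \<mu> i = nat (\<mu> i) + (n - 1 - i)"

lemma beta_number_strict:
  assumes "\<mu> \<in> partitions" "i < j" "j < n"
  shows "beta_number n \<mu> j < beta_number n \<mu> i"
  using partitionsD(1)[OF assms(1), of i j] assms unfolding beta_number_def by linarith

lemma beta_number_mono: "\<mu> \<in> partitions \<Longrightarrow> i \<le> j \<Longrightarrow> j < n \<Longrightarrow> beta_number n \<mu> j \<le> beta_number n \<mu> i"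
  using beta_number_strict[of \<mu> i j n] by (cases "i = j") auto

lemma beta_number_inj: "\<mu> \<in> partitions \<Longrightarrow> i < n \<Longrightarrow> j < n \<Longrightarrow> beta_number n \<mu> i = beta_number n \<mu> j \<Longrightarrow> i = j"
  using beta_number_strict[of \<mu> i j n] beta_number_strict[of \<mu> j i n] by (metis less_irrefl linorder_neqE_nat)

text \<open>
  An injective function is a strictly decreasing one composed with a unique permutation; subtracting
  the staircase from the former leaves a partition.
\<close>

lemma beta_number_bij:
  "bij_betw (\<lambda>(\<mu>, p). restrict (\<lambda>j. beta_number n \<mu> (p j)) {0..<n})
     (boxed_partitions n K \<times> {p. p permutes {0..<n}})
     {f \<in> PiE {0..<n} (\<lambda>_. {..<n + K}). inj_on f {0..<n}}"
proof (rule bij_betw_imageI)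
  let ?P = "{p. p permutes {0..<n}}"
  let ?\<Phi> = "\<lambda>(\<mu>, p). restrict (\<lambda>j. beta_number n \<mu> (p j)) {0..<n}"
  show "inj_on ?\<Phi> (boxed_partitions n K \<times> ?P)"
  proof (rule inj_onI, clarify)
    fix \<mu> p \<nu> q
    assume \<mu>: "\<mu> \<in> boxed_partitions n K" and \<nu>: "\<nu> \<in> boxed_partitions n K" and p: "p permutes {0..<n}" and q: "q permutes {0..<n}"
      and eq: "restrict (\<lambda>j. beta_number n \<mu> (p j)) {0..<n} = restrict (\<lambda>j. beta_number n \<nu> (q j)) {0..<n}"
    have par: "\<mu> \<in> partitions" "\<nu> \<in> partitions" using \<mu> \<nu> boxed_partitions_subset by auto
    have e: "beta_number n \<mu> (p j) = beta_number n \<nu> (q j)" if "j < n" for j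
      using fun_cong[OF eq, of j] that by simp
    let ?r = "p \<circ> Hilbert_Choice.inv q"
    have r: "?r permutes {0..<n}" by (intro permutes_compose permutes_inv p q)
    have "beta_number n \<nu> i = beta_number n \<mu> (?r i)" if "i < n" for i
    proof -
      have "Hilbert_Choice.inv q i < n"
        using permutes_in_image[OF permutes_inv[OF q], of i] that by simp
      then show ?thesis using e[of "Hilbert_Choice.inv q i"] permutes_inverses(1)[OF q] by simp
    qed
    then have b: "beta_number n \<nu> i = beta_number n \<mu> i" if "i < n" for i
      by (rule sorted_unique[OF r]) (use that par in \<open>auto intro: beta_number_mono\<close>)
    have "\<mu> = \<nu>"
    proof
      fix k show "\<mu> k = \<nu> k"
        using b[of k] \<mu> \<nu> partitionsD(2)[OF par(1), of k] partitionsD(2)[OF par(2), of k]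
        by (cases "k < n") (auto simp: beta_number_def boxed_partitions_def)
    qed
    moreover have "p = q"
    proof
      fix j show "p j = q j"
      proof (cases "j < n")
        case True
        then have "p j < n" "q j < n"
          using permutes_in_image[OF p, of j] permutes_in_image[OF q, of j] by auto
        then show ?thesis using e[OF True] unfolding \<open>\<mu> = \<nu>\<close> by (rule beta_number_inj[OF par(2)])
      next
        case False
        then show ?thesis using permutes_not_in[OF p, of j] permutes_not_in[OF q, of j] by simp
      qed
    qed
    ultimately show "\<mu> = \<nu> \<and> p = q" ..
  qed
  show "?\<Phi> ` (boxed_partitions n K \<times> ?P) = {f \<in> PiE {0..<n} (\<lambda>_. {..<n + K}). inj_on f {0..<n}}"
  proof safe
    fix \<mu> p j assume \<mu>: "\<mu> \<in> boxed_partitions n K" and p: "p permutes {0..<n}"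
    have par: "\<mu> \<in> partitions" using \<mu> boxed_partitions_subset by auto
    have pn: "p j < n" if "j < n" for j using permutes_in_image[OF p, of j] that by simp
    {
      assume j: "j \<in> {0..<n}"
      have "nat (\<mu> (p j)) \<le> K" using \<mu> by (simp add: boxed_partitions_def nat_le_iff)
      then show "restrict (\<lambda>j. beta_number n \<mu> (p j)) {0..<n} j < n + K"
        using pn[of j] j by (simp add: beta_number_def)
    }
    {
      assume "j \<notin> {0..<n}"
      then show "restrict (\<lambda>j. beta_number n \<mu> (p j)) {0..<n} j = undefined" by simp
    }
    show "inj_on (restrict (\<lambda>j. beta_number n \<mu> (p j)) {0..<n}) {0..<n}"
    proof (rule inj_onI)
      fix i j assume "i \<in> {0..<n}" "j \<in> {0..<n}"
        "restrict (\<lambda>j. beta_number n \<mu> (p j)) {0..<n} i = restrict (\<lambda>j. beta_number n \<mu> (p j)) {0..<n} j"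
      then have "beta_number n \<mu> (p i) = beta_number n \<mu> (p j)" "p i < n" "p j < n" using pn by auto
      then have "p i = p j" by (rule beta_number_inj[OF par, rotated 2])
      then show "i = j" using permutes_inj[OF p] by (simp add: inj_eq)
    qed
  next
    fix f assume f: "f \<in> PiE {0..<n} (\<lambda>_. {..<n + K})" and inj: "inj_on f {0..<n}"
    obtain p where p: "p permutes {0..<n}" and srt: "\<And>i j. i \<le> j \<Longrightarrow> j < n \<Longrightarrow> f (p j) \<le> f (p i)"
      using sorting_permutation[of n f] by blast
    have pn: "p j < n" if "j < n" for j using permutes_in_image[OF p, of j] that by simp
    have strict: "f (p j) < f (p i)" if "i < j" "j < n" for i j
    proof -
      have "p i \<noteq> p j" using that permutes_inj[OF p] by (auto simp: inj_eq)
      then have "f (p i) \<noteq> f (p j)" using inj pn[of i] pn[of j] that by (auto simp: inj_on_def)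
      then show ?thesis using srt[of i j] that by simp
    qed
    have gap: "f (p (i + d)) + d \<le> f (p i)" if "i + d < n" for i d
      using that
    proof (induction d)
      case (Suc d)
      then show ?case using strict[of "i + d" "i + Suc d"] by simp
    qed simp
    define \<mu> where "\<mu> = (\<lambda>i. if i < n then int (f (p i)) - int (n - 1 - i) else 0)"
    have nonneg: "0 \<le> \<mu> i" for i
      using gap[of i "n - 1 - i"] by (auto simp: \<mu>_def)
    have anti: "\<mu> j \<le> \<mu> i" if "i \<le> j" for i j
    proof (cases "j < n")
      case True
      then show ?thesis using gap[of i "j - i"] that by (simp add: \<mu>_def)
    next
      case False
      then show ?thesis using nonneg[of i] by (simp add: \<mu>_def)
    qed
    have le: "\<mu> k \<le> int K" for k
    proof -
      have "\<mu> k \<le> \<mu> 0" by (rule anti) simp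
      also have "\<mu> 0 \<le> int K"
      proof (cases "0 < n")
        case True
        then have "f (p 0) < n + K" using f pn[of 0] by (auto simp: PiE_iff)
        then show ?thesis using True by (simp add: \<mu>_def)
      qed (simp add: \<mu>_def)
      finally show ?thesis .
    qed
    have "{i. \<mu> i \<noteq> 0} \<subseteq> {..<n}" by (auto simp: \<mu>_def split: if_splits)
    then have "finite {i. \<mu> i \<noteq> 0}" by (rule finite_subset) simp
    then have \<mu>: "\<mu> \<in> boxed_partitions n K"
      using nonneg anti le by (auto simp: boxed_partitions_def partitions_def antimono_def) (simp add: \<mu>_def)
    have b: "beta_number n \<mu> i = f (p i)" if "i < n" for i
      using nonneg[of i] that by (simp add: beta_number_def \<mu>_def)
    have q: "Hilbert_Choice.inv p permutes {0..<n}" by (rule permutes_inv[OF p])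
    have "f = restrict (\<lambda>j. beta_number n \<mu> (Hilbert_Choice.inv p j)) {0..<n}"
    proof
      fix j show "f j = restrict (\<lambda>j. beta_number n \<mu> (Hilbert_Choice.inv p j)) {0..<n} j"
      proof (cases "j < n")
        case True
        then have "Hilbert_Choice.inv p j < n" using permutes_in_image[OF q, of j] by simp
        then show ?thesis using True b permutes_inverses(1)[OF p] by simp
      next
        case False
        then show ?thesis using f by (auto simp: PiE_iff extensional_def)
      qed
    qed
    then show "f \<in> ?\<Phi> ` (boxed_partitions n K \<times> ?P)" using \<mu> q by (auto intro!: image_eqI[of _ _ "(\<mu>, Hilbert_Choice.inv p)"])
  qed
qed

section \<open>A finite Cauchy identity\<close>

text \<open>
  The columns have to be reversed. The resulting sign appears twice in the Cauchy-Binet formula and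
  cancels there.
\<close>

lemma det_fun_beta_number:
  assumes "\<mu> \<in> partitions"
  shows "det_fun n (\<lambda>i k. int_coeff F (int (beta_number n \<mu> i) - int k)) =
     signof (\<lambda>i. if i < n then n - 1 - i else i) * jacobi_trudi (int_coeff F) n \<mu>"
proof -
  define r where "r = (\<lambda>i. if i < n then n - 1 - i else i)"
  have r: "r permutes {0..<n}"
  proof (rule bij_imp_permutes)
    show "bij_betw r {0..<n} {0..<n}"
      by (rule bij_betw_byWitness[where f' = r]) (auto simp: r_def)
    show "r x = x" if "x \<notin> {0..<n}" for x using that by (simp add: r_def)
  qed
  have "det_fun n (\<lambda>i k. int_coeff F (int (beta_number n \<mu> i) - int k)) =
      det_fun n (\<lambda>k i. int_coeff F (\<mu> i + int (r k) - int i))"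
  proof (subst det_fun_transpose[symmetric], rule det_fun_cong)
    fix k i assume ki: "k < n" "i < n"
    have "int (beta_number n \<mu> i) - int k = \<mu> i + int (r k) - int i"
      using partitionsD(2)[OF assms, of i] ki by (simp add: beta_number_def r_def)
    then show "int_coeff F (int (beta_number n \<mu> i) - int k) = int_coeff F (\<mu> i + int (r k) - int i)" by simp
  qed
  also have "\<dots> = signof r * det_fun n (\<lambda>k i. int_coeff F (\<mu> i + int k - int i))"
    using det_fun_permute_rows[OF r, of "\<lambda>k i. int_coeff F (\<mu> i + int k - int i)"] .
  also have "det_fun n (\<lambda>k i. int_coeff F (\<mu> i + int k - int i)) = jacobi_trudi (int_coeff F) n \<mu>"
    unfolding jacobi_trudi_def by (rule det_fun_transpose)
  finally show ?thesis by (simp add: r_def)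
qed

text \<open>
  In the expansion along the rows only injective choices of the indices \<open>b\<close> survive. Grouping them by
  the partition that they sort to reassembles, for each partition, two determinants, and the one
  in the powers of \<open>y\<close> is a bialternant.
\<close>

lemma cauchy_binet:
  fixes y :: "nat \<Rightarrow> 'a::comm_ring_1"
  shows "det_fun n (\<lambda>j i. \<Sum>b<n + K. y j ^ b * int_coeff F (int b - int i)) =
    det_fun n (\<lambda>i j. y j ^ i) * (\<Sum>\<mu>\<in>boxed_partitions n K. jacobi_trudi (int_coeff F) n \<mu> * jacobi_trudi (int_coeff (complete_gen y n)) n \<mu>)"
proof -
  define H where "H = (\<lambda>b i. int_coeff F (int b - int i))"
  define T where "T = (\<lambda>f. (\<Prod>j=0..<n. y j ^ f j) * det_fun n (\<lambda>j. H (f j)))"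
  let ?P = "{p. p permutes {0..<n}}"
  let ?I = "{f \<in> PiE {0..<n} (\<lambda>_. {..<n + K}). inj_on f {0..<n}}"
  have "det_fun n (\<lambda>j i. \<Sum>b<n + K. y j ^ b * int_coeff F (int b - int i)) =
      (\<Sum>f\<in>PiE {0..<n} (\<lambda>_. {..<n + K}). T f)"
    using det_fun_sum_rows[of "{..<n + K}" n "\<lambda>b j. y j ^ b" H] by (simp add: H_def T_def)
  also have "\<dots> = (\<Sum>f\<in>?I. T f)"
  proof (rule sum.mono_neutral_right)
    show "finite (PiE {0..<n} (\<lambda>_. {..<n + K}))" by (intro finite_PiE) auto
    show "\<forall>f\<in>PiE {0..<n} (\<lambda>_. {..<n + K}) - ?I. T f = 0"
    proof
      fix f assume "f \<in> PiE {0..<n} (\<lambda>_. {..<n + K}) - ?I"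
      then obtain i j where "i < n" "j < n" "i \<noteq> j" "f i = f j" by (auto simp: inj_on_def)
      then have "det_fun n (\<lambda>j. H (f j)) = 0" by (intro det_fun_identical_rows[of i j]) simp_all
      then show "T f = 0" by (simp add: T_def)
    qed
  qed auto
  also have "\<dots> = (\<Sum>\<mu>p\<in>boxed_partitions n K \<times> ?P. T ((\<lambda>(\<mu>, p). restrict (\<lambda>j. beta_number n \<mu> (p j)) {0..<n}) \<mu>p))"
    by (rule sum.reindex_bij_betw[OF beta_number_bij, symmetric])
  also have "\<dots> = (\<Sum>\<mu>\<in>boxed_partitions n K. \<Sum>p\<in>?P. T (restrict (\<lambda>j. beta_number n \<mu> (p j)) {0..<n}))"
    by (simp add: sum.cartesian_product case_prod_unfold)
  also have "\<dots> = (\<Sum>\<mu>\<in>boxed_partitions n K. det_fun n (\<lambda>i j. y j ^ i) * (jacobi_trudi (int_coeff F) n \<mu> * jacobi_trudi (int_coeff (complete_gen y n)) n \<mu>))"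
  proof (rule sum.cong[OF refl])
    fix \<mu> assume "\<mu> \<in> boxed_partitions n K"
    then have \<mu>: "\<mu> \<in> partitions" using boxed_partitions_subset by auto
    define s :: 'a where "s = signof (\<lambda>i. if i < n then n - 1 - i else i)"
    have ss: "s * s = 1" unfolding s_def by (rule signof_mult_self)
    have T: "T (restrict (\<lambda>j. beta_number n \<mu> (p j)) {0..<n}) =
       det_fun n (\<lambda>i. H (beta_number n \<mu> i)) * (signof p * (\<Prod>j=0..<n. y j ^ beta_number n \<mu> (p j)))"
      if "p \<in> ?P" for p
    proof -
      have "det_fun n (\<lambda>j. H (restrict (\<lambda>j. beta_number n \<mu> (p j)) {0..<n} j)) = det_fun n (\<lambda>j. H (beta_number n \<mu> (p j)))"
        by (rule det_fun_cong) simp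
      also have "\<dots> = signof p * det_fun n (\<lambda>i. H (beta_number n \<mu> i))"
        using that det_fun_permute_rows[of p n "\<lambda>i. H (beta_number n \<mu> i)"] by simp
      finally show ?thesis by (simp add: T_def mult_ac)
    qed
    have "(\<Sum>p\<in>?P. T (restrict (\<lambda>j. beta_number n \<mu> (p j)) {0..<n})) =
       (\<Sum>p\<in>?P. det_fun n (\<lambda>i. H (beta_number n \<mu> i)) * (signof p * (\<Prod>j=0..<n. y j ^ beta_number n \<mu> (p j))))"
      by (rule sum.cong[OF refl T])
    also have "\<dots> = det_fun n (\<lambda>i. H (beta_number n \<mu> i)) * det_fun n (\<lambda>j i. y j ^ beta_number n \<mu> i)"
      unfolding det_fun_expand[of n "\<lambda>j i. y j ^ beta_number n \<mu> i"] by (simp add: sum_distrib_left)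
    also have "det_fun n (\<lambda>j i. y j ^ beta_number n \<mu> i) = det_fun n (\<lambda>i j. y j ^ beta_number n \<mu> i)"
      by (rule det_fun_transpose)
    also have "\<dots> = s * jacobi_trudi (int_coeff (complete_gen y n)) n \<mu> * det_fun n (\<lambda>i j. y j ^ i)"
      by (subst bialternant[of n y "beta_number n \<mu>"]) (simp only: det_fun_beta_number[OF \<mu>] s_def)
    also have "det_fun n (\<lambda>i. H (beta_number n \<mu> i)) = s * jacobi_trudi (int_coeff F) n \<mu>"
      unfolding H_def det_fun_beta_number[OF \<mu>] s_def ..
    also have "s * jacobi_trudi (int_coeff F) n \<mu> * (s * jacobi_trudi (int_coeff (complete_gen y n)) n \<mu> * det_fun n (\<lambda>i j. y j ^ i)) =
       (s * s) * (det_fun n (\<lambda>i j. y j ^ i) * (jacobi_trudi (int_coeff F) n \<mu> * jacobi_trudi (int_coeff (complete_gen y n)) n \<mu>))"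
      by (simp only: mult_ac)
    finally show "(\<Sum>p\<in>?P. T (restrict (\<lambda>j. beta_number n \<mu> (p j)) {0..<n})) =
       det_fun n (\<lambda>i j. y j ^ i) * (jacobi_trudi (int_coeff F) n \<mu> * jacobi_trudi (int_coeff (complete_gen y n)) n \<mu>)"
      by (simp only: ss mult_1)
  qed
  finally show ?thesis by (simp only: sum_distrib_left)
qed

lemma coeff_var_mult:
  "mps_coeff (mps_var v * f) (Poly_Mapping.single v 1 + m) = mps_coeff f m"
proof -
  let ?e = "Poly_Mapping.single v (1 :: nat)"
  have "mps_coeff (mps_var v * f) (?e + m) = (\<Sum>(a, b)\<in>{(?e, m)}. mps_coeff (mps_var v) a * mps_coeff f b)"
    unfolding coeff_times
  proof (rule sum.mono_neutral_right)
    show "finite {(a, b). a + b = ?e + m}" by (rule finite_splittings)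
    show "\<forall>i\<in>{(a, b). a + b = ?e + m} - {(?e, m)}.
       (case i of (a, b) \<Rightarrow> mps_coeff (mps_var v) a * mps_coeff f b) = 0"
      by (auto simp: mps_var.rep_eq split: if_splits)
  qed simp
  then show ?thesis by (simp add: mps_var.rep_eq)
qed

lemma coeff_var_mult_eq_0:
  assumes "Poly_Mapping.lookup m v = 0"
  shows "mps_coeff (mps_var v * f) m = 0"
  unfolding coeff_times
proof (rule sum.neutral, clarify)
  fix a b assume ab: "m = a + b"
  have "a \<noteq> Poly_Mapping.single v 1" using assms by (auto simp: ab lookup_add)
  then show "mps_coeff (mps_var v) a * mps_coeff f b = 0" by (simp add: mps_var.rep_eq)
qed

text \<open>
  For monomials \<open>m\<close> of degree below \<open>d\<close>, the coefficient of \<open>(u - v) f\<close> at \<open>u m\<close> expresses the coefficient of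
  \<open>f\<close> at \<open>m\<close> by the one at \<open>u m / v\<close>, so induction on the exponent of \<open>v\<close> applies. Each
  factor costs one degree.
\<close>

lemma cancel_difference:
  assumes uv: "u \<noteq> v" and z: "agree (degree_below (Suc d)) ((mps_var u - mps_var v) * f) 0"
  shows "agree (degree_below d) f 0"
proof -
  have main: "mps_coeff f m = 0" if "mdeg m < d" "Poly_Mapping.lookup m v = k" for m k
    using that
  proof (induction k arbitrary: m)
    case 0
    let ?m = "Poly_Mapping.single u 1 + m"
    have "Poly_Mapping.lookup ?m v = 0" using uv 0 by (simp add: lookup_add lookup_single_not_eq)
    then have "mps_coeff (mps_var v * f) ?m = 0" by (rule coeff_var_mult_eq_0)
    moreover have "mps_coeff ((mps_var u - mps_var v) * f) ?m = 0"
      using z 0 by (auto simp: agree_def degree_below_def mdeg_add)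
    ultimately show ?case by (simp only: left_diff_distrib coeff_minus coeff_var_mult)
  next
    case (Suc k)
    define m' where "m' = m - Poly_Mapping.single v 1"
    have m: "m = Poly_Mapping.single v 1 + m'"
      by (rule poly_mapping_eqI) (use Suc.prems in \<open>auto simp: m'_def lookup_add lookup_minus lookup_single when_def\<close>)
    \<comment> \<open>coefficient at \<open>u m\<close>; with \<open>m = v m'\<close> the second term is the coefficient of \<open>f\<close> at \<open>u m'\<close>\<close>
    let ?m = "Poly_Mapping.single u 1 + m" and ?m' = "Poly_Mapping.single u 1 + m'"
    have "mps_coeff f ?m' = 0"
    proof (rule Suc.IH)
      show "mdeg ?m' < d" using Suc.prems(1) by (simp add: m mdeg_add)
      show "Poly_Mapping.lookup ?m' v = k"
        using Suc.prems(2) uv by (simp add: m lookup_add lookup_single_not_eq)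
    qed
    moreover have "?m = Poly_Mapping.single v 1 + ?m'" by (simp only: m ac_simps)
    ultimately have "mps_coeff (mps_var v * f) ?m = 0" by (simp only: coeff_var_mult)
    moreover have "mps_coeff ((mps_var u - mps_var v) * f) ?m = 0"
      using z Suc.prems by (auto simp: agree_def degree_below_def mdeg_add)
    ultimately show ?case by (simp only: left_diff_distrib coeff_minus coeff_var_mult)
  qed
  then show ?thesis by (auto simp: agree_def degree_below_def)
qed

lemma cancel_differences:
  assumes "finite P" "\<And>p. p \<in> P \<Longrightarrow> u p \<noteq> v p"
    and "agree (degree_below (d + card P)) ((\<Prod>p\<in>P. mps_var (u p) - mps_var (v p)) * f) 0"
  shows "agree (degree_below d) f 0"
  using assms
proof (induction P arbitrary: d rule: finite_induct)
  case (insert p P)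
  have "agree (degree_below (Suc (d + card P)))
      ((mps_var (u p) - mps_var (v p)) * ((\<Prod>p\<in>P. mps_var (u p) - mps_var (v p)) * f)) 0"
    using insert.prems(2) insert.hyps by (simp add: mult.assoc)
  then have "agree (degree_below (d + card P)) ((\<Prod>p\<in>P. mps_var (u p) - mps_var (v p)) * f) 0"
    by (rule cancel_difference[rotated]) (simp add: insert.prems(1))
  then show ?case by (rule insert.IH[rotated]) (simp add: insert.prems(1))
qed simp

lemma agree_det_fun:
  assumes "divisor_closed M" "\<And>i j. i < n \<Longrightarrow> j < n \<Longrightarrow> agree M (f i j) (g i j)"
  shows "agree M (det_fun n f) (det_fun n g)"
  unfolding det_fun_expand
proof (intro agree_sum agree_mult agree_refl agree_prod assms)
  fix p i assume "p \<in> {p. p permutes {0..<n}}" "i \<in> {0..<n}"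
  then show "i < n" "p i < n" using permutes_in_image[of p "{0..<n}" i] by auto
qed

text \<open>
  The hypothesis on \<open>d\<close> accounts for the degree of the Vandermonde determinant that is cancelled.
\<close>

lemma finite_cauchy:
  fixes F :: "'v mps fps" and c :: "nat \<Rightarrow> 'v"
  assumes c: "inj c"
    and G: "\<And>j. j < n \<Longrightarrow> agree (degree_below (Suc K)) (G j) (\<Sum>r<Suc K. fps_nth F r * mps_var (c j) ^ r)"
    and d: "d + card (pairs n) \<le> Suc K"
  shows "agree (degree_below d) (\<Prod>j<n. G j)
      (\<Sum>\<mu>\<in>boxed_partitions n K. jacobi_trudi (int_coeff F) n \<mu> * jacobi_trudi (int_coeff (complete_gen (\<lambda>j. mps_var (c j)) n)) n \<mu>)"
proof -
  define y where "y = (\<lambda>j. mps_var (c j))"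
  define S where "S = (\<Sum>\<mu>\<in>boxed_partitions n K. jacobi_trudi (int_coeff F) n \<mu> * jacobi_trudi (int_coeff (complete_gen y n)) n \<mu>)"
  have entry: "agree (degree_below (Suc K)) (G j * y j ^ i) (\<Sum>b<n + K. y j ^ b * int_coeff F (int b - int i))"
    if "j < n" "i < n" for i j
  proof -
    have pow: "agree (degree_below (Suc K)) (y j ^ r) 0" if "Suc K \<le> r" for r
      using agree_degree_below_power_zero[OF agree_degree_below_var[of "c j"], of r] that
      by (auto simp: y_def intro: agree_degree_below_mono)
    have "(\<Sum>b<n + K. y j ^ b * int_coeff F (int b - int i)) = (\<Sum>b\<in>{i..<n + K}. y j ^ b * int_coeff F (int b - int i))"
      by (rule sum.mono_neutral_right) (auto simp: int_coeff_def)
    also have "\<dots> = (\<Sum>r<n + K - i. y j ^ (r + i) * fps_nth F r)"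
      by (rule sum.reindex_bij_witness[where i = "\<lambda>r. r + i" and j = "\<lambda>b. b - i"])
         (auto simp: int_coeff_def simp flip: of_nat_diff)
    also have "\<dots> = (\<Sum>r<n + K - i. fps_nth F r * y j ^ r * y j ^ i)"
      by (simp add: power_add mult_ac)
    finally have rhs: "(\<Sum>b<n + K. y j ^ b * int_coeff F (int b - int i)) = (\<Sum>r<n + K - i. fps_nth F r * y j ^ r * y j ^ i)" .
    have "agree (degree_below (Suc K)) (G j * y j ^ i) ((\<Sum>r<Suc K. fps_nth F r * y j ^ r) * y j ^ i)"
      using G[OF \<open>j < n\<close>] by (intro agree_mult divisor_closed_degree_below agree_refl) (simp add: y_def)
    also have "(\<Sum>r<Suc K. fps_nth F r * y j ^ r) * y j ^ i
        = (\<Sum>r<n + K - i. if r < Suc K then fps_nth F r * y j ^ r * y j ^ i else 0)"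
    proof -
      have "{..<n + K - i} \<inter> {r. r < Suc K} = {..<Suc K}" using \<open>i < n\<close> by auto
      then show ?thesis by (simp add: sum.If_cases sum_distrib_right del: sum.lessThan_Suc)
    qed
    also have "agree (degree_below (Suc K)) \<dots> (\<Sum>r<n + K - i. fps_nth F r * y j ^ r * y j ^ i)"
    proof (rule agree_sum)
      fix r assume "r \<in> {..<n + K - i}"
      show "agree (degree_below (Suc K)) (if r < Suc K then fps_nth F r * y j ^ r * y j ^ i else 0) (fps_nth F r * y j ^ r * y j ^ i)"
      proof (cases "r < Suc K")
        case False
        then have "agree (degree_below (Suc K)) (y j ^ r * (fps_nth F r * y j ^ i)) 0"
          by (intro agree_mult_zero divisor_closed_degree_below pow) simp
        then show ?thesis using False by (simp add: mult_ac agree_sym)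
      qed simp
    qed
    finally show ?thesis unfolding rhs .
  qed
  have V: "det_fun n (\<lambda>j i. y j ^ i) = (\<Prod>p\<in>pairs n. mps_var (c (snd p)) - mps_var (c (fst p)))"
    unfolding det_fun_vandermonde by (simp add: pairs_def y_def case_prod_unfold)
  have "agree (degree_below (Suc K)) (det_fun n (\<lambda>j i. G j * y j ^ i))
     (det_fun n (\<lambda>j i. \<Sum>b<n + K. y j ^ b * int_coeff F (int b - int i)))"
    by (intro agree_det_fun divisor_closed_degree_below entry)
  then have "agree (degree_below (Suc K)) ((\<Prod>j<n. G j) * det_fun n (\<lambda>j i. y j ^ i)) (det_fun n (\<lambda>j i. y j ^ i) * S)"
    unfolding det_fun_scale_rows cauchy_binet S_def[symmetric] det_fun_transpose[of n "\<lambda>j i. y j ^ i"] .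
  then have "agree (degree_below (Suc K)) ((\<Prod>j<n. G j) * det_fun n (\<lambda>j i. y j ^ i) - det_fun n (\<lambda>j i. y j ^ i) * S)
      (det_fun n (\<lambda>j i. y j ^ i) * S - det_fun n (\<lambda>j i. y j ^ i) * S)"
    by (rule agree_diff) simp
  then have "agree (degree_below (Suc K)) (det_fun n (\<lambda>j i. y j ^ i) * ((\<Prod>j<n. G j) - S)) 0"
    by (simp only: right_diff_distrib mult.commute[of "prod G {..<n}"] diff_self)
  then have "agree (degree_below (d + card (pairs n)))
      ((\<Prod>p\<in>pairs n. mps_var (c (snd p)) - mps_var (c (fst p))) * ((\<Prod>j<n. G j) - S)) 0"
    unfolding V using d by (rule agree_degree_below_mono)
  then have "agree (degree_below d) ((\<Prod>j<n. G j) - S) 0"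
  proof (rule cancel_differences[rotated 2])
    show "c (snd p) \<noteq> c (fst p)" if "p \<in> pairs n" for p
      using that c by (auto simp: pairs_def inj_eq)
  qed simp
  then show ?thesis
    by (simp add: agree_def S_def y_def)
qed

text \<open>
  Substituting a series without constant term for \<open>t\<close> is multiplicative; with all sums truncated at
  \<open>d\<close> this remains true below degree \<open>d\<close>.
\<close>

lemma eval_mult:
  assumes y: "agree (degree_below 1) y (0 :: 'v mps)"
  shows "agree (degree_below d) (\<Sum>r<d. fps_nth (F * G) r * y ^ r)
    ((\<Sum>r<d. fps_nth F r * y ^ r) * (\<Sum>r<d. fps_nth G r * y ^ r))"
proof -
  let ?t = "\<lambda>(a, b). fps_nth F a * fps_nth G b * y ^ (a + b)"
  have "(\<Sum>r<d. fps_nth (F * G) r * y ^ r) = (\<Sum>(r, a)\<in>Sigma {..<d} (\<lambda>r. {0..r}). ?t (a, r - a))"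
    by (subst sum.Sigma[symmetric]) (auto simp: fps_mult_nth sum_distrib_right intro!: sum.cong)
  also have "\<dots> = (\<Sum>ab\<in>{(a, b). a + b < d}. ?t ab)"
    by (rule sum.reindex_bij_witness[where i = "\<lambda>(a, b). (a + b, a)" and j = "\<lambda>(r, a). (a, r - a)"]) auto
  also have "\<dots> = (\<Sum>ab\<in>{..<d} \<times> {..<d}. if fst ab + snd ab < d then ?t ab else 0)"
    by (rule sum.mono_neutral_cong_left) auto
  also have "agree (degree_below d) \<dots> (\<Sum>ab\<in>{..<d} \<times> {..<d}. ?t ab)"
  proof (rule agree_sum)
    fix ab assume "ab \<in> {..<d} \<times> {..<d}"
    obtain a b where ab: "ab = (a, b)" by (cases ab)
    show "agree (degree_below d) (if fst ab + snd ab < d then ?t ab else 0) (?t ab)"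
    proof (cases "a + b < d")
      case False
      have "agree (degree_below (a + b)) (y ^ (a + b)) 0" using agree_degree_below_power_zero[OF y, of "a + b"] by simp
      then have "agree (degree_below d) (y ^ (a + b)) 0" using False by (auto intro: agree_degree_below_mono)
      then have "agree (degree_below d) (y ^ (a + b) * (fps_nth F a * fps_nth G b)) 0"
        by (intro agree_mult_zero divisor_closed_degree_below)
      then show ?thesis using False by (simp add: ab mult_ac agree_sym)
    qed (simp add: ab)
  qed
  also have "(\<Sum>ab\<in>{..<d} \<times> {..<d}. ?t ab) = (\<Sum>r<d. fps_nth F r * y ^ r) * (\<Sum>r<d. fps_nth G r * y ^ r)"
    by (simp add: sum_product sum.cartesian_product power_add mult_ac case_prod_unfold)
  finally show ?thesis .
qed

lemma eval_prod:
  assumes y: "agree (degree_below 1) y (0 :: 'v mps)"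
  shows "agree (degree_below d) (\<Sum>r<d. fps_nth (\<Prod>i\<in>A. F i) r * y ^ r) (\<Prod>i\<in>A. \<Sum>r<d. fps_nth (F i) r * y ^ r)"
proof -
  have one: "agree (degree_below d) (\<Sum>r<d. fps_nth 1 r * y ^ r) 1"
  proof (cases d)
    case (Suc d')
    have "(\<Sum>r<d. fps_nth 1 r * y ^ r) = (\<Sum>r\<in>{0}. fps_nth 1 r * y ^ r)"
      by (rule sum.mono_neutral_right) (auto simp: Suc)
    then show ?thesis by simp
  qed simp
  show ?thesis
  proof (induction A rule: infinite_finite_induct)
    case (insert i A)
    have "agree (degree_below d) (\<Sum>r<d. fps_nth (F i * (\<Prod>i\<in>A. F i)) r * y ^ r)
       ((\<Sum>r<d. fps_nth (F i) r * y ^ r) * (\<Sum>r<d. fps_nth (\<Prod>i\<in>A. F i) r * y ^ r))"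
      by (rule eval_mult[OF y])
    also have "agree (degree_below d) \<dots> ((\<Sum>r<d. fps_nth (F i) r * y ^ r) * (\<Prod>i\<in>A. \<Sum>r<d. fps_nth (F i) r * y ^ r))"
      by (intro agree_mult divisor_closed_degree_below agree_refl insert.IH)
    finally show ?case using insert.hyps by simp
  qed (use one in simp_all)
qed

lemma sgn_prod_int: "sgn (\<Prod>i\<in>A. f i) = (\<Prod>i\<in>A. sgn (f i :: int))"
  by (induction A rule: infinite_finite_induct) (simp_all add: sgn_mult)

section \<open>Duality of Jacobi-Trudi determinants\<close>

text \<open>
  Permuting the nodes \<open>0, \<dots>, n - 1\<close> multiplies their Vandermonde determinant by the sign of the
  permutation, and in the product formula it flips one factor for each inversion.
\<close>

lemma sign_inversions:
  assumes p: "p permutes {0..<n}"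
  shows "sign p = (-1) ^ card {(i, j) \<in> pairs n. p j < p i}"
proof -
  let ?D = "\<lambda>q. \<Prod>ij\<in>pairs n. int (q (snd ij)) - int (q (fst ij))"
  have "det_fun n (\<lambda>i j. int (p i) ^ j) = signof p * det_fun n (\<lambda>i j. int i ^ j)"
    using det_fun_permute_rows[OF p, of "\<lambda>i j. int i ^ j"] .
  then have eq: "?D p = sign p * ?D (\<lambda>i. i)"
    unfolding det_fun_vandermonde by (simp add: pairs_def case_prod_unfold)
  have pos: "0 < ?D (\<lambda>i. i)" by (rule prod_pos) (auto simp: pairs_def)
  have "sgn (?D p) = sgn (sign p) * sgn (?D (\<lambda>i. i))" by (simp only: eq sgn_mult)
  also have "\<dots> = sign p" using pos by (simp add: sign_def)
  finally have "sign p = (\<Prod>ij\<in>pairs n. sgn (int (p (snd ij)) - int (p (fst ij))))"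
    by (simp only: sgn_prod_int)
  also have "\<dots> = (\<Prod>ij\<in>pairs n. if p (snd ij) < p (fst ij) then - 1 else 1)"
  proof (rule prod.cong[OF refl])
    fix ij assume "ij \<in> pairs n"
    then have "p (fst ij) \<noteq> p (snd ij)" using permutes_inj[OF p] by (auto simp: pairs_def inj_eq)
    then show "sgn (int (p (snd ij)) - int (p (fst ij))) = (if p (snd ij) < p (fst ij) then - 1 else 1)"
      by (auto simp: sgn_if)
  qed
  also have "\<dots> = (-1) ^ card {ij \<in> pairs n. p (snd ij) < p (fst ij)}"
    by (simp add: prod.If_cases Int_def)
  finally show ?thesis by (simp add: case_prod_unfold)
qed

text \<open>
  As \<open>\<mu>\<close> is decreasing, the rows of its diagram that reach column \<open>j\<close> are an initial segment, and
  \<open>conjugate \<mu> j\<close> is the number of these rows.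
\<close>

lemma conjugate_transpose:
  assumes \<mu>: "\<mu> \<in> partitions"
  shows "int r < conjugate \<mu> j \<longleftrightarrow> int j < \<mu> r"
proof -
  let ?D = "{r. \<mu> r \<ge> int (j + 1)}"
  have "finite ?D" by (rule finite_subset[OF _ partitionsD(3)[OF \<mu>]]) auto
  then have "?D = {..<card ?D}"
    by (rule finite_initial_segment) (use partitionsD(1)[OF \<mu>] in \<open>auto intro: order.trans\<close>)
  then have "r \<in> ?D \<longleftrightarrow> r < card ?D" by blast
  then show ?thesis by (simp add: conjugate_def) linarith
qed

lemma conjugate_boxed:
  assumes \<mu>: "\<mu> \<in> boxed_partitions n m"
  shows "conjugate \<mu> \<in> boxed_partitions m n"
proof -
  have par: "\<mu> \<in> partitions" using \<mu> boxed_partitions_subset by auto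
  note tr = conjugate_transpose[OF par]
  have nonneg: "0 \<le> conjugate \<mu> j" for j by (simp add: conjugate_def)
  have anti: "conjugate \<mu> j \<le> conjugate \<mu> i" if "i \<le> j" for i j
  proof (rule ccontr)
    assume "\<not> conjugate \<mu> j \<le> conjugate \<mu> i"
    then have "int (nat (conjugate \<mu> i)) < conjugate \<mu> j" using nonneg[of i] by simp
    then have "int (nat (conjugate \<mu> i)) < conjugate \<mu> i" using that unfolding tr by simp
    then show False using nonneg[of i] by simp
  qed
  have zero: "conjugate \<mu> j = 0" if "m \<le> j" for j
  proof (rule ccontr)
    assume "conjugate \<mu> j \<noteq> 0"
    then have "int 0 < conjugate \<mu> j" using nonneg[of j] by simp
    then have "int j < \<mu> 0" by (simp only: tr)
    moreover have "\<mu> 0 \<le> int m" using \<mu> by (simp add: boxed_partitions_def)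
    ultimately show False using that by simp
  qed
  have le: "conjugate \<mu> j \<le> int n" for j
  proof (rule ccontr)
    assume "\<not> conjugate \<mu> j \<le> int n"
    then have "int n < conjugate \<mu> j" by simp
    then have "int j < \<mu> n" by (simp only: tr)
    moreover have "\<mu> n = 0" using \<mu> by (simp add: boxed_partitions_def)
    ultimately show False by simp
  qed
  have "{j. conjugate \<mu> j \<noteq> 0} \<subseteq> {..<m}" using zero by (auto simp: not_less[symmetric] intro: leI)
  then have "finite {j. conjugate \<mu> j \<noteq> 0}" by (rule finite_subset) simp
  then show ?thesis using nonneg anti zero le by (simp add: boxed_partitions_def partitions_def antimono_def)
qed

text \<open>
  Toeplitz matrices of mutually inverse power series are inverse to each other.
\<close>

lemma int_coeff_convolution:
  assumes "H * E = (1 :: 'a::comm_ring_1 fps)" "u < N" "v < N"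
  shows "(\<Sum>k<N. int_coeff H (int u - int k) * int_coeff E (int k - int v)) = of_bool (u = v)"
proof (cases "v \<le> u")
  case True
  have "(\<Sum>k<N. int_coeff H (int u - int k) * int_coeff E (int k - int v)) =
      (\<Sum>k=v..u. int_coeff H (int u - int k) * int_coeff E (int k - int v))"
    by (rule sum.mono_neutral_right) (use assms in \<open>auto simp: int_coeff_def\<close>)
  also have "\<dots> = (\<Sum>s=0..u - v. fps_nth H s * fps_nth E (u - v - s))"
    by (rule sum.reindex_bij_witness[where i = "\<lambda>s. u - s" and j = "\<lambda>k. u - k"])
       (use True in \<open>auto simp: int_coeff_def simp flip: of_nat_diff\<close>)
  also have "\<dots> = fps_nth (H * E) (u - v)" by (simp add: fps_mult_nth)
  finally show ?thesis using True assms(1) by (auto simp: fps_one_nth)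
next
  case False
  then have "(\<Sum>k<N. int_coeff H (int u - int k) * int_coeff E (int k - int v)) = 0"
    by (intro sum.neutral) (auto simp: int_coeff_def)
  then show ?thesis using False by auto
qed

text \<open>
  Jacobi's theorem on complementary minors. Let \<open>A\<close> be the Toeplitz matrix of \<open>H\<close> of size \<open>n + m\<close> with
  rows permuted by \<open>\<pi>\<close>, so that its upper left block of size \<open>n\<close>, read backwards, gives the left
  hand side, and let \<open>B\<close> be its inverse, a permuted Toeplitz matrix of \<open>1 / H\<close>. Let \<open>X\<close> have the first \<open>n\<close> columns of the identity
  matrix and the last \<open>m\<close> columns of \<open>B\<close>. Then \<open>A X\<close> has the first \<open>n\<close> columns of \<open>A\<close> and the last
  \<open>m\<close> of the identity matrix, so the upper left block of \<open>A\<close> has determinant \<open>det A\<close> times that of the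
  lower right block of \<open>B\<close>. The sign of \<open>\<pi>\<close>, whose inversions are the boxes of \<open>\<mu>\<close>,
  cancels the alternating signs in \<open>1 / H\<close>.
\<close>

lemma jacobi_trudi_conjugate:
  fixes H E :: "'a::comm_ring_1 fps"
  assumes HE: "H * Abs_fps (\<lambda>k. (-1) ^ k * fps_nth E k) = 1" and H0: "fps_nth H 0 = 1"
    and \<mu>: "\<mu> \<in> boxed_partitions n m"
  shows "jacobi_trudi (int_coeff H) n \<mu> = jacobi_trudi (int_coeff E) m (conjugate \<mu>)"
proof -
  define E' where "E' = Abs_fps (\<lambda>k. (-1) ^ k * fps_nth E k)"
  define L where "L = (\<lambda>r. nat (\<mu> r))"
  define L' where "L' = (\<lambda>j. nat (conjugate \<mu> j))"
  have par: "\<mu> \<in> partitions" "conjugate \<mu> \<in> partitions"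
    using \<mu> conjugate_boxed[OF \<mu>] boxed_partitions_subset by auto
  have \<mu>L: "\<mu> r = int (L r)" and cL: "conjugate \<mu> r = int (L' r)" for r
    using partitionsD(2)[OF par(1), of r] partitionsD(2)[OF par(2), of r] by (simp_all add: L_def L'_def)
  have tr: "r < L' j \<longleftrightarrow> j < L r" for r j
    using conjugate_transpose[OF par(1), of r j] by (simp add: \<mu>L cL)
  have Lmono: "L j \<le> L i" "L' j \<le> L' i" if "i \<le> j" for i j
    using partitionsD(1)[OF par(1) that] partitionsD(1)[OF par(2) that] by (simp_all add: \<mu>L cL)
  have Lm: "L r \<le> m" and L'n: "L' r \<le> n" for r
    using \<mu> conjugate_boxed[OF \<mu>] by (simp_all add: boxed_partitions_def \<mu>L cL)
  \<comment> \<open>the first \<open>n\<close> values are the increasing beta numbers of \<open>\<mu>\<close>, the others their complement\<close>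
  define \<pi> where "\<pi> = (\<lambda>i. if i < n then L (n - 1 - i) + i else if i < n + m then i - L' (i - n) else i)"
  have row: "\<pi> i = L (n - 1 - i) + i" if "i < n" for i using that by (simp add: \<pi>_def)
  have col: "\<pi> (n + j) = n + j - L' j" if "j < m" for j using that by (simp add: \<pi>_def)
  have inc1: "\<pi> i < \<pi> i'" if "i < i'" "i' < n" for i i'
  proof -
    have "L (n - 1 - i) \<le> L (n - 1 - i')" by (rule Lmono(1)) (use that in linarith)
    then show ?thesis using that by (simp add: row)
  qed
  have inc2: "\<pi> (n + j) < \<pi> (n + j')" if "j < j'" "j' < m" for j j'
    using Lmono(2)[of j j'] L'n[of j] that by (simp add: col)
  \<comment> \<open>the two values differ by \<open>L r + L' j - (r + j + 1)\<close> with \<open>r = n - 1 - i\<close>, which is never 0\<close>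
  have cross: "if j < L (n - 1 - i) then \<pi> (n + j) < \<pi> i else \<pi> i < \<pi> (n + j)" if "i < n" "j < m" for i j
    using tr[of "n - 1 - i" j] L'n[of j] that by (auto simp: row col)
  have cases: "(\<exists>j<m. i = n + j) \<or> i < n" if "i < n + m" for i
    using that by (auto intro!: exI[of _ "i - n"])
  have inversions: "{(i, j) \<in> pairs (n + m). \<pi> j < \<pi> i} = (\<lambda>(j, r). (n - 1 - r, n + j)) ` Sigma {..<m} (\<lambda>j. {..<L' j})"
  proof (intro equalityI subsetI)
    fix x assume "x \<in> {(i, j) \<in> pairs (n + m). \<pi> j < \<pi> i}"
    then obtain i k where x: "x = (i, k)" "i < k" "k < n + m" "\<pi> k < \<pi> i" by (auto simp: pairs_def)
    have "\<not> k < n" using inc1[of i k] x by auto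
    then obtain j where j: "j < m" "k = n + j" using cases[of k] x by auto
    have "i < n"
    proof (rule ccontr)
      assume "\<not> i < n"
      then obtain j' where "i = n + j'" using cases[of i] x by auto
      then show False using inc2[of j' j] x j by simp
    qed
    then have "j < L (n - 1 - i)" using cross[of i j] x j by (auto split: if_splits)
    then have "n - 1 - i < L' j" by (simp add: tr)
    then show "x \<in> (\<lambda>(j, r). (n - 1 - r, n + j)) ` Sigma {..<m} (\<lambda>j. {..<L' j})"
      using j x \<open>i < n\<close> by (intro image_eqI[of _ _ "(j, n - 1 - i)"]) auto
  next
    fix x assume "x \<in> (\<lambda>(j, r). (n - 1 - r, n + j)) ` Sigma {..<m} (\<lambda>j. {..<L' j})"
    then obtain j r where x: "x = (n - 1 - r, n + j)" "j < m" "r < L' j" by auto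
    then have "r < n" using L'n[of j] by simp
    moreover have "j < L r" using x by (simp add: tr)
    ultimately show "x \<in> {(i, j) \<in> pairs (n + m). \<pi> j < \<pi> i}"
      using cross[of "n - 1 - r" j] x by (auto simp: pairs_def)
  qed
  have "inj_on (\<lambda>(j, r). (n - 1 - r, n + j)) (Sigma {..<m} (\<lambda>j. {..<L' j}))"
  proof (rule inj_onI)
    fix x x'
    assume "x \<in> Sigma {..<m} (\<lambda>j. {..<L' j})" "x' \<in> Sigma {..<m} (\<lambda>j. {..<L' j})"
      and eq: "(\<lambda>(j, r). (n - 1 - r, n + j)) x = (\<lambda>(j, r). (n - 1 - r, n + j)) x'"
    then have "snd x < n" "snd x' < n" using L'n[of "fst x"] L'n[of "fst x'"] by auto
    then show "x = x'" using eq by (cases x; cases x') auto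
  qed
  then have card_inv: "card {(i, j) \<in> pairs (n + m). \<pi> j < \<pi> i} = (\<Sum>j<m. L' j)"
    unfolding inversions by (simp add: card_image)
  have inj: "inj_on \<pi> {0..<n + m}"
  proof (rule linorder_inj_onI')
    fix i k assume ik: "i \<in> {0..<n + m}" "k \<in> {0..<n + m}" "i < k"
    show "\<pi> i \<noteq> \<pi> k"
    proof (cases "k < n")
      case True
      then show ?thesis using inc1[of i k] ik by simp
    next
      case False
      then obtain j where j: "j < m" "k = n + j" using cases[of k] ik by auto
      show ?thesis
      proof (cases "i < n")
        case True
        then show ?thesis using cross[of i j] j by (auto split: if_splits)
      next
        case False
        then obtain j' where "i = n + j'" using cases[of i] ik by auto
        then show ?thesis using inc2[of j' j] ik j by simp
      qed
    qed
  qed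
  have bound: "\<pi> i < n + m" if "i < n + m" for i
    using that Lm[of "n - 1 - i"] by (auto simp: \<pi>_def)
  have \<pi>: "\<pi> permutes {0..<n + m}"
  proof (rule bij_imp_permutes)
    have "\<pi> ` {0..<n + m} \<subseteq> {0..<n + m}" using bound by auto
    then show "bij_betw \<pi> {0..<n + m} {0..<n + m}"
      using inj endo_inj_surj[of "{0..<n + m}" \<pi>] by (simp add: bij_betw_def)
    show "\<pi> x = x" if "x \<notin> {0..<n + m}" for x using that by (simp add: \<pi>_def)
  qed
  have sgn: "sign \<pi> = (-1) ^ (\<Sum>j<m. L' j)"
    using sign_inversions[OF \<pi>] card_inv by simp
  define A where "A = (\<lambda>i k. int_coeff H (int (\<pi> i) - int k))"
  define B where "B = (\<lambda>k j. int_coeff E' (int k - int (\<pi> j)))"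
  define X where "X = (\<lambda>k j. if j < n then of_bool (k = j) else B k j)"
  have AB: "(\<Sum>k<n + m. A i k * B k j) = of_bool (i = j)" if "i < n + m" "j < n + m" for i j
  proof -
    have "(\<Sum>k<n + m. A i k * B k j) = of_bool (\<pi> i = \<pi> j)"
      unfolding A_def B_def by (rule int_coeff_convolution) (use HE bound that in \<open>auto simp: E'_def\<close>)
    also have "\<pi> i = \<pi> j \<longleftrightarrow> i = j" using permutes_inj[OF \<pi>] by (simp add: inj_eq)
    finally show ?thesis .
  qed
  have "det_fun (n + m) A = signof \<pi> * det_fun (n + m) (\<lambda>i k. int_coeff H (int i - int k))"
    unfolding A_def using det_fun_permute_rows[OF \<pi>, of "\<lambda>i k. int_coeff H (int i - int k)"] .
  also have "det_fun (n + m) (\<lambda>i k. int_coeff H (int i - int k)) = (\<Prod>i<n + m. int_coeff H (int i - int i))"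
    by (rule det_fun_triangular) (simp add: int_coeff_def)
  also have "\<dots> = 1" by (simp add: int_coeff_def H0)
  finally have detA: "det_fun (n + m) A = (-1) ^ (\<Sum>j<m. L' j)" by (simp add: sgn)
  have "det_fun (n + m) A * det_fun (n + m) X = det_fun (n + m) (\<lambda>i j. \<Sum>k<n + m. A i k * X k j)"
    by (rule det_fun_mult[symmetric])
  also have "\<dots> = det_fun (n + m) (\<lambda>i j. if j < n then A i j else of_bool (i = j))"
  proof (rule det_fun_cong)
    fix i j assume ij: "i < n + m" "j < n + m"
    show "(\<Sum>k<n + m. A i k * X k j) = (if j < n then A i j else of_bool (i = j))"
    proof (cases "j < n")
      case True
      have "(\<Sum>k<n + m. A i k * X k j) = (\<Sum>k\<in>{j}. A i k * X k j)"
        by (rule sum.mono_neutral_right) (use True in \<open>auto simp: X_def\<close>)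
      then show ?thesis using True by (simp add: X_def)
    next
      case False
      then show ?thesis using AB[OF ij] by (simp add: X_def)
    qed
  qed
  also have "\<dots> = det_fun n (\<lambda>i j. if j < n then A i j else of_bool (i = j))"
    by (rule det_fun_block_left) auto
  also have "\<dots> = det_fun n (\<lambda>i k. A (n - 1 - i) (n - 1 - k))"
    by (subst det_fun_reverse[symmetric]) (rule det_fun_cong, auto)
  also have "\<dots> = jacobi_trudi (int_coeff H) n \<mu>"
    unfolding jacobi_trudi_def
  proof (rule det_fun_cong)
    fix i k assume "i < n" "k < n"
    then have "int (\<pi> (n - 1 - i)) - int (n - 1 - k) = \<mu> i + int k - int i" by (simp add: row \<mu>L)
    then show "A (n - 1 - i) (n - 1 - k) = int_coeff H (\<mu> i + int k - int i)" by (simp only: A_def)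
  qed
  finally have 1: "det_fun (n + m) A * det_fun (n + m) X = jacobi_trudi (int_coeff H) n \<mu>" .
  have "det_fun (n + m) X = det_fun m (\<lambda>i j. X (n + i) (n + j))"
    by (rule det_fun_block_right) (simp add: X_def)
  also have "\<dots> = det_fun m (\<lambda>i j. (-1) ^ i * ((-1) ^ (L' j + j) * int_coeff E (conjugate \<mu> j + int i - int j)))"
  proof (rule det_fun_cong)
    fix i j assume ij: "i < m" "j < m"
    have arg: "int (n + i) - int (\<pi> (n + j)) = int (L' j) + int i - int j"
      using ij L'n[of j] by (simp add: col of_nat_diff)
    have "int_coeff E' (int (L' j) + int i - int j) = (-1) ^ i * ((-1) ^ (L' j + j) * int_coeff E (int (L' j) + int i - int j))"
    proof (cases "j \<le> L' j + i")
      case True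
      define s where "s = L' j + i - j"
      have s: "int (L' j) + int i - int j = int s" "i + (L' j + j) = s + 2 * j" using True by (simp_all add: s_def)
      have "(-1) ^ i * (-1) ^ (L' j + j) = ((-1) ^ s :: 'a)"
        unfolding power_add[symmetric] s by (simp add: power_add power_mult)
      then show ?thesis unfolding s by (simp add: int_coeff_def E'_def flip: mult.assoc)
    qed (simp add: int_coeff_def)
    then show "X (n + i) (n + j) = (-1) ^ i * ((-1) ^ (L' j + j) * int_coeff E (conjugate \<mu> j + int i - int j))"
      by (simp only: X_def B_def arg cL) simp
  qed
  also have "\<dots> = (\<Prod>i<m. (-1) ^ i) * ((\<Prod>j<m. (-1) ^ (L' j + j)) * det_fun m (\<lambda>i j. int_coeff E (conjugate \<mu> j + int i - int j)))"
    by (simp only: det_fun_scale_rows det_fun_scale_cols)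
  also have "det_fun m (\<lambda>i j. int_coeff E (conjugate \<mu> j + int i - int j)) = jacobi_trudi (int_coeff E) m (conjugate \<mu>)"
    unfolding jacobi_trudi_def by (rule det_fun_transpose)
  also have "(\<Prod>i<m. (-1) ^ i) * ((\<Prod>j<m. (-1) ^ (L' j + j)) * jacobi_trudi (int_coeff E) m (conjugate \<mu>))
      = (-1) ^ (\<Sum>j<m. L' j) * jacobi_trudi (int_coeff E) m (conjugate \<mu>)"
  proof -
    have cancel: "(-1) ^ i * (-1) ^ (l + i) = (-1 :: 'a) ^ l" for i l :: nat
    proof -
      have "i + (l + i) = l + 2 * i" by simp
      then show ?thesis by (simp only: power_add[symmetric]) (simp add: power_add power_mult)
    qed
    have "(\<Prod>i<m. (-1) ^ i) * (\<Prod>j<m. (-1 :: 'a) ^ (L' j + j)) = (\<Prod>j<m. (-1) ^ L' j)"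
      by (simp only: prod.distrib[symmetric] cancel)
    also have "\<dots> = (-1) ^ (\<Sum>j<m. L' j)"
      by (simp add: power_sum)
    finally show ?thesis by (simp flip: mult.assoc)
  qed
  finally have 2: "det_fun (n + m) X = (-1) ^ (\<Sum>j<m. L' j) * jacobi_trudi (int_coeff E) m (conjugate \<mu>)" .
  have "(-1) ^ (\<Sum>j<m. L' j) * (-1) ^ (\<Sum>j<m. L' j) = (1 :: 'a)"
    by (simp flip: power_mult_distrib)
  with 1 show ?thesis
    unfolding detA 2 by (simp flip: mult.assoc)
qed

section \<open>Truncating the symmetric functions\<close>

lemma Lim_agree:
  fixes g :: "'i set \<Rightarrow> 'v mps"
  assumes "\<And>m. \<exists>M I. m \<in> M \<and> finite I \<and> I \<subseteq> A \<and>
     (\<forall>J. finite J \<longrightarrow> I \<subseteq> J \<longrightarrow> J \<subseteq> A \<longrightarrow> agree M (g J) (g I))"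
  shows "(g \<longlongrightarrow> Lim (finite_subsets_at_top A) g) (finite_subsets_at_top A)"
    and "finite I \<Longrightarrow> I \<subseteq> A \<Longrightarrow> (\<And>J. finite J \<Longrightarrow> I \<subseteq> J \<Longrightarrow> J \<subseteq> A \<Longrightarrow> agree M (g J) h)
      \<Longrightarrow> agree M (Lim (finite_subsets_at_top A) g) h"
proof -
  let ?F = "finite_subsets_at_top A"
  have "\<exists>L. (g \<longlongrightarrow> L) ?F"
  proof (rule tendsto_mps_exists)
    fix m
    obtain M I where I: "m \<in> M \<and> finite I \<and> I \<subseteq> A \<and>
        (\<forall>J. finite J \<longrightarrow> I \<subseteq> J \<longrightarrow> J \<subseteq> A \<longrightarrow> agree M (g J) (g I))"
      using assms[of m] by metis
    have "eventually (\<lambda>J. mps_coeff (g J) m = mps_coeff (g I) m) ?F"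
      unfolding eventually_finite_subsets_at_top
    proof (intro exI[of _ I] conjI allI impI)
      fix J assume J: "finite J \<and> I \<subseteq> J \<and> J \<subseteq> A"
      then have "agree M (g J) (g I)" using I by blast
      moreover have "m \<in> M" using I by blast
      ultimately show "mps_coeff (g J) m = mps_coeff (g I) m" by (rule agreeD)
    qed (use I in blast)+
    then show "\<exists>c. eventually (\<lambda>J. mps_coeff (g J) m = c) ?F" ..
  qed
  then obtain L where L: "(g \<longlongrightarrow> L) ?F" by blast
  then have "Lim ?F g = L" by (intro tendsto_Lim) simp_all
  with L show lim: "(g \<longlongrightarrow> Lim ?F g) ?F" by simp
  show "agree M (Lim ?F g) h" if "finite I" "I \<subseteq> A"
    "\<And>J. finite J \<Longrightarrow> I \<subseteq> J \<Longrightarrow> J \<subseteq> A \<Longrightarrow> agree M (g J) h"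
  proof (rule eventually_agree_tendsto[OF lim])
    show "eventually (\<lambda>J. agree M (g J) h) ?F"
      unfolding eventually_finite_subsets_at_top using that by blast
  qed simp
qed

definition first_vars :: "nat \<Rightarrow> (nat + nat) set" where
  "first_vars n = Inl ` {..<n} \<union> Inr ` {..<n}"

lemma ex_first_vars: "\<exists>n\<ge>k. m \<in> monomials_in (first_vars n)"
proof -
  have "finite (Poly_Mapping.keys m)" by simp
  then obtain n where "Poly_Mapping.keys m \<subseteq> first_vars n"
  proof (induction arbitrary: thesis rule: finite_induct)
    case (insert v A)
    obtain n where n: "A \<subseteq> first_vars n" using insert.IH by blast
    obtain k where k: "v \<in> first_vars k" by (cases v) (auto simp: first_vars_def)
    have "insert v A \<subseteq> first_vars (max n k)" using n k by (auto simp: first_vars_def)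
    then show ?case by (rule insert.prems)
  qed auto
  moreover have "first_vars n \<subseteq> first_vars (max n k)" by (auto simp: first_vars_def)
  ultimately show ?thesis unfolding monomials_in_def by (intro exI[of _ "max n k"]) auto
qed

definition agree_fps :: "('v \<Rightarrow>\<^sub>0 nat) set \<Rightarrow> 'v mps fps \<Rightarrow> 'v mps fps \<Rightarrow> bool" where
  "agree_fps M F G \<longleftrightarrow> (\<forall>r. agree M (fps_nth F r) (fps_nth G r))"

lemma agree_fps_prod:
  assumes "divisor_closed M" "\<And>i. i \<in> A \<Longrightarrow> agree_fps M (F i) (G i)"
  shows "agree_fps M (\<Prod>i\<in>A. F i) (\<Prod>i\<in>A. G i)"
  using assms(2)
proof (induction A rule: infinite_finite_induct)
  case (insert a A)
  have "agree_fps M (F a) (G a)" "agree_fps M (prod F A) (prod G A)" using insert by auto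
  then have "agree_fps M (F a * prod F A) (G a * prod G A)"
    unfolding agree_fps_def fps_mult_nth by (intro allI agree_sum agree_mult assms(1)) auto
  then show ?case using insert.hyps by simp
qed (simp_all add: agree_fps_def)

lemma fps_infprod_agree:
  fixes f :: "nat \<Rightarrow> (nat + nat) mps fps"
  assumes f: "\<And>n i. n \<le> i \<Longrightarrow> agree_fps (monomials_in (first_vars n)) (f i) 1"
  shows "agree (monomials_in (first_vars n)) (fps_nth (fps_infprod f UNIV) r) (fps_nth (\<Prod>i<n. f i) r)"
proof -
  have const: "agree (monomials_in (first_vars n)) (fps_nth (\<Prod>i\<in>J. f i) r) (fps_nth (\<Prod>i<n. f i) r)"
    if "finite J" "{..<n} \<subseteq> J" for n J
  proof -
    have "agree_fps (monomials_in (first_vars n)) (\<Prod>i\<in>J. f i) (\<Prod>i\<in>J. if i < n then f i else 1)"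
      by (intro agree_fps_prod divisor_closed_monomials_in) (use f in \<open>auto simp: agree_fps_def\<close>)
    also have "(\<Prod>i\<in>J. if i < n then f i else 1) = (\<Prod>i<n. f i)"
      by (rule prod.mono_neutral_cong_right) (use that in auto)
    finally show ?thesis by (simp add: agree_fps_def)
  qed
  have "agree (monomials_in (first_vars n)) (Lim (finite_subsets_at_top UNIV) (\<lambda>I. fps_nth (\<Prod>i\<in>I. f i) r))
      (fps_nth (\<Prod>i<n. f i) r)"
  proof (rule Lim_agree(2)[where I = "{..<n}"])
    fix m :: "(nat + nat) \<Rightarrow>\<^sub>0 nat"
    obtain k where "m \<in> monomials_in (first_vars k)" using ex_first_vars[of 0 m] by blast
    then show "\<exists>M I. m \<in> M \<and> finite I \<and> I \<subseteq> UNIV \<and> (\<forall>J. finite J \<longrightarrow> I \<subseteq> J \<longrightarrow> J \<subseteq> UNIV \<longrightarrow>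
        agree M (fps_nth (\<Prod>i\<in>J. f i) r) (fps_nth (\<Prod>i\<in>I. f i) r))"
      using const by (intro exI[of _ "monomials_in (first_vars k)"] exI[of _ "{..<k}"]) auto
  qed (use const in auto)
  then show ?thesis by (simp add: fps_infprod_def)
qed

lemma infprod_agree:
  fixes f :: "nat \<times> nat \<Rightarrow> (nat + nat) mps"
  assumes f: "\<And>n i j. n \<le> i \<or> n \<le> j \<Longrightarrow> agree (monomials_in (first_vars n)) (f (i, j)) 1"
  shows "f multipliable_on UNIV"
    and "agree (monomials_in (first_vars n)) (infprod f UNIV) (\<Prod>ij\<in>{..<n} \<times> {..<n}. f ij)"
proof -
  have const: "agree (monomials_in (first_vars n)) (prod f J) (prod f ({..<n} \<times> {..<n}))"
    if "finite J" "{..<n} \<times> {..<n} \<subseteq> J" for n J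
  proof -
    have "agree (monomials_in (first_vars n)) (\<Prod>ij\<in>J. f ij) (\<Prod>ij\<in>J. if ij \<in> {..<n} \<times> {..<n} then f ij else 1)"
    proof (intro agree_prod divisor_closed_monomials_in)
      fix ij show "agree (monomials_in (first_vars n)) (f ij) (if ij \<in> {..<n} \<times> {..<n} then f ij else 1)"
        using f[of n "fst ij" "snd ij"] by (cases ij) auto
    qed
    also have "(\<Prod>ij\<in>J. if ij \<in> {..<n} \<times> {..<n} then f ij else 1) = (\<Prod>ij\<in>{..<n} \<times> {..<n}. f ij)"
      by (rule prod.mono_neutral_cong_right) (use that in auto)
    finally show ?thesis .
  qed
  have ev: "\<exists>M I. m \<in> M \<and> finite I \<and> I \<subseteq> UNIV \<and> (\<forall>J. finite J \<longrightarrow> I \<subseteq> J \<longrightarrow> J \<subseteq> UNIV \<longrightarrow>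
        agree M (prod f J) (prod f I))" for m
  proof -
    obtain k where "m \<in> monomials_in (first_vars k)" using ex_first_vars[of 0 m] by blast
    then show ?thesis
      using const by (intro exI[of _ "monomials_in (first_vars k)"] exI[of _ "{..<k} \<times> {..<k}"]) auto
  qed
  show "f multipliable_on UNIV"
    unfolding multipliable_on_def using Lim_agree(1)[OF ev] by blast
  show "agree (monomials_in (first_vars n)) (infprod f UNIV) (\<Prod>ij\<in>{..<n} \<times> {..<n}. f ij)"
    unfolding infprod_def
    by (rule Lim_agree(2)[OF ev, where I = "{..<n} \<times> {..<n}"]) (use const in auto)
qed

definition alphabet :: "(nat \<Rightarrow> (nat + nat) mps) \<Rightarrow> bool" where
  "alphabet z \<longleftrightarrow> z = xvar \<or> z = yvar"

lemma alphabet_xvar [simp]: "alphabet xvar" and alphabet_yvar [simp]: "alphabet yvar"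
  by (simp_all add: alphabet_def)

lemma alphabet_monomials_in: "alphabet z \<Longrightarrow> n \<le> i \<Longrightarrow> agree (monomials_in (first_vars n)) (z i) 0"
  by (auto simp: alphabet_def xvar_def yvar_def first_vars_def intro!: agree_monomials_in_var)

lemma alphabet_degree_below: "alphabet z \<Longrightarrow> agree (degree_below 1) (z i) 0"
  by (auto simp: alphabet_def xvar_def yvar_def intro!: agree_degree_below_var[unfolded One_nat_def])

lemma complete_sym_agree:
  assumes "alphabet z"
  shows "agree (monomials_in (first_vars n)) (complete_sym z r) (int_coeff (complete_gen z n) r)"
proof -
  have "agree (monomials_in (first_vars n)) (fps_nth (fps_infprod (\<lambda>i. inverse (1 - fps_const (z i) * fps_X)) UNIV) k)
     (fps_nth (\<Prod>i<n. inverse (1 - fps_const (z i) * fps_X)) k)" for k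
  proof (rule fps_infprod_agree)
    fix n i :: nat assume "n \<le> i"
    have "agree (monomials_in (first_vars n)) (z i ^ k) (0 ^ k)" for k
      by (intro agree_power divisor_closed_monomials_in alphabet_monomials_in assms \<open>n \<le> i\<close>)
    then show "agree_fps (monomials_in (first_vars n)) (inverse (1 - fps_const (z i) * fps_X)) 1"
      by (simp add: agree_fps_def fps_geometric_inverse fps_one_nth power_0_left)
  qed
  then show ?thesis
    by (simp add: complete_sym_def int_coeff_def complete_gen_def fps_geometric_inverse)
qed

lemma elementary_sym_agree:
  assumes "alphabet z"
  shows "agree (monomials_in (first_vars n)) (elementary_sym z r) (int_coeff (elementary_gen z n) r)"
proof -
  have "agree (monomials_in (first_vars n)) (fps_nth (fps_infprod (\<lambda>i. 1 + fps_const (z i) * fps_X) UNIV) k)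
     (fps_nth (\<Prod>i<n. 1 + fps_const (z i) * fps_X) k)" for k
  proof (rule fps_infprod_agree)
    fix n i :: nat assume "n \<le> i"
    then have z: "agree (monomials_in (first_vars n)) (z i) 0" by (rule alphabet_monomials_in[OF assms])
    have "agree (monomials_in (first_vars n)) (1 + z i * c) (1 + 0)" for c
      by (intro agree_add agree_refl agree_mult_zero divisor_closed_monomials_in z)
    then show "agree_fps (monomials_in (first_vars n)) (1 + fps_const (z i) * fps_X) 1"
      using z by (auto simp: agree_fps_def)
  qed
  then show ?thesis
    by (simp add: elementary_sym_def int_coeff_def elementary_gen_def)
qed

lemma schur_agree:
  assumes "alphabet z" "\<And>k. k \<ge> l \<Longrightarrow> \<mu> k = 0"
  shows "agree (monomials_in (first_vars n)) (schur z \<mu>) (jacobi_trudi (int_coeff (complete_gen z n)) l \<mu>)"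
proof -
  have "schur z \<mu> = jacobi_trudi (complete_sym z) l \<mu>" by (rule schur_eq_jacobi_trudi) (rule assms(2))
  then show ?thesis
    unfolding jacobi_trudi_def
    by (simp only:) (intro agree_det_fun divisor_closed_monomials_in complete_sym_agree assms(1))
qed

text \<open>
  The truncations to finitely many variables are products of geometric series in \<open>z\<^sub>i t\<close>, in which
  the degree in \<open>t\<close> is the degree in the variables.
\<close>

lemma complete_sym_degree_below:
  assumes z: "alphabet z"
  shows "agree (degree_below (nat r)) (complete_sym z r) 0"
  unfolding agree_def
proof
  fix m :: "(nat + nat) \<Rightarrow>\<^sub>0 nat" assume m: "m \<in> degree_below (nat r)"
  obtain n where n: "m \<in> monomials_in (first_vars n)" using ex_first_vars[of 0 m] by blast
  have "agree (degree_below r) (fps_nth (\<Prod>i\<in>A. Abs_fps (\<lambda>r. z i ^ r)) r) 0" for A :: "nat set" and r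
  proof (induction A arbitrary: r rule: infinite_finite_induct)
    case (insert a A)
    have pow: "agree (degree_below s) (z a ^ s) 0" for s
      using agree_degree_below_power_zero[OF alphabet_degree_below[OF z, of a], of s] by simp
    have "agree (degree_below r) (\<Sum>s=0..r. z a ^ s * fps_nth (\<Prod>i\<in>A. Abs_fps (\<lambda>r. z i ^ r)) (r - s)) 0"
    proof (rule agree_zero_sum)
      fix s assume "s \<in> {0..r}"
      then show "agree (degree_below r) (z a ^ s * fps_nth (\<Prod>i\<in>A. Abs_fps (\<lambda>r. z i ^ r)) (r - s)) 0"
        using agree_degree_below_mult_zero[OF pow[of s] insert.IH[of "r - s"]] by simp
    qed
    then show ?case using insert.hyps by (simp add: fps_mult_nth)
  qed (auto simp: fps_one_nth)
  then have "agree (degree_below (nat r)) (int_coeff (complete_gen z n) r) 0"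
    by (simp add: int_coeff_def complete_gen_def)
  then show "mps_coeff (complete_sym z r) m = mps_coeff 0 m"
    using complete_sym_agree[OF z, of n r] n m by (auto simp: agree_def)
qed

text \<open>
  In each term of the Leibniz formula the degrees of the factors add up to the size of the
  partition, unless some factor has negative degree and vanishes.
\<close>

lemma schur_degree_below:
  assumes z: "alphabet z" and \<mu>: "\<mu> \<in> partitions" and l: "\<And>k. k \<ge> l \<Longrightarrow> \<mu> k = 0"
  shows "agree (degree_below (nat (\<Sum>k<l. \<mu> k))) (schur z \<mu>) 0"
proof -
  have "schur z \<mu> = jacobi_trudi (complete_sym z) l \<mu>" by (rule schur_eq_jacobi_trudi) (rule l)
  also have "\<dots> = (\<Sum>p | p permutes {0..<l}. signof p * (\<Prod>i=0..<l. complete_sym z (\<mu> i + int (p i) - int i)))"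
    unfolding jacobi_trudi_def det_fun_expand ..
  finally have eq: "schur z \<mu> = \<dots>" .
  show ?thesis unfolding eq
  proof (rule agree_zero_sum)
    fix p assume "p \<in> {p. p permutes {0..<l}}"
    then have p: "p permutes {0..<l}" by simp
    let ?a = "\<lambda>i. \<mu> i + int (p i) - int i"
    have "agree (degree_below (nat (\<Sum>k<l. \<mu> k))) (\<Prod>i=0..<l. complete_sym z (?a i)) 0"
    proof (cases "\<forall>i\<in>{0..<l}. 0 \<le> ?a i")
      case True
      have "(\<Sum>i=0..<l. int (p i)) = (\<Sum>i=0..<l. int i)"
        using sum.permute[OF p, of int] by (simp add: o_def)
      then have "(\<Sum>k<l. \<mu> k) = (\<Sum>i=0..<l. ?a i)"
        by (simp add: sum.distrib sum_subtractf lessThan_atLeast0)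
      also have "\<dots> = int (\<Sum>i=0..<l. nat (?a i))" using True by simp
      finally have sum: "nat (\<Sum>k<l. \<mu> k) = (\<Sum>i=0..<l. nat (?a i))" by (simp only: nat_int)
      show ?thesis
        unfolding sum by (rule agree_degree_below_prod_zero) (rule complete_sym_degree_below[OF z])
    next
      case False
      then have "(\<Prod>i=0..<l. complete_sym z (?a i)) = 0"
        by (intro prod_zero) (auto simp: not_le intro!: complete_sym_neg)
      then show ?thesis by simp
    qed
    then have "agree (degree_below (nat (\<Sum>k<l. \<mu> k))) ((\<Prod>i=0..<l. complete_sym z (?a i)) * signof p) 0"
      by (intro agree_mult_zero divisor_closed_degree_below)
    then show "agree (degree_below (nat (\<Sum>k<l. \<mu> k))) (signof p * (\<Prod>i=0..<l. complete_sym z (?a i))) 0"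
      by (simp only: mult.commute)
  qed
qed

lemma partition_length: "\<mu> \<in> partitions \<Longrightarrow> \<exists>l\<ge>n. \<forall>k\<ge>l. \<mu> k = 0"
proof -
  assume "\<mu> \<in> partitions"
  then obtain l where l: "{i. \<mu> i \<noteq> 0} \<subseteq> {..<l}"
    using finite_nat_iff_bounded partitionsD(3) by blast
  have "\<mu> k = 0" if "max n l \<le> k" for k
    using l that by auto
  then show ?thesis by (intro exI[of _ "max n l"]) auto
qed

lemma schur_outside_box:
  assumes z: "alphabet z" and \<mu>: "\<mu> \<in> partitions - boxed_partitions n K" and D: "D \<le> n" "D \<le> K"
  shows "agree (degree_below (Suc D)) (schur z \<mu>) 0"
proof -
  have par: "\<mu> \<in> partitions" using \<mu> by simp
  obtain l where l: "n < l" "\<And>k. k \<ge> l \<Longrightarrow> \<mu> k = 0" using partition_length[OF par, of "Suc n"] by (metis Suc_le_eq)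
  have "int (Suc D) \<le> (\<Sum>k<l. \<mu> k)"
  proof (cases "\<exists>k\<ge>n. \<mu> k \<noteq> 0")
    case True
    then obtain k where k: "n \<le> k" "\<mu> k \<noteq> 0" by blast
    then have "1 \<le> \<mu> k" using partitionsD(2)[OF par, of k] by simp
    then have ge: "1 \<le> \<mu> i" if "i \<le> n" for i
      using partitionsD(1)[OF par, of i k] that k by simp
    have "int (Suc n) = (\<Sum>k<Suc n. 1)" by simp
    also have "\<dots> \<le> (\<Sum>k<Suc n. \<mu> k)" using ge by (intro sum_mono) auto
    also have "\<dots> \<le> (\<Sum>k<l. \<mu> k)"
      using l(1) partitionsD(2)[OF par] by (intro sum_mono2) auto
    finally show ?thesis using D by simp
  next
    case False
    then have "\<not> (\<forall>k. \<mu> k \<le> int K)" using \<mu> unfolding boxed_partitions_def by blast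
    then obtain k where k: "\<mu> k > int K" by (auto simp: not_le)
    then have "k < l" using l(2)[of k] by (cases "k < l") auto
    then have "\<mu> k \<le> (\<Sum>k<l. \<mu> k)"
      using partitionsD(2)[OF par] by (intro member_le_sum) auto
    then show ?thesis using k D by simp
  qed
  then have "Suc D \<le> nat (\<Sum>k<l. \<mu> k)" by simp
  then show ?thesis
    by (rule agree_degree_below_mono[OF schur_degree_below[OF z par l(2)], rotated]) assumption
qed

section \<open>The two kernels\<close>

lemma alphabet_mult_degree_below: "agree (degree_below 1) (xvar i * yvar j) 0"
  by (intro agree_mult_zero divisor_closed_degree_below alphabet_degree_below) simp

lemma complete_kernel_agree_one:
  assumes "n \<le> i \<or> n \<le> j"
  shows "agree (monomials_in (first_vars n)) (1 / (1 - xvar i * yvar j)) 1"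
proof (rule geometric_agree_one[OF alphabet_mult_degree_below divisor_closed_monomials_in])
  show "agree (monomials_in (first_vars n)) (xvar i * yvar j) 0"
    using assms agree_mult_zero[OF divisor_closed_monomials_in alphabet_monomials_in[OF alphabet_xvar], of n i "yvar j"]
      agree_mult_zero[OF divisor_closed_monomials_in alphabet_monomials_in[OF alphabet_yvar], of n j "xvar i"]
    by (auto simp: mult.commute)
qed

lemma elementary_kernel_agree_one:
  assumes "n \<le> i \<or> n \<le> j"
  shows "agree (monomials_in (first_vars n)) (1 + xvar i * yvar j) 1"
proof -
  have "agree (monomials_in (first_vars n)) (xvar i * yvar j) 0"
    using assms agree_mult_zero[OF divisor_closed_monomials_in alphabet_monomials_in[OF alphabet_xvar], of n i "yvar j"]
      agree_mult_zero[OF divisor_closed_monomials_in alphabet_monomials_in[OF alphabet_yvar], of n j "xvar i"]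
    by (auto simp: mult.commute)
  then have "agree (monomials_in (first_vars n)) (1 + xvar i * yvar j) (1 + 0)" by (intro agree_add agree_refl)
  then show ?thesis by simp
qed

lemma complete_gen_eval:
  assumes "alphabet z" "alphabet w"
  shows "agree (degree_below (Suc K)) (\<Prod>i<n. 1 / (1 - z i * w j)) (\<Sum>r<Suc K. fps_nth (complete_gen z n) r * w j ^ r)"
proof -
  have "agree (degree_below 1) (z i * w j) 0" for i
    by (intro agree_mult_zero divisor_closed_degree_below alphabet_degree_below assms)
  then have "agree (degree_below (Suc K)) (\<Prod>i<n. 1 / (1 - z i * w j)) (\<Prod>i<n. \<Sum>r<Suc K. (z i * w j) ^ r)"
    by (intro agree_prod divisor_closed_degree_below geometric_truncate)
  also have "(\<Prod>i<n. \<Sum>r<Suc K. (z i * w j) ^ r) = (\<Prod>i<n. \<Sum>r<Suc K. fps_nth (Abs_fps (\<lambda>r. z i ^ r)) r * w j ^ r)"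
    by (simp add: power_mult_distrib del: sum.lessThan_Suc)
  also have "agree (degree_below (Suc K)) \<dots> (\<Sum>r<Suc K. fps_nth (complete_gen z n) r * w j ^ r)"
    unfolding complete_gen_def by (rule agree_sym, rule eval_prod) (rule alphabet_degree_below[OF assms(2)])
  finally show ?thesis .
qed

lemma elementary_gen_eval:
  assumes "alphabet z" "alphabet w" "0 < K"
  shows "agree (degree_below (Suc K)) (\<Prod>i<n. 1 + z i * w j) (\<Sum>r<Suc K. fps_nth (elementary_gen z n) r * w j ^ r)"
proof -
  have lin: "(\<Sum>r<Suc K. fps_nth (1 + fps_const c * fps_X) r * w j ^ r) = 1 + c * w j" for c
  proof -
    have "(\<Sum>r<Suc K. fps_nth (1 + fps_const c * fps_X) r * w j ^ r) =
      (\<Sum>r\<in>{0, 1}. fps_nth (1 + fps_const c * fps_X) r * w j ^ r)"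
      by (rule sum.mono_neutral_right) (use assms(3) in auto)
    then show ?thesis by simp
  qed
  have "agree (degree_below (Suc K)) (\<Sum>r<Suc K. fps_nth (\<Prod>i<n. 1 + fps_const (z i) * fps_X) r * w j ^ r)
     (\<Prod>i<n. \<Sum>r<Suc K. fps_nth (1 + fps_const (z i) * fps_X) r * w j ^ r)"
    by (rule eval_prod) (rule alphabet_degree_below[OF assms(2)])
  then show ?thesis unfolding lin elementary_gen_def by (rule agree_sym)
qed

text \<open>
  The sign change \<open>t \<mapsto> -t\<close> is multiplicative, which reduces the claim to one variable.
\<close>

lemma elementary_complete_gen: "elementary_gen y n * Abs_fps (\<lambda>k. (-1) ^ k * fps_nth (complete_gen y n) k) = (1 :: 'a::comm_ring_1 fps)"
proof -
  let ?alt = "\<lambda>F. Abs_fps (\<lambda>k. (-1) ^ k * fps_nth F k) :: 'a fps"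
  have alt_mult: "?alt (F * G) = ?alt F * ?alt G" for F G
  proof (rule fps_ext)
    fix k
    have "(-1) ^ k * (fps_nth F i * fps_nth G (k - i)) = (-1) ^ i * fps_nth F i * ((-1) ^ (k - i) * fps_nth G (k - i))"
      if "i \<in> {0..k}" for i
    proof -
      have "(-1 :: 'a) ^ k = (-1) ^ i * (-1) ^ (k - i)" using that by (simp flip: power_add)
      then show ?thesis by (simp only: mult_ac)
    qed
    then show "fps_nth (?alt (F * G)) k = fps_nth (?alt F * ?alt G) k"
      by (simp add: fps_mult_nth sum_distrib_left)
  qed
  have "?alt 1 = 1" by (rule fps_ext) (simp add: fps_one_nth)
  then have alt_prod: "?alt (\<Prod>i<n. F i) = (\<Prod>i<n. ?alt (F i))" for F and n :: nat
    by (induction n) (simp_all add: alt_mult)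
  have alt_geo: "?alt (Abs_fps (\<lambda>r. c ^ r)) = Abs_fps (\<lambda>r. (- c) ^ r)" for c
    by (rule fps_ext) (simp flip: power_mult_distrib)
  have "(1 + fps_const c * fps_X) * ?alt (Abs_fps (\<lambda>r. c ^ r)) = 1" for c
  proof -
    have "1 - fps_const (- c) * fps_X = 1 + fps_const c * fps_X" by (simp flip: fps_const_neg)
    then show ?thesis using geometric_fps[of "- c"] alt_geo[of c]
      by (simp only: mult.commute)
  qed
  then show ?thesis
    unfolding elementary_gen_def complete_gen_def alt_prod by (simp add: prod.distrib[symmetric])
qed

section \<open>The Schur expansions\<close>

text \<open>
  For the coefficient at \<open>m\<close>, take \<open>n\<close> so large that \<open>m\<close> only involves the first \<open>n\<close> variables of either
  kind, and the degree bound \<open>K\<close> beyond the degree of \<open>m\<close>. Partitions outside the box have Schur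
  functions of too large degree, and inside the box \<open>finite_cauchy\<close> applies. The factor \<open>S\<close> is left
  general to cover both the Schur functions of \<open>\<mu>\<close> and those of its conjugate.
\<close>

lemma schur_expansion_has_sum:
  fixes P :: "(nat + nat) mps" and w :: "nat \<Rightarrow> (nat + nat) mps"
  assumes w: "w = (\<lambda>j. mps_var (c j))" "alphabet w" "inj c"
    and P: "\<And>n. agree (monomials_in (first_vars n)) P (\<Prod>j<n. G n j)"
    and G: "\<And>n K j. 0 < K \<Longrightarrow> agree (degree_below (Suc K)) (G n j) (\<Sum>r<Suc K. fps_nth (F n) r * w j ^ r)"
    and S: "\<And>n K \<mu>. \<mu> \<in> boxed_partitions n K \<Longrightarrow> agree (monomials_in (first_vars n)) (S \<mu>) (jacobi_trudi (int_coeff (F n)) n \<mu>)"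
  shows "((\<lambda>\<mu>. S \<mu> * schur w \<mu>) has_sum P) partitions"
proof (rule has_sum_mpsI)
  fix m :: "(nat + nat) \<Rightarrow>\<^sub>0 nat"
  define d where "d = mdeg m"
  obtain n where n: "d \<le> n" "m \<in> monomials_in (first_vars n)" using ex_first_vars[of d m] by blast
  \<comment> \<open>the excess over the degree pays for cancelling the Vandermonde determinant\<close>
  define K where "K = Suc (d + card (pairs n))"
  have "mps_coeff (S \<mu> * schur w \<mu>) m = 0" if "\<mu> \<in> partitions - boxed_partitions n K" for \<mu>
  proof -
    have "agree (degree_below (Suc d)) (schur w \<mu> * S \<mu>) 0"
      using schur_outside_box[OF w(2) that n(1)]
      by (intro agree_mult_zero divisor_closed_degree_below) (simp add: K_def)
    then show ?thesis by (simp add: agree_def degree_below_def d_def mult.commute)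
  qed
  moreover have "(\<Sum>\<mu>\<in>boxed_partitions n K. mps_coeff (S \<mu> * schur w \<mu>) m) = mps_coeff P m"
  proof -
    let ?T = "\<Sum>\<mu>\<in>boxed_partitions n K. jacobi_trudi (int_coeff (F n)) n \<mu> * jacobi_trudi (int_coeff (complete_gen w n)) n \<mu>"
    have "agree (monomials_in (first_vars n)) (\<Sum>\<mu>\<in>boxed_partitions n K. S \<mu> * schur w \<mu>) ?T"
      by (intro agree_sum agree_mult divisor_closed_monomials_in S schur_agree w(2)) (auto simp: boxed_partitions_def)
    then have "mps_coeff (\<Sum>\<mu>\<in>boxed_partitions n K. S \<mu> * schur w \<mu>) m = mps_coeff ?T m"
      using n(2) by (simp add: agree_def)
    also have "agree (degree_below (Suc d)) (\<Prod>j<n. G n j) ?T"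
      unfolding w(1) by (rule finite_cauchy[OF w(3)]) (use G[of K n, unfolded w(1)] in \<open>auto simp: K_def\<close>)
    then have "mps_coeff ?T m = mps_coeff (\<Prod>j<n. G n j) m" by (simp add: agree_def degree_below_def d_def)
    also have "\<dots> = mps_coeff P m" using P[of n] n(2) by (simp add: agree_def)
    finally show ?thesis by (simp add: coeff_sum)
  qed
  ultimately show "\<exists>B. finite B \<and> B \<subseteq> partitions \<and> (\<forall>\<mu>\<in>partitions - B. mps_coeff (S \<mu> * schur w \<mu>) m = 0) \<and>
      (\<Sum>\<mu>\<in>B. mps_coeff (S \<mu> * schur w \<mu>) m) = mps_coeff P m"
    by (intro exI[of _ "boxed_partitions n K"]) (auto simp: boxed_partitions_subset subsetD[OF boxed_partitions_subset])
qed

lemma xvar_eq: "xvar = (\<lambda>i. mps_var (Inl i))" and yvar_eq: "yvar = (\<lambda>j. mps_var (Inr j))"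
  by (simp_all add: fun_eq_iff xvar_def yvar_def)

lemma complete_kernel:
  shows "(\<lambda>(i, j). 1 / (1 - xvar i * yvar j)) multipliable_on UNIV"
    and "agree (monomials_in (first_vars n)) (infprod (\<lambda>(i, j). 1 / (1 - xvar i * yvar j)) UNIV)
      (\<Prod>i<n. \<Prod>j<n. 1 / (1 - xvar i * yvar j))"
  using infprod_agree[of "\<lambda>(i, j). 1 / (1 - xvar i * yvar j)"] complete_kernel_agree_one
  by (simp_all add: prod.cartesian_product)

lemma elementary_kernel:
  shows "(\<lambda>(i, j). 1 + xvar i * yvar j) multipliable_on UNIV"
    and "agree (monomials_in (first_vars n)) (infprod (\<lambda>(i, j). 1 + xvar i * yvar j) UNIV)
      (\<Prod>i<n. \<Prod>j<n. 1 + xvar i * yvar j)"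
  using infprod_agree[of "\<lambda>(i, j). 1 + xvar i * yvar j"] elementary_kernel_agree_one
  by (simp_all add: prod.cartesian_product)

lemma schur_schur_has_sum:
  "((\<lambda>\<mu>. schur xvar \<mu> * schur yvar \<mu>) has_sum infprod (\<lambda>(i, j). 1 / (1 - xvar i * yvar j)) UNIV) partitions"
proof (rule schur_expansion_has_sum[OF yvar_eq alphabet_yvar])
  show "inj Inr" by simp
  show "agree (monomials_in (first_vars n)) (infprod (\<lambda>(i, j). 1 / (1 - xvar i * yvar j)) UNIV)
     (\<Prod>j<n. \<Prod>i<n. 1 / (1 - xvar i * yvar j))" for n
    using complete_kernel(2)[of n] by (subst prod.swap)
  show "agree (degree_below (Suc K)) (\<Prod>i<n. 1 / (1 - xvar i * yvar j)) (\<Sum>r<Suc K. fps_nth (complete_gen xvar n) r * yvar j ^ r)" for n K j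
    by (rule complete_gen_eval) simp_all
  show "agree (monomials_in (first_vars n)) (schur xvar \<mu>) (jacobi_trudi (int_coeff (complete_gen xvar n)) n \<mu>)" if "\<mu> \<in> boxed_partitions n K" for n K \<mu>
    by (rule schur_agree) (use that in \<open>auto simp: boxed_partitions_def\<close>)
qed

text \<open>
  The alternants are formed in the variables \<open>x\<close> here, and \<open>F\<close> is the generating function of
  the elementary functions in \<open>y\<close>; its determinants are turned into Schur functions by duality.
\<close>

lemma schur_conjugate_has_sum:
  "((\<lambda>\<mu>. schur xvar \<mu> * schur yvar (conjugate \<mu>)) has_sum infprod (\<lambda>(i, j). 1 + xvar i * yvar j) UNIV) partitions"
proof -
  have "((\<lambda>\<mu>. schur yvar (conjugate \<mu>) * schur xvar \<mu>) has_sum infprod (\<lambda>(i, j). 1 + xvar i * yvar j) UNIV) partitions"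
  proof (rule schur_expansion_has_sum[OF xvar_eq alphabet_xvar])
    show "inj Inl" by simp
    show "agree (monomials_in (first_vars n)) (infprod (\<lambda>(i, j). 1 + xvar i * yvar j) UNIV)
       (\<Prod>i<n. \<Prod>j<n. 1 + yvar j * xvar i)" for n
      using elementary_kernel(2)[of n] by (simp only: mult.commute)
    show "agree (degree_below (Suc K)) (\<Prod>j<n. 1 + yvar j * xvar i) (\<Sum>r<Suc K. fps_nth (elementary_gen yvar n) r * xvar i ^ r)"
      if "0 < K" for n K i
      by (rule elementary_gen_eval) (simp_all add: that)
    show "agree (monomials_in (first_vars n)) (schur yvar (conjugate \<mu>)) (jacobi_trudi (int_coeff (elementary_gen yvar n)) n \<mu>)"
      if \<mu>: "\<mu> \<in> boxed_partitions n K" for n K \<mu>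
    proof -
      have "agree (monomials_in (first_vars n)) (schur yvar (conjugate \<mu>)) (jacobi_trudi (int_coeff (complete_gen yvar n)) K (conjugate \<mu>))"
        by (rule schur_agree) (use conjugate_boxed[OF \<mu>] in \<open>auto simp: boxed_partitions_def\<close>)
      also have "jacobi_trudi (int_coeff (complete_gen yvar n)) K (conjugate \<mu>) = jacobi_trudi (int_coeff (elementary_gen yvar n)) n \<mu>"
        by (rule jacobi_trudi_conjugate[OF elementary_complete_gen _ \<mu>, symmetric]) (simp add: elementary_gen_def fps_nth_prod_0)
      finally show ?thesis .
    qed
  qed
  then show ?thesis by (simp only: mult.commute)
qed

section \<open>The monomial expansions\<close>

definition rearrangements :: "(nat \<Rightarrow> int) \<Rightarrow> (nat \<Rightarrow> int) set" where
  "rearrangements \<mu> = {\<mu> \<circ> \<sigma> | \<sigma>. bij \<sigma>}"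

definition bounded_exponents :: "nat \<Rightarrow> nat \<Rightarrow> (nat \<Rightarrow> int) set" where
  "bounded_exponents n K = {\<alpha>. (\<forall>i. 0 \<le> \<alpha> i \<and> \<alpha> i \<le> int K) \<and> (\<forall>i\<ge>n. \<alpha> i = 0)}"

lemma bounded_exponents_bij:
  "bij_betw (\<lambda>f i. if i < n then int (f i) else 0) (PiE {..<n} (\<lambda>_. {..<Suc K})) (bounded_exponents n K)"
proof (rule bij_betw_byWitness[where f' = "\<lambda>\<alpha>. restrict (\<lambda>i. nat (\<alpha> i)) {..<n}"])
  show "\<forall>f\<in>PiE {..<n} (\<lambda>_. {..<Suc K}). restrict (\<lambda>i. nat (if i < n then int (f i) else 0)) {..<n} = f"
    by (auto simp: PiE_iff fun_eq_iff extensional_def)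
  show "\<forall>\<alpha>\<in>bounded_exponents n K. (\<lambda>i. if i < n then int (restrict (\<lambda>i. nat (\<alpha> i)) {..<n} i) else 0) = \<alpha>"
    by (auto simp: bounded_exponents_def fun_eq_iff)
  show "(\<lambda>f i. if i < n then int (f i) else 0) ` PiE {..<n} (\<lambda>_. {..<Suc K}) \<subseteq> bounded_exponents n K"
  proof (rule image_subsetI)
    fix f assume f: "f \<in> PiE {..<n} (\<lambda>_. {..<Suc K})"
    have "f i \<le> K" if "i < n" for i
      using PiE_mem[OF f, of i] that by (simp only: lessThan_iff less_Suc_eq_le)
    then show "(\<lambda>i. if i < n then int (f i) else 0) \<in> bounded_exponents n K" by (simp add: bounded_exponents_def)
  qed
  show "(\<lambda>\<alpha>. restrict (\<lambda>i. nat (\<alpha> i)) {..<n}) ` bounded_exponents n K \<subseteq> PiE {..<n} (\<lambda>_. {..<Suc K})"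
  proof (rule image_subsetI)
    fix \<alpha> assume "\<alpha> \<in> bounded_exponents n K"
    then have "nat (\<alpha> i) < Suc K" for i by (simp add: bounded_exponents_def nat_le_iff less_Suc_eq_le)
    then show "restrict (\<lambda>i. nat (\<alpha> i)) {..<n} \<in> PiE {..<n} (\<lambda>_. {..<Suc K})" by simp
  qed
qed

lemma finite_bounded_exponents [simp]: "finite (bounded_exponents n K)"
  using bij_betw_finite[OF bounded_exponents_bij[of n K]] by (simp add: finite_PiE)

lemma partition_levels:
  assumes "\<mu> \<in> partitions" "0 < c"
  shows "{i. c \<le> \<mu> i} = {..<card {i. c \<le> \<mu> i}}"
proof (rule finite_initial_segment)
  show "finite {i. c \<le> \<mu> i}"
    by (rule finite_subset[OF _ partitionsD(3)[OF assms(1)]]) (use assms(2) in auto)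
  show "i \<in> {i. c \<le> \<mu> i}" if "j \<in> {i. c \<le> \<mu> i}" "i \<le> j" for i j
    using that partitionsD(1)[OF assms(1) that(2)] by simp
qed

lemma card_levels_rearranged:
  assumes "\<alpha> \<in> rearrangements \<mu>"
  shows "card {i. c \<le> \<alpha> i} = card {i. c \<le> \<mu> i}"
proof -
  obtain \<sigma> where \<sigma>: "bij \<sigma>" "\<alpha> = \<mu> \<circ> \<sigma>" using assms by (auto simp: rearrangements_def)
  have "bij_betw \<sigma> {i. c \<le> \<alpha> i} {i. c \<le> \<mu> i}"
  proof (rule bij_betw_imageI)
    show "inj_on \<sigma> {i. c \<le> \<alpha> i}" using bij_is_inj[OF \<sigma>(1)] by (rule inj_on_subset) simp
    show "\<sigma> ` {i. c \<le> \<alpha> i} = {i. c \<le> \<mu> i}"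
      unfolding \<sigma>(2) using bij_is_surj[OF \<sigma>(1)] by auto
  qed
  then show ?thesis by (rule bij_betw_same_card)
qed

text \<open>
  A partition is determined by the cardinalities of its level sets at positive heights, and these are
  invariant under rearrangement. At height 0 the level set is infinite.
\<close>

lemma rearrangements_disjoint:
  assumes "\<mu> \<in> partitions" "\<nu> \<in> partitions" "\<alpha> \<in> rearrangements \<mu>" "\<alpha> \<in> rearrangements \<nu>"
  shows "\<mu> = \<nu>"
proof
  fix i
  have card: "card {i. c \<le> \<mu> i} = card {i. c \<le> \<nu> i}" for c
    using card_levels_rearranged[OF assms(3), of c] card_levels_rearranged[OF assms(4), of c] by simp
  have lev: "c \<le> \<mu> i \<longleftrightarrow> c \<le> \<nu> i" if "0 < c" for c
  proof -
    have "{i. c \<le> \<mu> i} = {..<card {i. c \<le> \<mu> i}}" by (rule partition_levels[OF assms(1) that])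
    also have "\<dots> = {..<card {i. c \<le> \<nu> i}}" by (simp only: card)
    also have "\<dots> = {i. c \<le> \<nu> i}" by (rule partition_levels[OF assms(2) that, symmetric])
    finally show ?thesis by blast
  qed
  show "\<mu> i = \<nu> i"
    using lev[of "\<mu> i"] lev[of "\<nu> i"] partitionsD(2)[OF assms(1), of i] partitionsD(2)[OF assms(2), of i]
    by linarith
qed

lemma bounded_exponents_rearrange:
  assumes \<alpha>: "\<alpha> \<in> bounded_exponents n K"
  shows "\<exists>\<mu>\<in>boxed_partitions n K. \<alpha> \<in> rearrangements \<mu>"
proof -
  obtain p where p: "p permutes {0..<n}" and srt: "\<And>i j. i \<le> j \<Longrightarrow> j < n \<Longrightarrow> \<alpha> (p j) \<le> \<alpha> (p i)"
    using sorting_permutation[of n \<alpha>] by blast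
  have zero: "\<alpha> (p j) = 0" if "n \<le> j" for j
    using \<alpha> that permutes_not_in[OF p, of j] by (simp add: bounded_exponents_def)
  have "(\<alpha> \<circ> p) j \<le> (\<alpha> \<circ> p) i" if "i \<le> j" for i j
    using srt[of i j] zero[of j] that \<alpha> by (cases "j < n") (auto simp: bounded_exponents_def)
  moreover have "{i. (\<alpha> \<circ> p) i \<noteq> 0} \<subseteq> {..<n}" using zero by (auto intro: leI simp: not_less[symmetric])
  then have "finite {i. (\<alpha> \<circ> p) i \<noteq> 0}" by (rule finite_subset) simp
  ultimately have "\<alpha> \<circ> p \<in> boxed_partitions n K"
    using \<alpha> zero by (auto simp: boxed_partitions_def partitions_def antimono_def bounded_exponents_def)
  moreover have "\<alpha> = (\<alpha> \<circ> p) \<circ> Hilbert_Choice.inv p"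
    by (simp add: fun_eq_iff permutes_inverses(1)[OF p])
  then have "\<alpha> \<in> rearrangements (\<alpha> \<circ> p)"
    unfolding rearrangements_def using permutes_bij[OF permutes_inv[OF p]] by blast
  ultimately show ?thesis by blast
qed

lemma rearrangement_in_exponents:
  assumes \<mu>: "\<mu> \<in> partitions" and \<alpha>: "\<alpha> \<in> rearrangements \<mu>" "\<alpha> \<in> bounded_exponents n K"
  shows "\<mu> \<in> boxed_partitions n K"
proof -
  obtain \<sigma> where \<sigma>: "bij \<sigma>" "\<alpha> = \<mu> \<circ> \<sigma>" using \<alpha>(1) by (auto simp: rearrangements_def)
  have le: "\<mu> k \<le> int K" for k
  proof -
    obtain i where "k = \<sigma> i" using bij_is_surj[OF \<sigma>(1)] by (metis surjD)
    then show ?thesis using \<alpha>(2) \<sigma>(2) by (auto simp: bounded_exponents_def)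
  qed
  have "{i. 1 \<le> \<alpha> i} \<subseteq> {..<n}" using \<alpha>(2) by (auto simp: bounded_exponents_def not_less[symmetric] intro: leI)
  then have "card {i. 1 \<le> \<alpha> i} \<le> n" using card_mono[of "{..<n}"] by fastforce
  then have "card {i. 1 \<le> \<mu> i} \<le> n" using card_levels_rearranged[OF \<alpha>(1), of 1] by simp
  then have "{..<card {i. 1 \<le> \<mu> i}} \<subseteq> {..<n}" by (simp only: lessThan_subset_iff)
  moreover have "{i. 1 \<le> \<mu> i} = {..<card {i. 1 \<le> \<mu> i}}"
    by (rule partition_levels[OF \<mu>]) simp
  ultimately have sub: "{i. 1 \<le> \<mu> i} \<subseteq> {..<n}" by (rule ord_eq_le_trans[rotated])
  have "\<not> 1 \<le> \<mu> k" if "n \<le> k" for k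
  proof
    assume "1 \<le> \<mu> k"
    then have "k \<in> {..<n}" using sub by blast
    then show False using that by simp
  qed
  then have "\<mu> k = 0" if "n \<le> k" for k
    using that partitionsD(2)[OF \<mu>, of k] by force
  then show ?thesis using \<mu> le by (simp add: boxed_partitions_def)
qed

definition x_monomial :: "(nat \<Rightarrow> int) \<Rightarrow> (nat + nat) mps" where
  "x_monomial \<alpha> = (\<Prod>i | \<alpha> i \<noteq> 0. xvar i ^ nat (\<alpha> i))"

lemma monomial_sym_eq: "monomial_sym xvar \<mu> = infsum x_monomial (rearrangements \<mu>)"
  by (simp add: monomial_sym_def rearrangements_def x_monomial_def[abs_def])

lemma rearrangement_finite_support:
  assumes "\<mu> \<in> partitions" "\<alpha> \<in> rearrangements \<mu>"
  shows "finite {i. \<alpha> i \<noteq> 0}" "0 \<le> \<alpha> i"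
proof -
  obtain \<sigma> where \<sigma>: "bij \<sigma>" "\<alpha> = \<mu> \<circ> \<sigma>" using assms(2) by (auto simp: rearrangements_def)
  have "{i. \<alpha> i \<noteq> 0} = \<sigma> -` {i. \<mu> i \<noteq> 0}" using \<sigma>(2) by auto
  then show "finite {i. \<alpha> i \<noteq> 0}"
    using finite_vimageI[OF partitionsD(3)[OF assms(1)] bij_is_inj[OF \<sigma>(1)]] by simp
  show "0 \<le> \<alpha> i" using partitionsD(2)[OF assms(1)] \<sigma>(2) by simp
qed

text \<open>
  Monomials visible to the first \<open>n\<close> variables of either kind in degree at most \<open>K\<close>; only rearrangements
  that are bounded by \<open>K\<close> and supported below \<open>n\<close> contribute to them.
\<close>

definition window :: "nat \<Rightarrow> nat \<Rightarrow> ((nat + nat) \<Rightarrow>\<^sub>0 nat) set" where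
  "window n K = monomials_in (first_vars n) \<inter> degree_below (Suc K)"

lemma divisor_closed_window: "divisor_closed (window n K)"
  using divisor_closed_monomials_in[of "first_vars n"] divisor_closed_degree_below[of "Suc K"]
  unfolding divisor_closed_def window_def by blast

lemma x_monomial_outside:
  assumes \<mu>: "\<mu> \<in> partitions" and \<alpha>: "\<alpha> \<in> rearrangements \<mu>" "\<alpha> \<notin> bounded_exponents n K"
  shows "agree (window n K) (x_monomial \<alpha>) 0"
proof -
  note fin = rearrangement_finite_support[OF \<mu> \<alpha>(1)]
  have "\<not> (\<forall>i\<ge>n. \<alpha> i = 0) \<or> (\<exists>i. int K < \<alpha> i)"
    using \<alpha>(2) fin(2) by (auto simp: bounded_exponents_def not_le)
  then obtain i where i: "n \<le> i \<and> \<alpha> i \<noteq> 0 \<or> int K < \<alpha> i" by blast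
  then have nz: "\<alpha> i \<noteq> 0" by auto
  have split: "x_monomial \<alpha> = xvar i ^ nat (\<alpha> i) * (\<Prod>j\<in>{j. \<alpha> j \<noteq> 0} - {i}. xvar j ^ nat (\<alpha> j))"
    unfolding x_monomial_def by (rule prod.remove[OF fin(1)]) (use nz in simp)
  have "agree (window n K) (xvar i ^ nat (\<alpha> i)) 0"
  proof (cases "int K < \<alpha> i")
    case True
    have "agree (degree_below (nat (\<alpha> i))) (xvar i ^ nat (\<alpha> i)) 0"
      using agree_degree_below_power_zero[OF alphabet_degree_below[OF alphabet_xvar, of i], of "nat (\<alpha> i)"] by simp
    then have "agree (degree_below (Suc K)) (xvar i ^ nat (\<alpha> i)) 0"
      by (rule agree_degree_below_mono) (use True in linarith)
    then show ?thesis by (rule agree_mono) (simp add: window_def)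
  next
    case False
    then have "n \<le> i" "0 < nat (\<alpha> i)" using i nz fin(2)[of i] by auto
    have "agree (monomials_in (first_vars n)) (xvar i ^ nat (\<alpha> i)) (0 ^ nat (\<alpha> i))"
      by (intro agree_power divisor_closed_monomials_in alphabet_monomials_in alphabet_xvar \<open>n \<le> i\<close>)
    then have "agree (monomials_in (first_vars n)) (xvar i ^ nat (\<alpha> i)) 0"
      using \<open>0 < nat (\<alpha> i)\<close> by (simp add: power_0_left)
    then show ?thesis by (rule agree_mono) (simp add: window_def)
  qed
  then show ?thesis unfolding split by (intro agree_mult_zero divisor_closed_window)
qed

lemma ex_window: "\<exists>n K. d \<le> K \<and> m \<in> window n K"
proof -
  obtain n where "m \<in> monomials_in (first_vars n)" using ex_first_vars[of 0 m] by blast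
  then have "m \<in> window n (max d (mdeg m))" by (simp add: window_def degree_below_def)
  then show ?thesis by (intro exI[of _ n] exI[of _ "max d (mdeg m)"]) simp
qed

lemma monomial_sym_agree:
  assumes \<mu>: "\<mu> \<in> partitions"
  shows "agree (window n K) (monomial_sym xvar \<mu>) (\<Sum>\<alpha>\<in>rearrangements \<mu> \<inter> bounded_exponents n K. x_monomial \<alpha>)"
  unfolding agree_def monomial_sym_eq coeff_sum
proof
  fix m assume m: "m \<in> window n K"
  have out: "mps_coeff (x_monomial \<alpha>) a = 0" if "\<alpha> \<in> rearrangements \<mu>" "\<alpha> \<notin> bounded_exponents n' K'" "a \<in> window n' K'" for \<alpha> a n' K'
    using x_monomial_outside[OF \<mu> that(1,2)] that(3) by (simp add: agree_def)
  show "mps_coeff (infsum x_monomial (rearrangements \<mu>)) m = (\<Sum>\<alpha>\<in>rearrangements \<mu> \<inter> bounded_exponents n K. mps_coeff (x_monomial \<alpha>) m)"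
  proof (rule coeff_infsum)
    fix a
    obtain n' K' where "a \<in> window n' K'" using ex_window by blast
    then have "{\<alpha> \<in> rearrangements \<mu>. mps_coeff (x_monomial \<alpha>) a \<noteq> 0} \<subseteq> bounded_exponents n' K'" using out by blast
    then show "finite {\<alpha> \<in> rearrangements \<mu>. mps_coeff (x_monomial \<alpha>) a \<noteq> 0}" by (rule finite_subset) simp
  qed (use out m in auto)
qed

lemma prod_rearrangement:
  assumes "\<alpha> \<in> rearrangements \<mu>"
  shows "(\<Prod>i | \<alpha> i \<noteq> 0. q (\<alpha> i)) = (\<Prod>i | \<mu> i \<noteq> 0. q (\<mu> i))"
proof -
  obtain \<sigma> where \<sigma>: "bij \<sigma>" "\<alpha> = \<mu> \<circ> \<sigma>" using assms by (auto simp: rearrangements_def)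
  show ?thesis
  proof (rule prod.reindex_bij_witness[where i = "Hilbert_Choice.inv \<sigma>" and j = \<sigma>])
    fix i assume "i \<in> {i. \<alpha> i \<noteq> 0}"
    then show "Hilbert_Choice.inv \<sigma> (\<sigma> i) = i" "\<sigma> i \<in> {i. \<mu> i \<noteq> 0}" "q (\<mu> (\<sigma> i)) = q (\<alpha> i)"
      using \<sigma> by (auto simp: inv_f_f bij_is_inj)
  next
    fix i assume "i \<in> {i. \<mu> i \<noteq> 0}"
    then show "\<sigma> (Hilbert_Choice.inv \<sigma> i) = i" "Hilbert_Choice.inv \<sigma> i \<in> {i. \<alpha> i \<noteq> 0}"
      using \<sigma> by (auto simp: surj_f_inv_f bij_is_surj)
  qed
qed

text \<open>
  Multiplying out the truncated product \<open>\<Prod>\<^sub>i F(x\<^sub>i)\<close> gives one term for each exponent sequence. A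
  sequence has a unique sorted rearrangement \<open>\<mu>\<close>, and its coefficient is the same as for \<open>\<mu>\<close>; the
  terms with given \<open>\<mu>\<close> make up the truncated monomial symmetric function.
\<close>

lemma monomial_has_sum:
  fixes P :: "(nat + nat) mps"
  assumes q: "\<And>n r. agree (monomials_in (first_vars n)) (q r) (int_coeff (F n) r)" and F0: "\<And>n. fps_nth (F n) 0 = 1"
    and P: "\<And>n. agree (monomials_in (first_vars n)) P (\<Prod>i<n. G n i)"
    and G: "\<And>n K i. 0 < K \<Longrightarrow> agree (degree_below (Suc K)) (G n i) (\<Sum>r<Suc K. fps_nth (F n) r * xvar i ^ r)"
  shows "((\<lambda>\<mu>. monomial_sym xvar \<mu> * (\<Prod>i | \<mu> i \<noteq> 0. q (\<mu> i))) has_sum P) partitions"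
proof (rule has_sum_mpsI)
  fix m :: "(nat + nat) \<Rightarrow>\<^sub>0 nat"
  obtain n K where K: "1 \<le> K" and m: "m \<in> window n K" using ex_window by blast
  let ?f = "\<lambda>\<mu>. monomial_sym xvar \<mu> * (\<Prod>i | \<mu> i \<noteq> 0. q (\<mu> i))"
  let ?Q = "\<lambda>\<mu>. \<Prod>i | \<mu> i \<noteq> 0. int_coeff (F n) (\<mu> i)"
  let ?R = "\<lambda>\<mu>. rearrangements \<mu> \<inter> bounded_exponents n K"
  have on_window: "agree (window n K) f g" if "agree (monomials_in (first_vars n)) f g" for f g
    by (rule agree_mono[OF that]) (simp add: window_def)
  have f: "agree (window n K) (?f \<mu>) ((\<Sum>\<alpha>\<in>?R \<mu>. x_monomial \<alpha>) * ?Q \<mu>)" if "\<mu> \<in> partitions" for \<mu>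
    by (intro agree_mult agree_prod divisor_closed_window monomial_sym_agree[OF that] on_window q)
  have zero: "mps_coeff (?f \<mu>) m = 0" if "\<mu> \<in> partitions - boxed_partitions n K" for \<mu>
  proof -
    have "?R \<mu> = {}" using that rearrangement_in_exponents by blast
    then show ?thesis using f[of \<mu>] that m by (simp add: agree_def)
  qed
  have "(\<Prod>i<n. \<Sum>r<Suc K. fps_nth (F n) r * xvar i ^ r) =
     (\<Sum>f\<in>PiE {..<n} (\<lambda>_. {..<Suc K}). \<Prod>i<n. fps_nth (F n) (f i) * xvar i ^ f i)"
    by (rule prod_sum_PiE) simp_all
  also have "\<dots> = (\<Sum>f\<in>PiE {..<n} (\<lambda>_. {..<Suc K}).
      (\<lambda>\<alpha>. x_monomial \<alpha> * ?Q \<alpha>) (\<lambda>i. if i < n then int (f i) else 0))"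
  proof (rule sum.cong[OF refl])
    fix f :: "nat \<Rightarrow> nat"
    have "(\<Prod>i<n. fps_nth (F n) (f i) * xvar i ^ f i) = (\<Prod>i\<in>{i. i < n \<and> f i \<noteq> 0}. xvar i ^ f i * fps_nth (F n) (f i))"
      by (rule prod.mono_neutral_cong_right) (auto simp: F0 mult.commute)
    also have "\<dots> = (\<Prod>i\<in>{i. i < n \<and> f i \<noteq> 0}. xvar i ^ f i) * (\<Prod>i\<in>{i. i < n \<and> f i \<noteq> 0}. fps_nth (F n) (f i))"
      by (rule prod.distrib)
    also have "\<dots> = (\<lambda>\<alpha>. x_monomial \<alpha> * ?Q \<alpha>) (\<lambda>i. if i < n then int (f i) else 0)"
      unfolding x_monomial_def by (intro arg_cong2[where f = "(*)"] prod.cong) (auto simp: int_coeff_def)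
    finally show "(\<Prod>i<n. fps_nth (F n) (f i) * xvar i ^ f i) = \<dots>" .
  qed
  also have "\<dots> = (\<Sum>\<alpha>\<in>bounded_exponents n K. x_monomial \<alpha> * ?Q \<alpha>)"
    by (rule sum.reindex_bij_betw[OF bounded_exponents_bij])
  also have "bounded_exponents n K = (\<Union>\<mu>\<in>boxed_partitions n K. ?R \<mu>)" using bounded_exponents_rearrange by blast
  also have "(\<Sum>\<alpha>\<in>(\<Union>\<mu>\<in>boxed_partitions n K. ?R \<mu>). x_monomial \<alpha> * ?Q \<alpha>) = (\<Sum>\<mu>\<in>boxed_partitions n K. \<Sum>\<alpha>\<in>?R \<mu>. x_monomial \<alpha> * ?Q \<alpha>)"
  proof (rule sum.UNION_disjoint)
    show "\<forall>\<mu>\<in>boxed_partitions n K. \<forall>\<nu>\<in>boxed_partitions n K. \<mu> \<noteq> \<nu> \<longrightarrow> ?R \<mu> \<inter> ?R \<nu> = {}"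
      using rearrangements_disjoint boxed_partitions_subset by blast
  qed auto
  also have "\<dots> = (\<Sum>\<mu>\<in>boxed_partitions n K. (\<Sum>\<alpha>\<in>?R \<mu>. x_monomial \<alpha>) * ?Q \<mu>)"
    unfolding sum_distrib_right
    by (intro sum.cong refl arg_cong2[where f = "(*)"] prod_rearrangement) auto
  finally have expand: "(\<Prod>i<n. \<Sum>r<Suc K. fps_nth (F n) r * xvar i ^ r) =
      (\<Sum>\<mu>\<in>boxed_partitions n K. (\<Sum>\<alpha>\<in>?R \<mu>. x_monomial \<alpha>) * ?Q \<mu>)" .
  have "agree (window n K) P (\<Prod>i<n. G n i)" by (rule on_window[OF P])
  also have "agree (window n K) (\<Prod>i<n. G n i) (\<Prod>i<n. \<Sum>r<Suc K. fps_nth (F n) r * xvar i ^ r)"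
  proof (intro agree_prod divisor_closed_window)
    fix i show "agree (window n K) (G n i) (\<Sum>r<Suc K. fps_nth (F n) r * xvar i ^ r)"
      by (rule agree_mono[OF G]) (use K in \<open>simp_all add: window_def\<close>)
  qed
  also note expand
  also have "agree (window n K) (\<Sum>\<mu>\<in>boxed_partitions n K. (\<Sum>\<alpha>\<in>?R \<mu>. x_monomial \<alpha>) * ?Q \<mu>) (\<Sum>\<mu>\<in>boxed_partitions n K. ?f \<mu>)"
    by (rule agree_sum, rule agree_sym, rule f) (use boxed_partitions_subset in blast)
  finally have "mps_coeff P m = (\<Sum>\<mu>\<in>boxed_partitions n K. mps_coeff (?f \<mu>) m)"
    using m by (simp add: agree_def coeff_sum)
  then show "\<exists>B. finite B \<and> B \<subseteq> partitions \<and> (\<forall>\<mu>\<in>partitions - B. mps_coeff (?f \<mu>) m = 0) \<and>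
      (\<Sum>\<mu>\<in>B. mps_coeff (?f \<mu>) m) = mps_coeff P m"
    using zero boxed_partitions_subset by (intro exI[of _ "boxed_partitions n K"]) auto
qed

lemma monomial_complete_has_sum:
  "((\<lambda>\<mu>. monomial_sym xvar \<mu> * complete_seq yvar \<mu>) has_sum infprod (\<lambda>(i, j). 1 / (1 - xvar i * yvar j)) UNIV) partitions"
  unfolding complete_seq_def
proof (rule monomial_has_sum)
  show "agree (monomials_in (first_vars n)) (complete_sym yvar r) (int_coeff (complete_gen yvar n) r)" for n r
    by (rule complete_sym_agree) simp
  show "fps_nth (complete_gen yvar n) 0 = 1" for n by (simp add: complete_gen_def fps_nth_prod_0)
  show "agree (monomials_in (first_vars n)) (infprod (\<lambda>(i, j). 1 / (1 - xvar i * yvar j)) UNIV)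
     (\<Prod>i<n. \<Prod>j<n. 1 / (1 - yvar j * xvar i))" for n
    using complete_kernel(2)[of n] by (simp only: mult.commute)
  show "agree (degree_below (Suc K)) (\<Prod>j<n. 1 / (1 - yvar j * xvar i)) (\<Sum>r<Suc K. fps_nth (complete_gen yvar n) r * xvar i ^ r)" for n K i
    by (rule complete_gen_eval) simp_all
qed

lemma monomial_elementary_has_sum:
  "((\<lambda>\<mu>. monomial_sym xvar \<mu> * elementary_seq yvar \<mu>) has_sum infprod (\<lambda>(i, j). 1 + xvar i * yvar j) UNIV) partitions"
  unfolding elementary_seq_def
proof (rule monomial_has_sum)
  show "agree (monomials_in (first_vars n)) (elementary_sym yvar r) (int_coeff (elementary_gen yvar n) r)" for n r
    by (rule elementary_sym_agree) simp
  show "fps_nth (elementary_gen yvar n) 0 = 1" for n by (simp add: elementary_gen_def fps_nth_prod_0)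
  show "agree (monomials_in (first_vars n)) (infprod (\<lambda>(i, j). 1 + xvar i * yvar j) UNIV)
     (\<Prod>i<n. \<Prod>j<n. 1 + yvar j * xvar i)" for n
    using elementary_kernel(2)[of n] by (simp only: mult.commute)
  show "agree (degree_below (Suc K)) (\<Prod>j<n. 1 + yvar j * xvar i) (\<Sum>r<Suc K. fps_nth (elementary_gen yvar n) r * xvar i ^ r)"
    if "0 < K" for n K i
    by (rule elementary_gen_eval) (simp_all add: that)
qed

section \<open>The Cauchy identities\<close>

theorem mainTheorem10:
  shows
    "(\<lambda>(i, j). 1 / (1 - xvar i * yvar j)) multipliable_on UNIV
     \<and> ((\<lambda>\<mu>. schur xvar \<mu> * schur yvar \<mu>) has_sum
          infprod (\<lambda>(i, j). 1 / (1 - xvar i * yvar j)) UNIV) partitions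
     \<and> ((\<lambda>\<mu>. monomial_sym xvar \<mu> * complete_seq yvar \<mu>) has_sum
          infprod (\<lambda>(i, j). 1 / (1 - xvar i * yvar j)) UNIV) partitions
     \<and> (\<lambda>(i, j). 1 + xvar i * yvar j) multipliable_on UNIV
     \<and> ((\<lambda>\<mu>. schur xvar \<mu> * schur yvar (conjugate \<mu>)) has_sum
          infprod (\<lambda>(i, j). 1 + xvar i * yvar j) UNIV) partitions
     \<and> ((\<lambda>\<mu>. monomial_sym xvar \<mu> * elementary_seq yvar \<mu>) has_sum
          infprod (\<lambda>(i, j). 1 + xvar i * yvar j) UNIV) partitions"
  by (intro conjI complete_kernel(1) schur_schur_has_sum monomial_complete_has_sum
      elementary_kernel(1) schur_conjugate_has_sum monomial_elementary_has_sum)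

end
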